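(* Let $\mu_0,\mu_T\in\mathcal{P}_2(\mathbb{R}^d)$. Suppose the control system is a controllable linear time invariant system. Let $U=\mathbb{R}^n$ and let the running cost be $L(t,x,u)=\langle x,Qx\rangle+\langle u,Ru\rangle$ for some positive semidefinite matrix $Q\in\mathbb{R}^{d\times d}$ and positive definite matrix $R\in\mathbb{R}^{n\times n}$, for all $(t,x,u)\in I\times\mathbb{R}^d\times U$. Then the Benamou-Brenier problem and the convexified Benamou-Brenier problem are equivalent: $$C_{BB}(\mu_0,\mu_T)=C^{conv}_{BB}(\mu_0,\mu_T).$$
   Context: Let $d,n\ge1$, $T>0$, $I=[0,T]$. The control system is $\dot\omega(t)=f(\omega(t),u(t))$, $f(x,u)=f_0(x)+\sum_{i=1}^n u_i f_i(x)$. It is a controllable linear time invariant (LTI) system if $f_0(x)=Ax$ and $f_i(x)=b_i$ with $A\in\mathbb{R}^{d\times d}$, $b_i\in\mathbb{R}^d$, and with $B=[b_1,\dots,b_n]$ the Kalman rank condition ${\rm rank}[B\ AB\ \cdots\ A^{d-1}B]=d$ holds. $\mathcal{P}(\mathbb{R}^d)$ is the set of Borel probability measures with the narrow topology; $\mathcal{P}_p(\mathbb{R}^d)$ is the subset with finite $p$-th moment; $C([0,T];\mathcal{P}_1(\mathbb{R}^d))$ denotes narrowly continuous curves in $\mathcal{P}_1(\mathbb{R}^d)$. Benamou-Brenier problem: $C_{BB}(\mu_0,\mu_T)=\inf_{(u,\mu)}\int_I\int_{\mathbb{R}^d}L(t,x,u(t,x))\,d\mu_t(x)\,dt$ over measurable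 $u:I\times\mathbb{R}^d\to U$ and narrowly continuous curves $\mu:I\to\mathcal{P}(\mathbb{R}^d)$ with endpoints $\mu_0,\mu_T$ such that for all $\phi\in C^1_c(I\times\mathbb{R}^d)$ $$\int_I\int_{\mathbb{R}^d}[\partial_t\phi+\partial_x\phi\cdot f(x,u(t,x))]\,d\mu_t(x)\,dt=\int\phi(T,x)\,d\mu_T(x)-\int\phi(0,x)\,d\mu_0(x).$$ Convexified problem: write $L(t,x,u)=s(x)+\psi(u)$ (here $s(x)=\langle x,Qx\rangle$, $\psi(u)=\langle u,Ru\rangle$). Let $\mathcal{M}([0,T]\times\mathbb{R}^d;\mathbb{R}^n)$ be the $\mathbb{R}^n$-valued Borel measures on $[0,T]\times\mathbb{R}^d$. Define $K(a,b)=b\,\psi(a/b)$ if $b>0$; $K(0,0)=0$; $K(a,b)=+\infty$ if $b<0$, or if $b=0$ and $a\ne0$. For $(m,\mu)\in\mathcal{M}([0,T]\times\mathbb{R}^d;\mathbb{R}^n)\times C([0,T];\mathcal{P}_1(\mathbb{R}^d))$ set $$\mathcal{F}(m,\mu)=\int_0^T\!\!\int_{\mathbb{R}^d}s(x)\,d\mu_t(x)\,dt+\int_0^T\!\!\int_{\mathbb{R}^d}K(m(t,x),\mu_t(x))\,dx\,dt$$ if both $m$ and $d\mu_t(x)dt$ are absolutely continuous with respect to $dx\,dt$ (with densities $m(t,x)$ and $\mu_t(x)$), and $\mathcal{F}(m,\mu)=+\infty$ otherwise. Let $AD(\mu_0,\mu_T)$ be the set of $(m,\mu)$ such that $m$ is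 absolutely continuous with respect to $d\mu_t(x)dt$, $\mu$ has endpoints $\mu_0,\mu_T$, and the displayed weak continuity equation holds for all $\phi\in C^1_c(I\times\mathbb{R}^d)$ with $u(t,x)$ replaced by the density $\frac{dm}{d\mu}(t,x)$ of $m$ with respect to $d\mu_t(x)dt$. Then $C^{conv}_{BB}(\mu_0,\mu_T)=\inf_{(m,\mu)\in AD(\mu_0,\mu_T)}\mathcal{F}(m,\mu)$. *)

theory Defs
  imports "HOL-Probability.Probability"
begin

definition control_affine ::
  "(real^'d \<Rightarrow> real^'d) \<Rightarrow> ('n::finite \<Rightarrow> real^'d \<Rightarrow> real^'d) \<Rightarrow> real^'d \<Rightarrow> real^'n \<Rightarrow> real^'d" where
  "control_affine f0 fs x u = f0 x + (\<Sum>i\<in>UNIV. (u $ i) *\<^sub>R fs i x)"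

text \<open>
  The \<open>d \<times> nd\<close> block matrix \<open>[B AB \<dots> A\<^sup>d\<^sup>-\<^sup>1B]\<close>. Its columns are indexed by pairs \<open>(k, i)\<close>, where
  \<^term>\<open>to_nat_on (UNIV :: 'd set)\<close> is a bijection from the index type onto \<open>{..<d}\<close>; column \<open>(k, i)\<close>
  is column \<open>i\<close> of \<open>A\<^sup>kB\<close>. The order of the columns does not affect the rank. Powers of \<open>A\<close> are
  iterated \<^term>\<open>(**)\<close>, since \<open>(^)\<close> on \<^typ>\<open>real^'d^'d\<close> is not the matrix power.
\<close>
definition kalman_matrix :: "real^'d^'d \<Rightarrow> real^'n^'d \<Rightarrow> real^('d \<times> 'n)^'d" where
  "kalman_matrix A B =
    (\<chi> r c. (((**) A ^^ to_nat_on (UNIV :: 'd set) (fst c)) B) $ r $ snd c)"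

definition controllable_LTI ::
  "(real^'d \<Rightarrow> real^'d) \<Rightarrow> ('n::finite \<Rightarrow> real^'d \<Rightarrow> real^'d) \<Rightarrow> bool" where
  "controllable_LTI f0 fs \<longleftrightarrow>
    (\<exists>(A :: real^'d^'d) (b :: 'n \<Rightarrow> real^'d).
      (\<forall>x. f0 x = A *v x) \<and> (\<forall>i x. fs i x = b i) \<and>
      rank (kalman_matrix A (\<chi> r i. b i $ r)) = CARD('d))"

definition prob_measures :: "'a::topological_space measure set" where
  "prob_measures = {M. sets M = sets borel \<and> prob_space M}"

definition prob_measures_moment :: "real \<Rightarrow> 'a::real_normed_vector measure set" where
  "prob_measures_moment p = {M \<in> prob_measures. integrable M (\<lambda>x. norm x powr p)}"

text \<open>The narrow topology is the initial topology of the maps \<open>M \<mapsto> \<integral>g dM\<close>, \<open>g\<close> bounded continuous.\<close>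
definition narrowly_continuous_on :: "real set \<Rightarrow> (real \<Rightarrow> 'a::topological_space measure) \<Rightarrow> bool" where
  "narrowly_continuous_on I \<mu> \<longleftrightarrow>
    (\<forall>g :: 'a \<Rightarrow> real. continuous_on UNIV g \<longrightarrow> bounded (range g) \<longrightarrow>
      continuous_on I (\<lambda>t. \<integral>x. g x \<partial>\<mu> t))"

text \<open>\<open>dt dx\<close> on \<open>[0,T] \<times> \<real>\<^sup>d\<close>, with the Borel sigma-algebra.\<close>
definition spacetime :: "real \<Rightarrow> (real \<times> (real^'d)) measure" where
  "spacetime T = restrict_space lborel ({0..T} \<times> UNIV)"

text \<open>
  \<open>d\<mu>\<^sub>t(x) dt\<close> on \<open>[0,T] \<times> \<real>\<^sup>d\<close>: the mixture over \<open>t \<in> [0,T]\<close> of the measures \<open>\<delta>\<^sub>t \<otimes> \<mu>\<^sub>t\<close>. A narrowly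
  continuous curve is a measurable kernel, so that \<open>emeasure_bind\<close> and \<open>nn_integral_bind\<close>
  apply.
\<close>
definition curve_measure :: "real \<Rightarrow> (real \<Rightarrow> (real^'d) measure) \<Rightarrow> (real \<times> (real^'d)) measure" where
  "curve_measure T \<mu> =
    restrict_space lborel {0..T} \<bind> (\<lambda>t. distr (\<mu> t) (spacetime T) (Pair t))"

text \<open>
  \<open>\<phi> \<in> C\<^sup>1\<^sub>c([0,T] \<times> \<real>\<^sup>d)\<close> with \<open>\<partial>\<^sub>t\<phi> = \<phi>t\<close> and \<open>\<partial>\<^sub>x\<phi> = \<phi>x\<close>. The support may meet the times \<open>0\<close> and \<open>T\<close>,
  where the time derivative is one-sided.
\<close>
definition C1c_test ::
  "real \<Rightarrow> (real \<times> (real^'d) \<Rightarrow> real) \<Rightarrow> (real \<times> (real^'d) \<Rightarrow> real) \<Rightarrow> (real \<times> (real^'d) \<Rightarrow> real^'d) \<Rightarrow> bool" where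
  "C1c_test T \<phi> \<phi>t \<phi>x \<longleftrightarrow>
    (\<forall>z \<in> {0..T} \<times> UNIV.
      (\<phi> has_derivative (\<lambda>(h, k). h * \<phi>t z + \<phi>x z \<bullet> k)) (at z within {0..T} \<times> UNIV)) \<and>
    continuous_on ({0..T} \<times> UNIV) \<phi>t \<and> continuous_on ({0..T} \<times> UNIV) \<phi>x \<and>
    (\<exists>S. compact S \<and> (\<forall>z \<in> {0..T} \<times> UNIV - S. \<phi> z = 0))"

text \<open>
  The integrability clause says that the left-hand side is meaningful: the Bochner integral of a
  non-integrable function is \<open>0\<close> by convention.
\<close>
definition continuity_equation ::
  "real \<Rightarrow> (real^'d \<Rightarrow> real^'n \<Rightarrow> real^'d) \<Rightarrow> (real \<times> (real^'d) \<Rightarrow> real^'n) \<Rightarrow>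
    (real \<Rightarrow> (real^'d) measure) \<Rightarrow> bool" where
  "continuity_equation T f u \<mu> \<longleftrightarrow>
    (\<forall>\<phi> \<phi>t \<phi>x. C1c_test T \<phi> \<phi>t \<phi>x \<longrightarrow>
      integrable (curve_measure T \<mu>) (\<lambda>(t, x). \<phi>t (t, x) + \<phi>x (t, x) \<bullet> f x (u (t, x))) \<and>
      (\<integral>t\<in>{0..T}. (\<integral>x. \<phi>t (t, x) + \<phi>x (t, x) \<bullet> f x (u (t, x)) \<partial>\<mu> t) \<partial>lborel)
        = (\<integral>x. \<phi> (T, x) \<partial>\<mu> T) - (\<integral>x. \<phi> (0, x) \<partial>\<mu> 0))"

definition BB_admissible ::
  "real \<Rightarrow> (real^'d \<Rightarrow> real^'n \<Rightarrow> real^'d) \<Rightarrow> (real^'n) set \<Rightarrow>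
    (real^'d) measure \<Rightarrow> (real^'d) measure \<Rightarrow>
    ((real \<times> (real^'d) \<Rightarrow> real^'n) \<times> (real \<Rightarrow> (real^'d) measure)) set" where
  "BB_admissible T f U \<mu>0 \<mu>T = {(u, \<mu>).
     u \<in> measurable (restrict_space borel ({0..T} \<times> UNIV)) (restrict_space borel U) \<and>
     (\<forall>t\<in>{0..T}. \<mu> t \<in> prob_measures) \<and> narrowly_continuous_on {0..T} \<mu> \<and>
     \<mu> 0 = \<mu>0 \<and> \<mu> T = \<mu>T \<and>
     continuity_equation T f u \<mu>}"

text \<open>Running costs are nonnegative, so integrals of costs are taken in \<^typ>\<open>ennreal\<close>.\<close>
definition BB_cost ::
  "real \<Rightarrow> (real^'d \<Rightarrow> real^'n \<Rightarrow> real^'d) \<Rightarrow> (real^'n) set \<Rightarrow>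
    (real \<Rightarrow> real^'d \<Rightarrow> real^'n \<Rightarrow> real) \<Rightarrow> (real^'d) measure \<Rightarrow> (real^'d) measure \<Rightarrow> ennreal" where
  "BB_cost T f U L \<mu>0 \<mu>T =
    (INF (u, \<mu>) \<in> BB_admissible T f U \<mu>0 \<mu>T.
      \<integral>\<^sup>+t\<in>{0..T}. (\<integral>\<^sup>+x. ennreal (L t x (u (t, x))) \<partial>\<mu> t) \<partial>lborel)"

definition vector_measure :: "'a measure \<Rightarrow> ('a set \<Rightarrow> 'b::real_normed_vector) \<Rightarrow> bool" where
  "vector_measure M m \<longleftrightarrow>
    (\<forall>A :: nat \<Rightarrow> 'a set. range A \<subseteq> sets M \<longrightarrow> disjoint_family A \<longrightarrow>
      (\<lambda>i. m (A i)) sums m (\<Union>i. A i))"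

definition vector_abs_continuous :: "'a measure \<Rightarrow> ('a set \<Rightarrow> 'b::real_normed_vector) \<Rightarrow> bool" where
  "vector_abs_continuous M m \<longleftrightarrow> (\<forall>E \<in> null_sets M. m E = 0)"

definition is_vector_density ::
  "'a measure \<Rightarrow> ('a set \<Rightarrow> 'b::{banach, second_countable_topology}) \<Rightarrow> ('a \<Rightarrow> 'b) \<Rightarrow> bool" where
  "is_vector_density M m w \<longleftrightarrow>
    integrable M w \<and> (\<forall>E \<in> sets M. m E = (\<integral>z\<in>E. w z \<partial>M))"

definition vector_RN_deriv ::
  "'a measure \<Rightarrow> ('a set \<Rightarrow> 'b::{banach, second_countable_topology}) \<Rightarrow> 'a \<Rightarrow> 'b" where
  "vector_RN_deriv M m = (SOME w. is_vector_density M m w)"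

definition perspective :: "('b::real_vector \<Rightarrow> real) \<Rightarrow> 'b \<Rightarrow> real \<Rightarrow> ennreal" where
  "perspective \<psi> a b =
    (if b > 0 then ennreal (b * \<psi> (a /\<^sub>R b)) else if a = 0 \<and> b = 0 then 0 else \<infinity>)"

definition conv_functional ::
  "real \<Rightarrow> (real^'d \<Rightarrow> real) \<Rightarrow> (real^'n \<Rightarrow> real) \<Rightarrow>
    ((real \<times> (real^'d)) set \<Rightarrow> real^'n) \<Rightarrow> (real \<Rightarrow> (real^'d) measure) \<Rightarrow> ennreal" where
  "conv_functional T s \<psi> m \<mu> =
    (if vector_abs_continuous (spacetime T) m \<and>
        absolutely_continuous (spacetime T) (curve_measure T \<mu>)
     then (\<integral>\<^sup>+t\<in>{0..T}. (\<integral>\<^sup>+x. ennreal (s x) \<partial>\<mu> t) \<partial>lborel) +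
          (\<integral>\<^sup>+t\<in>{0..T}. (\<integral>\<^sup>+x. perspective \<psi>
              (vector_RN_deriv (spacetime T) m (t, x))
              (enn2real (RN_deriv (spacetime T) (curve_measure T \<mu>) (t, x))) \<partial>lborel) \<partial>lborel)
     else \<infinity>)"

text \<open>The density \<open>u = dm/d\<mu>\<close> is determined almost everywhere; the equation does not depend on its version.\<close>
definition conv_admissible ::
  "real \<Rightarrow> (real^'d \<Rightarrow> real^'n \<Rightarrow> real^'d) \<Rightarrow> (real^'d) measure \<Rightarrow> (real^'d) measure \<Rightarrow>
    (((real \<times> (real^'d)) set \<Rightarrow> real^'n) \<times> (real \<Rightarrow> (real^'d) measure)) set" where
  "conv_admissible T f \<mu>0 \<mu>T = {(m, \<mu>).
     vector_measure (spacetime T) m \<and>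
     (\<forall>t\<in>{0..T}. \<mu> t \<in> prob_measures_moment 1) \<and> narrowly_continuous_on {0..T} \<mu> \<and>
     vector_abs_continuous (curve_measure T \<mu>) m \<and>
     \<mu> 0 = \<mu>0 \<and> \<mu> T = \<mu>T \<and>
     (\<exists>u. is_vector_density (curve_measure T \<mu>) m u \<and> continuity_equation T f u \<mu>)}"

definition conv_BB_cost ::
  "real \<Rightarrow> (real^'d \<Rightarrow> real^'n \<Rightarrow> real^'d) \<Rightarrow> (real^'d \<Rightarrow> real) \<Rightarrow> (real^'n \<Rightarrow> real) \<Rightarrow>
    (real^'d) measure \<Rightarrow> (real^'d) measure \<Rightarrow> ennreal" where
  "conv_BB_cost T f s \<psi> \<mu>0 \<mu>T =
    (INF (m, \<mu>) \<in> conv_admissible T f \<mu>0 \<mu>T. conv_functional T s \<psi> m \<mu>)"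

end

theory Submission
  imports Defs
begin

text \<open>
  An admissible pair of the convexified problem gives an admissible control of equal cost, because
  \<open>K(u\<rho>, \<rho>) = \<rho> \<psi>(u)\<close>. For the converse, a curve \<open>\<mu>\<close> of finite cost need not have densities, so it is
  regularised without moving its endpoints: let \<open>\<mu>\<^sup>\<delta>\<^sub>t\<close> be the law of \<open>X + \<delta> S(t) \<theta>\<close>, where \<open>X \<sim> \<mu>\<^sub>t\<close> and
  \<open>\<theta>\<close> is independent and uniform on a cube, and where \<open>S\<close> is a matrix of polynomials with
  \<open>S' = A S + B V\<close>, \<open>S(0) = S(T) = 0\<close> and \<open>det S \<noteq> 0\<close>; such an \<open>S\<close> exists by controllability. As
  \<open>S(t)\<close> is invertible for all but finitely many \<open>t\<close>, the law of the sum has a density. By linearity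
  \<open>\<mu>\<^sup>\<delta>\<close> solves the continuity equation with the control \<open>E[u(t, X) + \<delta> V(t) \<theta> | X + \<delta> S(t) \<theta>]\<close>, whose
  cost is, by Jensen's inequality, at most \<open>(1 + \<delta>) (cost + \<delta> C)\<close>. Finiteness of first moments at
  all times follows from the continuity equation, tested with truncations of \<open>\<bar>x\<bar>\<close>.
\<close>

section \<open>Loops of a controllable linear system\<close>

text \<open>Convolving every \<mu>_t with one fixed kernel fails twice: it moves the endpoints, and
  a constant displacement h leaves a defect A h in the equation, which no control absorbs unless A h
  lies in the range of B. The displacement must therefore be a trajectory of the same system, and a
  closed one. It vanishes at both ends, so the law of the sum may be singular there; this is
  harmless, because the convexified functional asks for a density of the space-time measure only,
  and a null set of times can be given up. Polynomials keep that set finite: det S is a polynomial,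
  and a single time with det S nonzero suffices. Conditioning on the sum is forced because a control
  is a function of time and position, while the driving term depends on X and \<theta> separately.
  First moments are an issue because the convexified problem demands them at all times, whereas the
  original problem prescribes them at the endpoints alone.\<close>

lemma column_funpow_matrix_mult:
  fixes A :: "real^'d^'d" and B :: "real^'n^'d"
  shows "column i (((**) A ^^ k) B) = ((*v) A ^^ k) (column i B)"
proof (induction k)
  case (Suc k)
  have "column i (A ** C) = A *v column i C" for C :: "real^'n^'d"
    by (simp add: vec_eq_iff column_def matrix_matrix_mult_def matrix_vector_mult_def)
  with Suc show ?case by simp
qed simp

text \<open>Full row rank makes \<open>?K\<close> surjective, so \<xi> itself equals some
  \<open>?K *v y\<close>. As \<xi> annihilates every column of \<open>?K\<close>, it follows that
  \<xi> \<bullet> \<xi> = 0.\<close>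

lemma kalman_orthogonal_eq_0:
  fixes A :: "real^'d^'d" and B :: "real^'n^'d"
  assumes rank: "rank (kalman_matrix A B) = CARD('d)"
    and orth: "\<And>k i. k < CARD('d) \<Longrightarrow> \<xi> \<bullet> ((*v) A ^^ k) (column i B) = 0"
  shows "\<xi> = 0"
proof -
  let ?K = "kalman_matrix A B"
  have "(\<xi> v* ?K) $ c = 0" for c
  proof -
    let ?k = "to_nat_on (UNIV :: 'd set) (fst c)"
    have "?k < CARD('d)"
      using to_nat_on_finite[of "UNIV :: 'd set"] by (auto simp: bij_betw_def)
    then have "\<xi> \<bullet> column (snd c) (((**) A ^^ ?k) B) = 0"
      using orth by (simp add: column_funpow_matrix_mult)
    then show ?thesis
      by (simp add: vector_matrix_mult_def kalman_matrix_def inner_vec_def column_def mult.commute)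
  qed
  then have "\<xi> v* ?K = 0" by (simp add: vec_eq_iff)
  then have *: "\<xi> \<bullet> (?K *v y) = 0" for y
    by (metis dot_lmul_matrix inner_zero_left)
  obtain y where "?K *v y = \<xi>"
    using rank full_rank_surjective[of ?K] by (metis surjD)
  with *[of y] show ?thesis by simp
qed

text \<open>The coefficients are indexed by \<open>k\<close> and not by vectors, because
  \<open>x\<close> need not be injective and the later recursion runs over exponents.\<close>

lemma in_span_image_lessThanD:
  fixes x :: "nat \<Rightarrow> 'a::real_vector"
  assumes "y \<in> span (x ` {..<n})"
  shows "\<exists>c. y = (\<Sum>k<n. c k *\<^sub>R x k)"
  using assms
proof (induction n arbitrary: y)
  case (Suc n)
  then obtain a where "y - a *\<^sub>R x n \<in> span (x ` {..<n})"
    by (auto simp: lessThan_Suc span_breakdown_eq)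
  then obtain c where c: "y - a *\<^sub>R x n = (\<Sum>k<n. c k *\<^sub>R x k)" using Suc.IH by blast
  have "y = (\<Sum>k<Suc n. (c(n := a)) k *\<^sub>R x k)"
    using c by (simp add: algebra_simps)
  then show ?case by blast
qed simp

text \<open>The vectors \<open>A^k b\<close> cannot all be independent, so some \<open>A^D b\<close>
  depends on its predecessors, and applying A carries the dependence to every later exponent. A late
  relation is wanted: p \<ge> CARD('d) puts all exponents of the Kalman matrix among 0, ...,
  p.\<close>

lemma krylov_dependent:
  fixes A :: "real^'d^'d" and b :: "real^'d"
  shows "\<exists>p\<ge>m. \<exists>c. ((*v) A ^^ Suc p) b = (\<Sum>k<Suc p. c k *\<^sub>R ((*v) A ^^ k) b)"
proof -
  define x where "x k = ((*v) A ^^ k) b" for k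
  have "\<exists>D. x D \<in> span (x ` {..<D})"
  proof (rule ccontr)
    assume no: "\<not> ?thesis"
    have "independent (x ` {..<n}) \<and> card (x ` {..<n}) = n" for n
    proof (induction n)
      case (Suc n)
      have "x n \<notin> span (x ` {..<n})" using no by blast
      then have "x n \<notin> x ` {..<n}" by (rule contra_subsetD[OF span_superset])
      then have "card (insert (x n) (x ` {..<n})) = Suc n"
        by (subst card_insert_disjoint) (use Suc in \<open>auto simp only: finite_imageI finite_lessThan\<close>)
      moreover have "independent (insert (x n) (x ` {..<n}))"
        using independent_insertI[OF \<open>x n \<notin> span (x ` {..<n})\<close>] Suc by simp
      ultimately show ?case unfolding lessThan_Suc image_insert by blast
    qed (simp add: independent_empty)
    then show False using independent_bound[of "x ` {..<Suc (DIM(real^'d))}"]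
      by (metis Suc_n_not_le_n)
  qed
  then obtain D where D: "x D \<in> span (x ` {..<D})" by blast
  have step: "x (Suc n) \<in> span (x ` {..<Suc n})" if "x n \<in> span (x ` {..<n})" for n
  proof -
    have "A *v x n \<in> span ((*v) A ` (x ` {..<n}))"
      unfolding linear_span_image[OF matrix_vector_mul_linear] by (rule imageI) (rule that)
    moreover have "(*v) A ` (x ` {..<n}) \<subseteq> x ` {..<Suc n}"
    proof clarify
      fix k assume "k < n"
      then show "A *v x k \<in> x ` {..<Suc n}" by (intro image_eqI[of _ _ "Suc k"]) (auto simp: x_def)
    qed
    ultimately have "A *v x n \<in> span (x ` {..<Suc n})" by (rule subsetD[OF span_mono, rotated])
    then show ?thesis by (simp add: x_def)
  qed
  have "x (D + n) \<in> span (x ` {..<D + n})" for n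
  proof (induction n)
    case (Suc n)
    then show ?case using step[of "D + n"] unfolding add_Suc_right by blast
  qed (use D in simp)
  from in_span_image_lessThanD[OF this[of "Suc m"]]
  obtain c where "x (Suc (D + m)) = (\<Sum>k<Suc (D + m). c k *\<^sub>R x k)" by auto
  then show ?thesis unfolding x_def by (intro exI[of _ "D + m"] conjI exI[of _ c]) (rule le_add2)
qed

text \<open>Let z have the coordinate g_j along \<open>A^(p-j) b\<close>, and let c be the
  coefficients of the Krylov relation. Comparing coefficients in z' = A z + B v gives g_0 = w and
  g_(j+1) = g_j' - c_(p-j) w. This is the recursion with \<open>e j = - c (p - j)\<close>; its entry
  of index p + 1 is the scalar control.\<close>

primrec flat_chain :: "(nat \<Rightarrow> real) \<Rightarrow> real poly \<Rightarrow> nat \<Rightarrow> real poly" where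
  "flat_chain e w 0 = w"
| "flat_chain e w (Suc j) = pderiv (flat_chain e w j) + smult (e j) w"

text \<open>Each step costs at most one order of vanishing at \<open>a\<close>: differentiation
  lowers the order by one, and the added multiple of w vanishes to the full order n. If s is nonzero
  at \<open>a\<close>, the order drops by exactly one, since the cofactor at \<open>a\<close> is
  only multiplied by a positive integer. The first half closes the loops at 0 and T; the second
  controls which coordinate is the first nonzero one at an intermediate time.\<close>

lemma flat_chain_factor:
  assumes w: "w = [:- a, 1:] ^ n * s" and "j \<le> n"
  shows "\<exists>s'. flat_chain e w j = [:- a, 1:] ^ (n - j) * s' \<and> (poly s a \<noteq> 0 \<longrightarrow> poly s' a \<noteq> 0)"
  using \<open>j \<le> n\<close>
proof (induction j)
  case (Suc j)
  define l where "l = [:- a, 1:]"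
  obtain s' where s': "flat_chain e w j = l ^ (n - j) * s'" "poly s a \<noteq> 0 \<Longrightarrow> poly s' a \<noteq> 0"
    using Suc by (auto simp: l_def)
  define m where "m = n - Suc j"
  have m: "n - j = Suc m" "n = Suc j + m" using Suc.prems by (auto simp: m_def)
  have l: "pderiv l = 1" "poly l a = 0" by (simp_all add: l_def pderiv_pCons)
  have d: "pderiv (l ^ Suc m * s') = l ^ m * (l * pderiv s' + smult (Suc m) s')"
    unfolding pderiv_mult pderiv_power_Suc l by (simp add: algebra_simps del: of_nat_Suc)
  have w': "w = l ^ m * (l ^ Suc j * s)"
    unfolding w m(2) l_def[symmetric] by (simp add: power_add mult_ac)
  have "flat_chain e w (Suc j) = pderiv (l ^ Suc m * s') + smult (e j) (l ^ m * (l ^ Suc j * s))"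
    using s'(1) w' m by simp
  then have "flat_chain e w (Suc j) = l ^ m * (l * pderiv s' + smult (Suc m) s' + smult (e j) (l ^ Suc j * s))"
    unfolding d by (simp add: distrib_left del: power_Suc)
  moreover have "poly (l * pderiv s' + smult (Suc m) s' + smult (e j) (l ^ Suc j * s)) a = Suc m * poly s' a"
    using l(2) by simp
  ultimately show ?case using s'(2) unfolding m_def[symmetric] l_def[symmetric]
    by (metis mult_eq_0_iff of_nat_eq_0_iff nat.distinct(1))
qed (use w in auto)

text \<open>Polynomial coordinates are demanded so that a matrix of loops has a polynomial
  determinant. Of the control, continuity is enough.\<close>

definition poly_loop :: "real \<Rightarrow> real^'d^'d \<Rightarrow> real^'n^'d \<Rightarrow> (real \<Rightarrow> real^'d) \<Rightarrow> (real \<Rightarrow> real^'n) \<Rightarrow> bool" where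
  "poly_loop T A B z v \<longleftrightarrow> (\<exists>P. \<forall>t r. z t $ r = poly (P r) t) \<and> continuous_on UNIV v \<and>
     (\<forall>t. (z has_vector_derivative A *v z t + B *v v t) (at t)) \<and> z 0 = 0 \<and> z T = 0"

text \<open>The loop is flat: with \<open>w\<close> as flat output, its coordinates along \<open>A\<^sup>p b, \<dots>, b\<close> are \<open>w\<close> and
  the successive combinations of derivatives of \<open>w\<close> forced by the relation satisfied by \<open>A\<^sup>p\<^sup>+\<^sup>1 b\<close>.\<close>
lemma flat_chain_loop:
  fixes A :: "real^'d^'d" and B :: "real^'n^'d"
  assumes c: "((*v) A ^^ Suc p) (column i B) = (\<Sum>k<Suc p. c k *\<^sub>R ((*v) A ^^ k) (column i B))"
    and w: "w = [:0, 1:] ^ Suc p * s1" "w = [:- T, 1:] ^ Suc p * s2"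
    and z: "z = (\<lambda>t. \<Sum>j<Suc p. poly (flat_chain (\<lambda>j. - c (p - j)) w j) t *\<^sub>R ((*v) A ^^ (p - j)) (column i B))"
    and v: "v = (\<lambda>t. poly (flat_chain (\<lambda>j. - c (p - j)) w (Suc p)) t *\<^sub>R axis i 1)"
  shows "poly_loop T A B z v"
proof -
  define x where "x k = ((*v) A ^^ k) (column i B)" for k
  define g where "g = flat_chain (\<lambda>j. - c (p - j)) w"
  have z: "z t = (\<Sum>j<Suc p. poly (g j) t *\<^sub>R x (p - j))" for t
    by (simp add: z x_def g_def)
  have Bv: "B *v v t = poly (g (Suc p)) t *\<^sub>R x 0" for t
    by (simp add: v x_def g_def matrix_vector_mult_basis matrix_vector_mult_scaleR)
  have poly: "\<exists>P. \<forall>t r. z t $ r = poly (P r) t"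
    by (intro exI[of _ "\<lambda>r. \<Sum>j<Suc p. smult (x (p - j) $ r) (g j)"])
       (simp add: z poly_sum mult.commute del: sum.lessThan_Suc)
  have der: "(z has_vector_derivative A *v z t + B *v v t) (at t)" for t
  proof -
    have 1: "(z has_vector_derivative (\<Sum>j<Suc p. poly (pderiv (g j)) t *\<^sub>R x (p - j))) (at t)"
      unfolding z[abs_def]
      by (intro has_vector_derivative_sum)
         (auto intro!: derivative_eq_intros simp: has_real_derivative_iff_has_vector_derivative[symmetric] poly_DERIV)
    have "(\<Sum>j<Suc p. poly (pderiv (g j)) t *\<^sub>R x (p - j))
        = (\<Sum>j<Suc p. poly (g (Suc j)) t *\<^sub>R x (p - j)) + poly w t *\<^sub>R (\<Sum>j<Suc p. c (p - j) *\<^sub>R x (p - j))"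
      unfolding sum_distrib_left scaleR_right.sum sum.distrib[symmetric]
      by (intro sum.cong refl) (simp add: g_def algebra_simps)
    also have "(\<Sum>j<Suc p. c (p - j) *\<^sub>R x (p - j)) = (\<Sum>k<Suc p. c k *\<^sub>R x k)"
      by (rule sum.reindex_bij_witness[of _ "\<lambda>k. p - k" "\<lambda>k. p - k"]) auto
    also have "\<dots> = x (Suc p)" using c by (simp add: x_def)
    \<comment> \<open>The summand \<open>j = p\<close> of the first sum carries
      \<open>x 0 = column i B\<close> and is exactly \<open>B *v v t\<close>.\<close>
    finally have 2: "(\<Sum>j<Suc p. poly (pderiv (g j)) t *\<^sub>R x (p - j))
        = (\<Sum>j<p. poly (g (Suc j)) t *\<^sub>R x (p - j)) + B *v v t + poly w t *\<^sub>R x (Suc p)"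
      by (simp add: Bv)
    have "A *v z t = (\<Sum>j<Suc p. poly (g j) t *\<^sub>R x (Suc (p - j)))"
      unfolding z by (simp add: linear_sum[OF matrix_vector_mul_linear] matrix_vector_mult_scaleR x_def del: sum.lessThan_Suc)
    also have "\<dots> = poly w t *\<^sub>R x (Suc p) + (\<Sum>j<p. poly (g (Suc j)) t *\<^sub>R x (p - j))"
      unfolding sum.lessThan_Suc_shift by (auto simp: g_def Suc_diff_Suc intro!: sum.cong)
    finally show ?thesis using 1 unfolding 2 by (simp add: algebra_simps)
  qed
  \<comment> \<open>A zero of order p + 1 keeps at least one factor after the at most p steps that
    lead to a coordinate of z.\<close>
  have root: "poly (g j) a = 0" if w: "w = [:- a, 1:] ^ Suc p * s" and j: "j < Suc p" for a s j
  proof -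
    obtain s' where "g j = [:- a, 1:] ^ (Suc p - j) * s'"
      using flat_chain_factor[OF w, of j] j unfolding g_def by auto
    then show ?thesis using j by (simp add: poly_power)
  qed
  have "z 0 = 0" "z T = 0"
    using root[of 0 s1] root[of T s2] w by (simp_all add: z del: sum.lessThan_Suc)
  then show ?thesis
    unfolding poly_loop_def using poly der v by (auto intro!: continuous_intros)
qed

section \<open>The vector space of loops and the points they pass through\<close>

lemma poly_loop_add:
  assumes "poly_loop T A B z v" "poly_loop T A B z' v'"
  shows "poly_loop T A B (\<lambda>t. z t + z' t) (\<lambda>t. v t + v' t)"
proof -
  obtain P P' where P: "\<And>t r. z t $ r = poly (P r) t" "\<And>t r. z' t $ r = poly (P' r) t"
    using assms unfolding poly_loop_def by metis
  have "\<exists>P. \<forall>t r. (z t + z' t) $ r = poly (P r) t"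
    by (intro exI[of _ "\<lambda>r. P r + P' r"]) (simp add: P)
  then show ?thesis using assms unfolding poly_loop_def
    by (auto intro!: continuous_intros derivative_eq_intros simp: matrix_vector_right_distrib)
qed

lemma poly_loop_scaleR:
  assumes "poly_loop T A B z v"
  shows "poly_loop T A B (\<lambda>t. a *\<^sub>R z t) (\<lambda>t. a *\<^sub>R v t)"
proof -
  obtain P where P: "\<And>t r. z t $ r = poly (P r) t"
    using assms unfolding poly_loop_def by metis
  have "\<exists>P. \<forall>t r. (a *\<^sub>R z t) $ r = poly (P r) t"
    by (intro exI[of _ "\<lambda>r. smult a (P r)"]) (simp add: P)
  then show ?thesis using assms unfolding poly_loop_def
    by (auto intro!: continuous_intros derivative_eq_intros simp: matrix_vector_mult_scaleR scaleR_right_distrib)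
qed

lemma poly_loop_zero: "poly_loop T A B (\<lambda>t. 0) (\<lambda>t. 0)"
  unfolding poly_loop_def by (auto intro: exI[of _ "\<lambda>_. 0"])

text \<open>The points reached at t0 form a subspace E, so it suffices that every \<xi> orthogonal
  to E vanishes. A flat output with a zero of order exactly j = p - k at t0 yields a loop whose
  coordinates of index below j vanish at t0, so \<xi> sees only \<open>A^k b\<close> and lower
  powers. Induction on k disposes of the lower powers, and the Kalman condition ends the
  argument.\<close>

lemma poly_loop_through:
  fixes A :: "real^'d^'d" and B :: "real^'n^'d"
  assumes rank: "rank (kalman_matrix A B) = CARD('d)" and t0: "0 < t0" "t0 < T"
  shows "\<exists>z v. poly_loop T A B z v \<and> z t0 = y"
proof -
  define E where "E = {y. \<exists>z v. poly_loop T A B z v \<and> z t0 = y}"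
  have "subspace E"
    unfolding subspace_def E_def
    using poly_loop_zero poly_loop_add poly_loop_scaleR by fast
  have orth0: "\<xi> = 0" if orth: "\<And>y. y \<in> E \<Longrightarrow> \<xi> \<bullet> y = 0" for \<xi>
  proof (rule kalman_orthogonal_eq_0[OF rank])
    fix k i assume k: "k < CARD('d)"
    obtain p c where p: "p \<ge> CARD('d)" and
      c: "((*v) A ^^ Suc p) (column i B) = (\<Sum>k<Suc p. c k *\<^sub>R ((*v) A ^^ k) (column i B))"
      using krylov_dependent by blast
    define e where "e = (\<lambda>j. - c (p - j))"
    have "k \<le> p \<Longrightarrow> \<xi> \<bullet> ((*v) A ^^ k) (column i B) = 0"
    proof (induction k rule: less_induct)
      case (less k)
      define j where "j = p - k"
      \<comment> \<open>The two factors of order p + 1 close the loop at 0 and at T, and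
        \<open>s\<close> is nonzero at t0.\<close>
      define s where "s = [:0, 1:] ^ Suc p * [:- T, 1:] ^ Suc p"
      define w where "w = [:- t0, 1:] ^ j * s"
      define z where "z t = (\<Sum>j<Suc p. poly (flat_chain e w j) t *\<^sub>R ((*v) A ^^ (p - j)) (column i B))" for t
      have "poly_loop T A B z (\<lambda>t. poly (flat_chain e w (Suc p)) t *\<^sub>R axis i 1)"
      proof (rule flat_chain_loop[OF c])
        show "w = [:0, 1:] ^ Suc p * ([:- t0, 1:] ^ j * [:- T, 1:] ^ Suc p)"
          "w = [:- T, 1:] ^ Suc p * ([:- t0, 1:] ^ j * [:0, 1:] ^ Suc p)"
          unfolding w_def s_def by (simp_all only: mult_ac)
      qed (simp_all only: e_def z_def[abs_def])
      then have "z t0 \<in> E" unfolding E_def by blast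
      then have "\<xi> \<bullet> z t0 = 0" by (rule orth)
      have "poly s t0 \<noteq> 0" using t0 by (simp add: s_def poly_power)
      then have nz: "poly (flat_chain e w j) t0 \<noteq> 0"
        using flat_chain_factor[OF w_def, of j e] by (auto simp: w_def)
      have zero: "poly (flat_chain e w l) t0 = 0" if lj: "l < j" for l
      proof -
        obtain s' where "flat_chain e w l = [:- t0, 1:] ^ (j - l) * s'"
          using flat_chain_factor[OF w_def less_imp_le[OF lj]] by blast
        then show ?thesis using lj by (simp add: poly_power)
      qed
      have "\<xi> \<bullet> z t0 = (\<Sum>l<Suc p. poly (flat_chain e w l) t0 * (\<xi> \<bullet> ((*v) A ^^ (p - l)) (column i B)))"
        by (simp add: z_def inner_sum_right inner_add_right)
      also have "\<dots> = (\<Sum>l<Suc p. if l = j then poly (flat_chain e w j) t0 * (\<xi> \<bullet> ((*v) A ^^ k) (column i B)) else 0)"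
      proof (rule sum.cong[OF refl])
        fix l assume "l \<in> {..<Suc p}"
        \<comment> \<open>For l < j the coordinate vanishes at t0; for l > j the power p - l is
          below k and the induction hypothesis applies.\<close>
        then consider "l < j" | "l = j" | "p - l < k" "p - l \<le> p" using less.prems unfolding j_def by fastforce
        then show "poly (flat_chain e w l) t0 * (\<xi> \<bullet> ((*v) A ^^ (p - l)) (column i B))
           = (if l = j then poly (flat_chain e w j) t0 * (\<xi> \<bullet> ((*v) A ^^ k) (column i B)) else 0)"
        proof cases
          case 1 then show ?thesis using zero by simp
        next
          case 2 then show ?thesis using less.prems by (simp add: j_def)
        next
          case 3
          then have "l \<noteq> j" using less.prems by (auto simp: j_def)
          then show ?thesis using less.IH[OF 3] by simp
        qed
      qed
      also have "\<dots> = poly (flat_chain e w j) t0 * (\<xi> \<bullet> ((*v) A ^^ k) (column i B))"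
        by (subst sum.delta) (auto simp: j_def)
      finally show ?case using nz \<open>\<xi> \<bullet> z t0 = 0\<close> by simp
    qed
    with p k show "\<xi> \<bullet> ((*v) A ^^ k) (column i B) = 0" by simp
  qed
  have "dim E = DIM(real^'d)"
  proof (rule ccontr)
    assume "dim E \<noteq> DIM(real^'d)"
    then have "dim E < DIM(real^'d)" using dim_subset_UNIV[of E] by linarith
    then obtain \<xi> where "\<xi> \<noteq> 0" "\<And>y. y \<in> span E \<Longrightarrow> orthogonal \<xi> y"
      using orthogonal_to_subspace_exists by metis
    then show False using orth0 by (auto simp: orthogonal_def span_base)
  qed
  then have "E = UNIV" using dim_eq_full[of E] \<open>subspace E\<close> by (metis span_eq_iff)
  then show ?thesis unfolding E_def by blast
qed

lemma det_poly_matrix: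
  fixes P :: "'d::finite \<Rightarrow> 'd \<Rightarrow> real poly"
  shows "det (\<chi> i j. poly (P i j) t) = poly (det (\<chi> i j. P i j)) t"
  unfolding det_def by (simp add: poly_sum poly_prod)

text \<open>The columns of S are loops through the basis vectors at the common time T/2. Hence S
  (T/2) is the identity, and det S is a polynomial that is not zero. V collects the controls of the
  columns.\<close>

lemma loop_family:
  fixes A :: "real^'d^'d" and B :: "real^'n^'d"
  assumes rank: "rank (kalman_matrix A B) = CARD('d)" and "T > 0"
  shows "\<exists>(S :: real \<Rightarrow> real^'d^'d) (V :: real \<Rightarrow> real^'d^'n).
    continuous_on UNIV S \<and> continuous_on UNIV V \<and>
    (\<forall>t \<theta>. ((\<lambda>t. S t *v \<theta>) has_vector_derivative A *v (S t *v \<theta>) + B *v (V t *v \<theta>)) (at t)) \<and>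
    S 0 = 0 \<and> S T = 0 \<and> finite {t. det (S t) = 0}"
proof -
  have "\<exists>z v. poly_loop T A B z v \<and> z (T/2) = axis j 1" for j
    using poly_loop_through[OF rank, of "T/2" T] \<open>T > 0\<close> by simp
  then obtain z v where zv: "\<And>j. poly_loop T A B (z j) (v j)" and mid: "\<And>j. z j (T/2) = axis j 1"
    by metis
  then have "\<exists>P. \<forall>t r. z j t $ r = poly (P r) t" for j unfolding poly_loop_def by blast
  then obtain P where P: "\<And>j t r. z j t $ r = poly (P j r) t" by metis
  define S where "S t = (\<chi> r j. z j t $ r)" for t
  define V where "V t = (\<chi> r j. v j t $ r)" for t
  have S: "S t *v \<theta> = (\<Sum>j\<in>UNIV. \<theta> $ j *\<^sub>R z j t)" for t \<theta>
    by (simp add: S_def matrix_vector_mult_def vec_eq_iff mult.commute)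
  have V: "V t *v \<theta> = (\<Sum>j\<in>UNIV. \<theta> $ j *\<^sub>R v j t)" for t \<theta>
    by (simp add: V_def matrix_vector_mult_def vec_eq_iff mult.commute)
  have der: "((\<lambda>t. S t *v \<theta>) has_vector_derivative A *v (S t *v \<theta>) + B *v (V t *v \<theta>)) (at t)" for t \<theta>
  proof -
    have "((\<lambda>t. \<Sum>j\<in>UNIV. \<theta> $ j *\<^sub>R z j t) has_vector_derivative
        (\<Sum>j\<in>UNIV. \<theta> $ j *\<^sub>R (A *v z j t + B *v v j t))) (at t)"
      using zv by (intro has_vector_derivative_sum bounded_linear.has_vector_derivative[OF bounded_linear_scaleR_right])
        (auto simp: poly_loop_def)
    then show ?thesis
      by (simp add: S V linear_sum[OF matrix_vector_mul_linear] matrix_vector_mult_scaleR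
          scaleR_right_distrib sum.distrib)
  qed
  define D where "D = det (\<chi> r j. P j r)"
  have D: "det (S t) = poly D t" for t
    unfolding S_def P D_def by (rule det_poly_matrix)
  have "S (T/2) = mat 1" by (simp add: S_def mid vec_eq_iff mat_def axis_def)
  then have "poly D (T/2) = 1" by (simp flip: D add: det_I)
  then have "D \<noteq> 0" by auto
  then have "finite {t. det (S t) = 0}" unfolding D by (rule poly_roots_finite)
  moreover have "continuous_on UNIV S" unfolding S_def P by (intro continuous_intros)
  moreover have "continuous_on UNIV V" unfolding V_def
    using zv by (intro continuous_intros) (auto simp: poly_loop_def)
  moreover have "S 0 = 0" "S T = 0" using zv by (auto simp: S_def poly_loop_def vec_eq_iff)
  ultimately show ?thesis using der by blast
qed

section \<open>The space-time measure of a narrowly continuous curve\<close>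

abbreviation time_measure :: "real \<Rightarrow> real measure" where
  "time_measure T \<equiv> restrict_space lborel {0..T}"

lemma sets_spacetime: "sets (spacetime T) = sets (restrict_space borel ({0..T} \<times> UNIV))"
  unfolding spacetime_def by (intro sets_restrict_space_cong) simp

lemma space_spacetime [simp]: "space (spacetime T) = {0..T} \<times> UNIV"
  by (simp add: spacetime_def space_restrict_space)

lemma measurable_spacetimeI:
  fixes f :: "'a \<Rightarrow> real" and g :: "'a \<Rightarrow> real^'d"
  assumes "f \<in> borel_measurable M" "g \<in> borel_measurable M" "\<And>x. x \<in> space M \<Longrightarrow> f x \<in> {0..T}"
  shows "(\<lambda>x. (f x, g x)) \<in> M \<rightarrow>\<^sub>M spacetime T"
proof -
  have "(\<lambda>x. (f x, g x)) \<in> M \<rightarrow>\<^sub>M borel"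
    using assms(1,2) by measurable
  then show ?thesis using assms(3) unfolding spacetime_def
    by (intro measurable_restrict_space2) auto
qed

lemma borel_measurable_spacetimeD:
  "f \<in> borel_measurable borel \<Longrightarrow> f \<in> borel_measurable (spacetime T)"
  unfolding spacetime_def by (intro measurable_restrict_space1) simp

lemma continuous_on_measurable_spacetime:
  fixes f :: "real \<times> (real^'d) \<Rightarrow> 'b::topological_space"
  assumes "continuous_on ({0..T} \<times> UNIV) f"
  shows "f \<in> borel_measurable (spacetime T)"
  using borel_measurable_continuous_on_restrict[OF assms]
  by (simp add: measurable_cong_sets[OF sets_spacetime refl])

lemma space_time_measure: "space (time_measure T) = {0..T}"
  by (simp add: space_restrict_space)

lemma measurable_fst_spacetime: "fst \<in> borel_measurable (spacetime T :: (real \<times> (real^'d)) measure)"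
  and measurable_snd_spacetime: "snd \<in> borel_measurable (spacetime T :: (real \<times> (real^'d)) measure)"
  by (rule borel_measurable_spacetimeD, simp add: borel_prod[symmetric])+

text \<open>\<open>spacetime T\<close> restricts the Borel sets of a product type and is not itself
  a product measure. This is the bridge to the facts on kernels and iterated integrals, which speak
  of product sigma-algebras.\<close>

lemma measurable_id_spacetime:
  "(\<lambda>z. z) \<in> time_measure T \<Otimes>\<^sub>M (borel :: (real^'d) measure) \<rightarrow>\<^sub>M spacetime T"
proof -
  have "(\<lambda>z. (fst z, snd z)) \<in> time_measure T \<Otimes>\<^sub>M (borel :: (real^'d) measure) \<rightarrow>\<^sub>M spacetime T"
    by (rule measurable_spacetimeI)
      (auto simp: space_pair_measure space_time_measure intro!: measurable_compose[OF measurable_fst] measurable_restrict_space1)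
  then show ?thesis by simp
qed

text \<open>Closed sets generate the Borel sets, and the indicator of a closed F is the pointwise
  limit of the bounded continuous functions \<open>g k\<close>. Their integrals are continuous in t,
  so the mass of F is a limit of measurable functions.\<close>

lemma narrowly_continuous_measurable:
  fixes \<mu> :: "real \<Rightarrow> 'a::metric_space measure"
  assumes prob: "\<And>t. t \<in> I \<Longrightarrow> \<mu> t \<in> prob_measures" and nc: "narrowly_continuous_on I \<mu>"
  shows "\<mu> \<in> restrict_space lborel I \<rightarrow>\<^sub>M subprob_algebra borel"
proof (rule measurable_prob_algebraD, rule measurable_prob_algebra_generated[where \<Omega>=UNIV and G="Collect closed"])
  show "sets borel = sigma_sets UNIV (Collect closed)"
    by (simp add: borel_eq_closed)
  show "Int_stable (Collect closed)" by (auto simp: Int_stable_def)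
  fix F :: "'a set" assume "F \<in> Collect closed"
  then have F: "closed F" by simp
  show "(\<lambda>t. emeasure (\<mu> t) F) \<in> borel_measurable (restrict_space lborel I)"
  \<comment> \<open>\<open>infdist x {}\<close> is 0 by convention, so for empty F the functions
    \<open>g k\<close> would be 1 and not tend to the indicator.\<close>
  proof (cases "F = {}")
    case False
    define g where "g k x = max 0 (1 - real k * infdist x F)" for k x
    have g_cont: "continuous_on UNIV (g k)" for k
      unfolding g_def by (intro continuous_intros)
    have g_bd: "\<bar>g k x\<bar> \<le> 1" for k x
      unfolding g_def by (auto simp: infdist_nonneg)
    have g_lim: "(\<lambda>k. g k x) \<longlonglongrightarrow> indicator F x" for x
    proof (cases "x \<in> F")
      case True then show ?thesis by (simp add: g_def)
    next
      case out: False
      then have "infdist x F > 0"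
        using in_closed_iff_infdist_zero[OF F False] infdist_nonneg[of x F] by (simp add: less_le)
      then obtain k0 where k0: "1 < real k0 * infdist x F" using ex_less_of_nat_mult by blast
      have "\<forall>\<^sub>F k in sequentially. g k x = 0"
        using eventually_ge_at_top[of k0]
      proof eventually_elim
        case (elim k)
        then have "real k0 * infdist x F \<le> real k * infdist x F"
          by (intro mult_right_mono) (auto simp: infdist_nonneg)
        with k0 show ?case by (simp add: g_def)
      qed
      then show ?thesis using out by (simp add: tendsto_eventually)
    qed
    have lim: "(\<lambda>k. \<integral>x. g k x \<partial>\<mu> t) \<longlonglongrightarrow> measure (\<mu> t) F" if "t \<in> I" for t
    proof -
      interpret prob_space "\<mu> t" using prob[OF that] by (simp add: prob_measures_def)
      have [measurable_cong]: "sets (\<mu> t) = sets borel" using prob[OF that] by (simp add: prob_measures_def)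
      have "(\<lambda>k. \<integral>x. g k x \<partial>\<mu> t) \<longlonglongrightarrow> (\<integral>x. indicator F x \<partial>\<mu> t)"
      proof (rule integral_dominated_convergence[where w="\<lambda>_. 1"])
        show "g k \<in> borel_measurable (\<mu> t)" for k
          using borel_measurable_continuous_onI[OF g_cont[of k]] by measurable
        show "(indicator F :: 'a \<Rightarrow> real) \<in> borel_measurable (\<mu> t)" using F sets_eq_imp_space_eq
          by (intro borel_measurable_indicator) (simp add: prob[OF that, unfolded prob_measures_def, simplified])
      qed (auto simp: g_bd g_lim)
      then show ?thesis using F by simp
    qed
    have "(\<lambda>t. measure (\<mu> t) F) \<in> borel_measurable (restrict_space lborel I)"
    proof (rule borel_measurable_LIMSEQ_real)
      show "(\<lambda>k. \<integral>x. g k x \<partial>\<mu> t) \<longlonglongrightarrow> measure (\<mu> t) F" if "t \<in> space (restrict_space lborel I)" for t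
        using lim that by (simp add: space_restrict_space)
      fix k
      have "bounded (range (g k))" using g_bd by (auto simp: bounded_iff)
      then have "continuous_on I (\<lambda>t. \<integral>x. g k x \<partial>\<mu> t)"
        using nc g_cont unfolding narrowly_continuous_on_def by blast
      from borel_measurable_continuous_on_restrict[OF this]
      show "(\<lambda>t. \<integral>x. g k x \<partial>\<mu> t) \<in> borel_measurable (restrict_space lborel I)"
        by (simp cong: measurable_cong_sets sets_restrict_space_cong)
    qed
    then have "(\<lambda>t. ennreal (measure (\<mu> t) F)) \<in> borel_measurable (restrict_space lborel I)" by measurable
    moreover have "emeasure (\<mu> t) F = ennreal (measure (\<mu> t) F)" if "t \<in> I" for t
    proof -
      interpret prob_space "\<mu> t" using prob[OF that] by (simp add: prob_measures_def)
      show ?thesis by (rule emeasure_eq_measure)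
    qed
    ultimately show ?thesis
      by (subst measurable_cong[where g="\<lambda>t. ennreal (measure (\<mu> t) F)"]) (auto simp: space_restrict_space)
  qed simp
qed (use prob in \<open>auto simp: prob_measures_def space_restrict_space\<close>)

section \<open>Iterated integrals for the space-time measure\<close>

locale narrow_curve =
  fixes T :: real and \<mu> :: "real \<Rightarrow> (real^'d) measure"
  assumes T_pos: "T > 0"
    and prob_measures: "\<And>t. t \<in> {0..T} \<Longrightarrow> \<mu> t \<in> prob_measures"
    and narrowly_continuous: "narrowly_continuous_on {0..T} \<mu>"
begin

abbreviation "C \<equiv> curve_measure T \<mu>"

lemma prob_space_curve: "t \<in> {0..T} \<Longrightarrow> prob_space (\<mu> t)"
  and sets_curve: "t \<in> {0..T} \<Longrightarrow> sets (\<mu> t) = sets borel"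
  using prob_measures by (auto simp: prob_measures_def)

lemma kernel: "\<mu> \<in> time_measure T \<rightarrow>\<^sub>M subprob_algebra borel"
  using prob_measures narrowly_continuous by (rule narrowly_continuous_measurable)

lemma spacetime_kernel:
  "(\<lambda>t. distr (\<mu> t) (spacetime T) (Pair t)) \<in> time_measure T \<rightarrow>\<^sub>M subprob_algebra (spacetime T)"
  by (rule measurable_distr2[OF _ kernel]) (use measurable_id_spacetime in \<open>simp add: case_prod_unfold\<close>)

lemma sets_curve_measure [simp, measurable_cong]: "sets C = sets (spacetime T)"
  unfolding curve_measure_def using T_pos by (intro sets_bind) (auto simp: space_time_measure)

lemma space_curve_measure [simp]: "space C = {0..T} \<times> UNIV"
  using sets_eq_imp_space_eq[OF sets_curve_measure] by simp

lemma measurable_slice: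
  assumes "t \<in> {0..T}" "f \<in> spacetime T \<rightarrow>\<^sub>M N"
  shows "(\<lambda>x. f (t, x)) \<in> \<mu> t \<rightarrow>\<^sub>M N"
proof -
  have "(\<lambda>x. (t, x)) \<in> \<mu> t \<rightarrow>\<^sub>M spacetime T"
    using assms(1) sets_curve[OF assms(1)]
    by (intro measurable_spacetimeI) (auto cong: measurable_cong_sets)
  then show ?thesis using assms(2) by (rule measurable_compose)
qed

lemma nn_integral_curve_measure:
  assumes f: "f \<in> borel_measurable (spacetime T)"
  shows "(\<integral>\<^sup>+z. f z \<partial>C) = (\<integral>\<^sup>+t. (\<integral>\<^sup>+x. f (t, x) \<partial>\<mu> t) \<partial>time_measure T)"
  unfolding curve_measure_def nn_integral_bind[OF f spacetime_kernel]
proof (rule nn_integral_cong)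
  fix t assume "t \<in> space (time_measure T)"
  then have t: "t \<in> {0..T}" by (simp add: space_time_measure)
  have "(\<lambda>x. (t, x)) \<in> \<mu> t \<rightarrow>\<^sub>M spacetime T" using measurable_slice[OF t, of "\<lambda>z. z"] by simp
  then show "(\<integral>\<^sup>+z. f z \<partial>distr (\<mu> t) (spacetime T) (Pair t)) = (\<integral>\<^sup>+x. f (t, x) \<partial>\<mu> t)"
    using f by (simp add: nn_integral_distr)
qed

lemma nn_integral_curve_measure':
  assumes f: "f \<in> borel_measurable (spacetime T)"
  shows "(\<integral>\<^sup>+z. f z \<partial>C) = (\<integral>\<^sup>+t\<in>{0..T}. (\<integral>\<^sup>+x. f (t, x) \<partial>\<mu> t) \<partial>lborel)"
  by (simp add: nn_integral_curve_measure[OF f] nn_integral_restrict_space)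

lemma finite_curve_measure: "finite_measure C"
proof
  have "emeasure C (space C) = (\<integral>\<^sup>+z. 1 \<partial>C)" by simp
  also have "\<dots> = (\<integral>\<^sup>+t. (\<integral>\<^sup>+x. 1 \<partial>\<mu> t) \<partial>time_measure T)"
    by (rule nn_integral_curve_measure) simp
  also have "\<dots> = (\<integral>\<^sup>+t. 1 \<partial>time_measure T)"
    by (intro nn_integral_cong) (simp add: space_time_measure prob_space.emeasure_space_1[OF prob_space_curve])
  also have "\<dots> < \<infinity>" using T_pos by (simp add: emeasure_restrict_space space_time_measure)
  finally show "emeasure C (space C) \<noteq> \<infinity>" by simp
qed

lemma measurable_nn_integral_slice:
  assumes f: "f \<in> borel_measurable (spacetime T)"
  shows "(\<lambda>t. \<integral>\<^sup>+x. f (t, x) \<partial>\<mu> t) \<in> borel_measurable (time_measure T)"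
  using measurable_compose[OF measurable_id_spacetime f]
  by (intro nn_integral_measurable_subprob_algebra2[OF _ kernel]) (simp add: case_prod_unfold)

text \<open>Fubini for a kernel, obtained from the nonnegative case: the slice integrals p and n of
  the positive and negative parts have finite time integrals, hence are finite for almost every t,
  and their difference is the slice integral of f.\<close>

lemma integral_curve_measure:
  fixes f :: "real \<times> (real^'d) \<Rightarrow> real"
  assumes f: "integrable C f"
  shows "(\<integral>z. f z \<partial>C) = (\<integral>t. (\<integral>x. f (t, x) \<partial>\<mu> t) \<partial>time_measure T)"
    and "integrable (time_measure T) (\<lambda>t. \<integral>x. f (t, x) \<partial>\<mu> t)"
proof -
  have [measurable]: "f \<in> borel_measurable (spacetime T)" 
    using borel_measurable_integrable[OF f] by (simp cong: measurable_cong_sets)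
  define p where "p t = (\<integral>\<^sup>+x. ennreal (f (t, x)) \<partial>\<mu> t)" for t
  define n where "n t = (\<integral>\<^sup>+x. ennreal (- f (t, x)) \<partial>\<mu> t)" for t
  have meas [measurable]: "p \<in> borel_measurable (time_measure T)" "n \<in> borel_measurable (time_measure T)"
    unfolding p_def n_def by (intro measurable_nn_integral_slice; measurable)+
  have int: "(\<integral>\<^sup>+t. p t \<partial>time_measure T) = (\<integral>\<^sup>+z. ennreal (f z) \<partial>C)"
    "(\<integral>\<^sup>+t. n t \<partial>time_measure T) = (\<integral>\<^sup>+z. ennreal (- f z) \<partial>C)"
    unfolding p_def n_def by (intro nn_integral_curve_measure[symmetric]; measurable)+
  have fin: "(\<integral>\<^sup>+z. ennreal (f z) \<partial>C) \<noteq> \<infinity>" "(\<integral>\<^sup>+z. ennreal (- f z) \<partial>C) \<noteq> \<infinity>"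
    using f by (auto simp: real_integrable_def)
  have ae: "AE t in time_measure T. p t \<noteq> \<infinity>" "AE t in time_measure T. n t \<noteq> \<infinity>"
    using int fin by (intro nn_integral_PInf_AE; simp)+
  have pn: "integrable (time_measure T) (\<lambda>t. enn2real (h t))"
      "(\<integral>t. enn2real (h t) \<partial>time_measure T) = enn2real (\<integral>\<^sup>+t. h t \<partial>time_measure T)"
    if h: "h \<in> borel_measurable (time_measure T)" "AE t in time_measure T. h t \<noteq> \<infinity>"
      "(\<integral>\<^sup>+t. h t \<partial>time_measure T) \<noteq> \<infinity>" for h
  proof -
    have eq: "(\<integral>\<^sup>+t. ennreal (enn2real (h t)) \<partial>time_measure T) = (\<integral>\<^sup>+t. h t \<partial>time_measure T)"
      using h(2) by (intro nn_integral_cong_AE) (auto simp: less_top)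
    have [measurable]: "(\<lambda>t. enn2real (h t)) \<in> borel_measurable (time_measure T)"
      using h(1) by measurable
    show "integrable (time_measure T) (\<lambda>t. enn2real (h t))"
      using h(3) eq by (intro integrableI_nonneg) (auto simp: less_top)
    show "(\<integral>t. enn2real (h t) \<partial>time_measure T) = enn2real (\<integral>\<^sup>+t. h t \<partial>time_measure T)"
      using eq by (subst integral_eq_nn_integral) auto
  qed
  \<comment> \<open>Measurability in t needs a formula valid at every t. At the exceptional times
    the slice is not integrable and its Bochner integral is 0 by convention.\<close>
  have cases: "(\<integral>x. f (t, x) \<partial>\<mu> t) = (if p t \<noteq> \<infinity> \<and> n t \<noteq> \<infinity> then enn2real (p t) - enn2real (n t) else 0)"
    if "t \<in> space (time_measure T)" for t
  proof -
    have "integrable (\<mu> t) (\<lambda>x. f (t, x)) \<longleftrightarrow> p t \<noteq> \<infinity> \<and> n t \<noteq> \<infinity>"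
      using that measurable_slice[of t f] by (simp add: space_time_measure real_integrable_def p_def n_def)
    then show ?thesis
      by (simp add: real_lebesgue_integral_def p_def n_def not_integrable_integral_eq)
  qed
  have ae_eq: "AE t in time_measure T. enn2real (p t) - enn2real (n t) = (\<integral>x. f (t, x) \<partial>\<mu> t)"
    using ae AE_space by eventually_elim (simp add: cases)
  have int_diff: "integrable (time_measure T) (\<lambda>t. enn2real (p t) - enn2real (n t))"
    using pn(1)[OF meas(1) ae(1)] pn(1)[OF meas(2) ae(2)] int fin by auto
  have meas': "(\<lambda>t. \<integral>x. f (t, x) \<partial>\<mu> t) \<in> borel_measurable (time_measure T)"
    by (subst measurable_cong[OF cases]) measurable
  show "integrable (time_measure T) (\<lambda>t. \<integral>x. f (t, x) \<partial>\<mu> t)"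
    using int_diff meas' ae_eq by (rule integrable_cong_AE_imp)
  have "(\<integral>t. (\<integral>x. f (t, x) \<partial>\<mu> t) \<partial>time_measure T) = (\<integral>t. enn2real (p t) - enn2real (n t) \<partial>time_measure T)"
    using ae_eq meas' by (intro integral_cong_AE) auto
  also have "\<dots> = enn2real (\<integral>\<^sup>+t. p t \<partial>time_measure T) - enn2real (\<integral>\<^sup>+t. n t \<partial>time_measure T)"
    using pn[OF meas(1) ae(1)] pn[OF meas(2) ae(2)] int fin by (simp add: Bochner_Integration.integral_diff)
  also have "\<dots> = (\<integral>z. f z \<partial>C)"
    unfolding int by (rule real_lebesgue_integral_def[OF f, symmetric])
  finally show "(\<integral>z. f z \<partial>C) = (\<integral>t. (\<integral>x. f (t, x) \<partial>\<mu> t) \<partial>time_measure T)" by simp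
qed

lemma set_integral_curve_measure:
  fixes f :: "real \<times> (real^'d) \<Rightarrow> real"
  assumes f: "integrable C f"
  shows "(\<integral>t\<in>{0..T}. (\<integral>x. f (t, x) \<partial>\<mu> t) \<partial>lborel) = (\<integral>z. f z \<partial>C)"
  unfolding integral_curve_measure[OF f] set_lebesgue_integral_def
  by (subst integral_restrict_space) auto

end

section \<open>The convexified functional and conditional expectations\<close>

text \<open>The real case applies along each basis vector, and finitely many null sets unite to one.
  This makes the arbitrary choice inside \<open>vector_RN_deriv\<close> harmless.\<close>

lemma vector_density_unique:
  fixes f g :: "'a \<Rightarrow> 'b::euclidean_space"
  assumes "is_vector_density M m f" "is_vector_density M m g"
  shows "AE x in M. f x = g x"
proof -
  have f: "integrable M f" "integrable M g"
    and eq: "\<And>A. A \<in> sets M \<Longrightarrow> (\<integral>x\<in>A. f x \<partial>M) = (\<integral>x\<in>A. g x \<partial>M)"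
    using assms unfolding is_vector_density_def by metis+
  have "AE x in M. f x \<bullet> b = g x \<bullet> b" for b
  proof (rule density_unique_real)
    fix A assume A: "A \<in> sets M"
    have "(\<integral>x\<in>A. h x \<bullet> b \<partial>M) = (\<integral>x\<in>A. h x \<partial>M) \<bullet> b" if "integrable M h" for h
      using integral_inner_left[of b M "\<lambda>x. indicator A x *\<^sub>R h x"] integrable_mult_indicator[OF A that]
      by (simp add: set_lebesgue_integral_def)
    then show "(\<integral>x\<in>A. f x \<bullet> b \<partial>M) = (\<integral>x\<in>A. g x \<bullet> b \<partial>M)"
      using f eq[OF A] by metis
  qed (use f in auto)
  then have "AE x in M. \<forall>b\<in>Basis. f x \<bullet> b = g x \<bullet> b" by (intro AE_finite_allI) auto
  then show ?thesis by eventually_elim (simp add: euclidean_eq_iff[of "f _"])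
qed

lemma measurable_perspective:
  fixes \<psi> :: "'b::{real_normed_vector, second_countable_topology} \<Rightarrow> real"
  assumes [measurable]: "\<psi> \<in> borel_measurable borel" "a \<in> borel_measurable M" "b \<in> borel_measurable M"
  shows "(\<lambda>x. perspective \<psi> (a x) (b x)) \<in> borel_measurable M"
  unfolding perspective_def by measurable

lemma nn_integral_spacetime:
  fixes f :: "real \<times> (real^'d) \<Rightarrow> ennreal"
  assumes f: "f \<in> borel_measurable (spacetime T)"
  shows "(\<integral>\<^sup>+z. f z \<partial>spacetime T) = (\<integral>\<^sup>+t\<in>{0..T}. (\<integral>\<^sup>+x. f (t, x) \<partial>lborel) \<partial>lborel)"
proof -
  have [measurable]: "{0..T} \<times> (UNIV :: (real^'d) set) \<in> sets borel"
    by (intro borel_closed closed_Times) auto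
  have m: "(\<lambda>z. f z * indicator ({0..T} \<times> UNIV) z) \<in> borel_measurable (lborel \<Otimes>\<^sub>M lborel)"
    using f unfolding spacetime_def lborel_prod
    by (subst (asm) borel_measurable_restrict_space_iff_ennreal) auto
  have "(\<integral>\<^sup>+z. f z \<partial>spacetime T) = (\<integral>\<^sup>+z. f z * indicator ({0..T} \<times> UNIV) z \<partial>(lborel \<Otimes>\<^sub>M lborel))"
    unfolding spacetime_def lborel_prod by (rule nn_integral_restrict_space) simp
  also have "\<dots> = (\<integral>\<^sup>+t. (\<integral>\<^sup>+x. f (t, x) * indicator ({0..T} \<times> UNIV) (t, x) \<partial>lborel) \<partial>lborel)"
    using lborel.nn_integral_fst[OF m] by simp
  also have "\<dots> = (\<integral>\<^sup>+t\<in>{0..T}. (\<integral>\<^sup>+x. f (t, x) \<partial>lborel) \<partial>lborel)"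
    by (intro nn_integral_cong) (auto simp: indicator_def)
  finally show ?thesis .
qed

lemma sigma_finite_spacetime: "sigma_finite_measure (spacetime T :: (real \<times> (real^'d)) measure)"
  unfolding spacetime_def
  by (intro sigma_finite_measure_restrict_space sigma_finite_lborel) (auto intro!: borel_closed closed_Times)

context narrow_curve begin

text \<open>If C has the density r with respect to dt dx, then m has the density r u, and uniqueness
  identifies it with the density that the functional selects. The Lebesgue integral of the
  perspective function thus turns into an integral of \<psi>(u) against C.\<close>

lemma conv_functional_eq:
  fixes m :: "(real \<times> (real^'d)) set \<Rightarrow> real^'n" and s :: "real^'d \<Rightarrow> real"
  assumes ac: "absolutely_continuous (spacetime T) C"
    and u: "is_vector_density C m u"
    and [measurable]: "s \<in> borel_measurable borel" "\<psi> \<in> borel_measurable borel"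
  shows "conv_functional T s \<psi> m \<mu> = (\<integral>\<^sup>+z. ennreal (s (snd z)) + ennreal (\<psi> (u z)) \<partial>C)"
proof -
  let ?S = "spacetime T :: (real \<times> (real^'d)) measure"
  note [measurable] = measurable_snd_spacetime
  interpret S: sigma_finite_measure ?S by (rule sigma_finite_spacetime)
  interpret C: finite_measure C by (rule finite_curve_measure)
  define r where "r z = enn2real (RN_deriv ?S C z)" for z
  have [measurable]: "r \<in> borel_measurable ?S" unfolding r_def by measurable
  \<comment> \<open>C is finite, so its Radon-Nikodym derivative is finite almost everywhere and
    \<open>enn2real\<close>, which sends infinity to 0, loses nothing.\<close>
  have fin: "AE z in ?S. RN_deriv ?S C z \<noteq> \<infinity>"
    by (rule S.RN_deriv_finite[OF C.sigma_finite_measure_axioms ac]) simp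
  have "C = density ?S (RN_deriv ?S C)"
    using S.density_RN_deriv[OF ac] by simp
  also have "\<dots> = density ?S (\<lambda>z. ennreal (r z))"
    using fin by (intro density_cong) (auto simp: r_def less_top)
  finally have C_r: "C = density ?S (\<lambda>z. ennreal (r z))" .
  have r_nonneg: "0 \<le> r z" for z by (simp add: r_def)
  have iu: "integrable C u" and mu: "\<And>E. E \<in> sets ?S \<Longrightarrow> m E = (\<integral>z\<in>E. u z \<partial>C)"
    using u by (auto simp: is_vector_density_def)
  have [measurable]: "u \<in> borel_measurable ?S"
    using borel_measurable_integrable[OF iu] by (simp cong: measurable_cong_sets)
  have iru: "integrable ?S (\<lambda>z. r z *\<^sub>R u z)"
    using iu by (subst (asm) C_r, subst (asm) integrable_density) (auto simp: r_nonneg)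
  have mru: "m E = (\<integral>z\<in>E. r z *\<^sub>R u z \<partial>?S)" if [measurable]: "E \<in> sets ?S" for E
  proof -
    have "m E = (\<integral>z. indicator E z *\<^sub>R u z \<partial>density ?S (\<lambda>z. ennreal (r z)))"
      unfolding mu[OF that] set_lebesgue_integral_def by (subst C_r) (rule refl)
    also have "\<dots> = (\<integral>z. r z *\<^sub>R indicator E z *\<^sub>R u z \<partial>?S)"
      by (rule integral_density) (auto simp: r_nonneg)
    finally show ?thesis by (simp add: set_lebesgue_integral_def mult.commute)
  qed
  have dens: "is_vector_density ?S m (\<lambda>z. r z *\<^sub>R u z)"
    using iru mru by (auto simp: is_vector_density_def)
  define w where "w = vector_RN_deriv ?S m"
  have w: "is_vector_density ?S m w"
    unfolding w_def vector_RN_deriv_def by (rule someI[of "is_vector_density ?S m", OF dens])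
  then have [measurable]: "w \<in> borel_measurable ?S" by (auto simp: is_vector_density_def)
  have w_eq: "AE z in ?S. w z = r z *\<^sub>R u z" by (rule vector_density_unique[OF w dens])
  have vac: "vector_abs_continuous ?S m"
    unfolding vector_abs_continuous_def
  proof
    fix E assume E: "E \<in> null_sets ?S"
    then have "m E = (\<integral>z. indicator E z *\<^sub>R (r z *\<^sub>R u z) \<partial>?S)"
      using mru by (auto simp: set_lebesgue_integral_def)
    also have "\<dots> = 0"
      using AE_not_in[OF E] by (intro integral_eq_zero_AE) (auto elim!: eventually_mono)
    finally show "m E = 0" .
  qed
  have "(\<integral>\<^sup>+t\<in>{0..T}. (\<integral>\<^sup>+x. perspective \<psi> (w (t, x)) (r (t, x)) \<partial>lborel) \<partial>lborel)
      = (\<integral>\<^sup>+z. perspective \<psi> (w z) (r z) \<partial>?S)"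
    by (rule nn_integral_spacetime[symmetric], rule measurable_perspective) auto
  also have "\<dots> = (\<integral>\<^sup>+z. ennreal (r z) * ennreal (\<psi> (u z)) \<partial>?S)"
  proof (rule nn_integral_cong_AE)
    \<comment> \<open>Where \<open>r z = 0\<close> also \<open>w z = 0\<close>, and both sides
      vanish whatever u is there; elsewhere the factor r cancels inside \<psi>.\<close>
    show "AE z in ?S. perspective \<psi> (w z) (r z) = ennreal (r z) * ennreal (\<psi> (u z))"
      using w_eq
    proof eventually_elim
      case (elim z)
      then show ?case using r_nonneg[of z] by (auto simp: perspective_def ennreal_mult')
    qed
  qed
  also have "\<dots> = (\<integral>\<^sup>+z. ennreal (\<psi> (u z)) \<partial>C)"
    by (subst C_r, subst nn_integral_density) auto
  finally have psi: "(\<integral>\<^sup>+t\<in>{0..T}. (\<integral>\<^sup>+x. perspective \<psi> (w (t, x)) (r (t, x)) \<partial>lborel) \<partial>lborel)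
      = (\<integral>\<^sup>+z. ennreal (\<psi> (u z)) \<partial>C)" .
  have "(\<integral>\<^sup>+t\<in>{0..T}. (\<integral>\<^sup>+x. ennreal (s x) \<partial>\<mu> t) \<partial>lborel) = (\<integral>\<^sup>+z. ennreal (s (snd z)) \<partial>C)"
    by (subst nn_integral_curve_measure') auto
  then show ?thesis
    unfolding conv_functional_def using vac ac psi
    by (simp add: w_def r_def nn_integral_add)
qed

end

text \<open>\<open>u \<circ> \<Phi>\<close> is the conditional expectation of \<open>w\<close> given \<open>\<Phi>\<close>.\<close>
lemma image_density_nonneg:
  fixes w :: "'a \<Rightarrow> real"
  assumes "finite_measure G" and \<Phi>[measurable]: "\<Phi> \<in> G \<rightarrow>\<^sub>M N" and w: "integrable G w" "\<And>z. 0 \<le> w z"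
  shows "\<exists>u. integrable (distr G N \<Phi>) u \<and>
    (\<forall>h. h \<in> borel_measurable N \<longrightarrow> bounded (range h) \<longrightarrow>
      integrable (distr G N \<Phi>) (\<lambda>y. h y * u y) \<and> (\<integral>y. h y * u y \<partial>distr G N \<Phi>) = (\<integral>z. h (\<Phi> z) * w z \<partial>G))"
proof -
  \<comment> \<open>\<open>?W\<close> is the image of the measure with density w. Its density with
    respect to the image of G is the conditional expectation, read on the target space.\<close>
  let ?D = "distr G N \<Phi>" and ?W = "distr (density G (\<lambda>z. ennreal (w z))) N \<Phi>"
  note [measurable] = borel_measurable_integrable[OF w(1)]
  interpret G: finite_measure G by fact
  interpret D: finite_measure ?D by (rule G.finite_measure_distr) fact
  have "emeasure (density G (\<lambda>z. ennreal (w z))) (space G) < \<infinity>"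
    using w by (simp add: emeasure_density nn_integral_eq_integral)
  then have finW: "emeasure ?W (space ?W) \<noteq> \<infinity>"
  proof (subst emeasure_distr)
    have "\<Phi> -` space N \<inter> space G = space G" using measurable_space[OF \<Phi>] by auto
    then show "emeasure (density G (\<lambda>z. ennreal (w z))) (\<Phi> -` space ?W \<inter> space (density G (\<lambda>z. ennreal (w z)))) \<noteq> \<infinity>"
      using \<open>emeasure (density G (\<lambda>z. ennreal (w z))) (space G) < \<infinity>\<close> by simp
  qed auto
  interpret W: finite_measure ?W by standard (rule finW)
  have ac: "absolutely_continuous ?D ?W"
    unfolding absolutely_continuous_def
  proof
    fix E assume E: "E \<in> null_sets ?D"
    then have [measurable]: "E \<in> sets N" by auto
    have "\<Phi> -` E \<inter> space G \<in> null_sets G"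
      using E by (auto simp: null_sets_def emeasure_distr)
    then have "\<Phi> -` E \<inter> space G \<in> null_sets (density G (\<lambda>z. ennreal (w z)))"
      by (rule subsetD[OF absolutely_continuousI_density[unfolded absolutely_continuous_def], rotated]) simp
    then show "E \<in> null_sets ?W"
      by (auto simp: null_sets_def emeasure_distr)
  qed
  define u where "u y = enn2real (RN_deriv ?D ?W y)" for y
  have u_meas [measurable]: "u \<in> borel_measurable N" unfolding u_def using borel_measurable_RN_deriv[of ?D ?W] by measurable
  have fin: "AE y in ?D. RN_deriv ?D ?W y \<noteq> \<infinity>"
    by (rule D.RN_deriv_finite[OF W.sigma_finite_measure_axioms ac]) simp
  have "?W = density ?D (RN_deriv ?D ?W)"
    using D.density_RN_deriv[OF ac] by simp
  also have "\<dots> = density ?D (\<lambda>z. ennreal (u z))"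
    using fin by (intro density_cong) (auto simp: u_def less_top)
  finally have W_u: "?W = density ?D (\<lambda>z. ennreal (u z))" .
  have u_nonneg: "0 \<le> u z" for z by (simp add: u_def)
  have main: "integrable ?D (\<lambda>y. h y * u y) \<and> (\<integral>y. h y * u y \<partial>?D) = (\<integral>z. h (\<Phi> z) * w z \<partial>G)"
    if [measurable]: "h \<in> borel_measurable N" and bd: "bounded (range h)" for h
  proof -
    obtain B where B: "\<And>y. \<bar>h y\<bar> \<le> B" using bd by (auto simp: bounded_iff)
    have "integrable ?W h"
      using B by (intro W.integrable_const_bound[of _ B]) auto
    then have int: "integrable ?D (\<lambda>y. u y *\<^sub>R h y)"
      by (subst (asm) W_u, subst (asm) integrable_density) (auto simp: u_nonneg)
    have "(\<integral>y. u y *\<^sub>R h y \<partial>?D) = (\<integral>y. h y \<partial>density ?D (\<lambda>z. ennreal (u z)))"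
      by (rule integral_density[symmetric]) (auto simp: u_nonneg)
    also have "\<dots> = (\<integral>y. h y \<partial>?W)" unfolding W_u ..
    also have "\<dots> = (\<integral>z. h (\<Phi> z) \<partial>density G (\<lambda>z. ennreal (w z)))"
      by (rule integral_distr) auto
    also have "\<dots> = (\<integral>z. w z *\<^sub>R h (\<Phi> z) \<partial>G)"
      by (rule integral_density) (auto simp: w)
    finally show ?thesis using int by (simp add: mult.commute)
  qed
  have "integrable ?D u" using main[of "\<lambda>_. 1"] by simp
  with main show ?thesis by blast
qed

lemma image_density_real:
  fixes w :: "'a \<Rightarrow> real"
  assumes "finite_measure G" and "\<Phi> \<in> G \<rightarrow>\<^sub>M N" and w: "integrable G w"
  shows "\<exists>u. integrable (distr G N \<Phi>) u \<and>
    (\<forall>h. h \<in> borel_measurable N \<longrightarrow> bounded (range h) \<longrightarrow>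
      integrable (distr G N \<Phi>) (\<lambda>y. h y * u y) \<and> (\<integral>y. h y * u y \<partial>distr G N \<Phi>) = (\<integral>z. h (\<Phi> z) * w z \<partial>G))"
proof -
  let ?D = "distr G N \<Phi>"
  interpret G: finite_measure G by fact
  define p where "p z = max 0 (w z)" for z
  define n where "n z = max 0 (- w z)" for z
  have pn: "integrable G p" "integrable G n" "\<And>z. 0 \<le> p z" "\<And>z. 0 \<le> n z" "\<And>z. w z = p z - n z"
    using w by (auto simp: p_def[abs_def] n_def[abs_def] intro!: Bochner_Integration.integrable_max)
  have int: "integrable G (\<lambda>z. h (\<Phi> z) * q z)"
    if h: "h \<in> borel_measurable N" and bd: "bounded (range h)" and q: "integrable G q" for h and q :: "'a \<Rightarrow> real"
  proof -
    obtain B where B: "\<And>y. \<bar>h y\<bar> \<le> B" using bd by (auto simp: bounded_iff)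
    note [measurable] = h assms(2) borel_measurable_integrable[OF q]
    show ?thesis
    proof (rule Bochner_Integration.integrable_bound)
      show "integrable G (\<lambda>z. B * q z)" using q by simp
      have "\<bar>h y\<bar> \<le> \<bar>B\<bar>" for y using B[of y] by linarith
      then show "AE z in G. norm (h (\<Phi> z) * q z) \<le> norm (B * q z)"
        by (auto simp: abs_mult intro!: mult_right_mono)
    qed measurable
  qed
  obtain up where up: "integrable ?D up" "\<And>h. h \<in> borel_measurable N \<Longrightarrow> bounded (range h) \<Longrightarrow>
      integrable ?D (\<lambda>y. h y * up y) \<and> (\<integral>y. h y * up y \<partial>?D) = (\<integral>z. h (\<Phi> z) * p z \<partial>G)"
    using image_density_nonneg[OF assms(1,2) pn(1,3)] by blast
  obtain un where un: "integrable ?D un" "\<And>h. h \<in> borel_measurable N \<Longrightarrow> bounded (range h) \<Longrightarrow>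
      integrable ?D (\<lambda>y. h y * un y) \<and> (\<integral>y. h y * un y \<partial>?D) = (\<integral>z. h (\<Phi> z) * n z \<partial>G)"
    using image_density_nonneg[OF assms(1,2) pn(2,4)] by blast
  show ?thesis
    by (rule exI[of _ "\<lambda>y. up y - un y"])
      (use up un int pn in \<open>auto simp: right_diff_distrib Bochner_Integration.integral_diff\<close>)
qed

text \<open>Coordinate by coordinate from the real case. The tests h are vector fields because both
  applications pair the density with one: the transposed B applied to the spatial gradient of a test
  function, and the gradient of the quadratic cost.\<close>

lemma image_density:
  fixes w :: "'a \<Rightarrow> 'b::euclidean_space"
  assumes G: "finite_measure G" "\<Phi> \<in> G \<rightarrow>\<^sub>M N" and w: "integrable G w"
  shows "\<exists>u. integrable (distr G N \<Phi>) u \<and>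
    (\<forall>h :: 'c \<Rightarrow> 'b. h \<in> borel_measurable N \<longrightarrow> bounded (range h) \<longrightarrow>
      integrable G (\<lambda>z. h (\<Phi> z) \<bullet> w z) \<and>
      integrable (distr G N \<Phi>) (\<lambda>y. h y \<bullet> u y) \<and> (\<integral>y. h y \<bullet> u y \<partial>distr G N \<Phi>) = (\<integral>z. h (\<Phi> z) \<bullet> w z \<partial>G))"
proof -
  let ?D = "distr G N \<Phi>"
  define P where "P b u \<longleftrightarrow> integrable ?D u \<and> (\<forall>h. h \<in> borel_measurable N \<longrightarrow> bounded (range h) \<longrightarrow>
      integrable ?D (\<lambda>y. h y * u y) \<and> (\<integral>y. h y * u y \<partial>?D) = (\<integral>z. h (\<Phi> z) * (w z \<bullet> b) \<partial>G))" for b u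
  have "\<exists>u. P b u" for b
    using w unfolding P_def by (intro image_density_real G) auto
  then obtain v where "\<And>b. P b (v b)" by metis
  then have v: "\<And>b. integrable ?D (v b)" "\<And>b h. h \<in> borel_measurable N \<Longrightarrow> bounded (range h) \<Longrightarrow>
      integrable ?D (\<lambda>y. h y * v b y) \<and> (\<integral>y. h y * v b y \<partial>?D) = (\<integral>z. h (\<Phi> z) * (w z \<bullet> b) \<partial>G)"
    unfolding P_def by blast+
  define u where "u y = (\<Sum>b\<in>Basis. v b y *\<^sub>R b)" for y
  have u: "integrable ?D u" unfolding u_def using v(1) by auto
  have main: "integrable G (\<lambda>z. h (\<Phi> z) \<bullet> w z) \<and> integrable ?D (\<lambda>y. h y \<bullet> u y) \<and>
      (\<integral>y. h y \<bullet> u y \<partial>?D) = (\<integral>z. h (\<Phi> z) \<bullet> w z \<partial>G)"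
    if h[measurable]: "h \<in> borel_measurable N" and bd: "bounded (range h)" for h :: "'c \<Rightarrow> 'b"
  proof -
    obtain B where B: "\<And>y. norm (h y) \<le> B" using bd by (auto simp: bounded_iff)
    have hb: "(\<lambda>y. h y \<bullet> b) \<in> borel_measurable N" "bounded (range (\<lambda>y. h y \<bullet> b))" if "b \<in> Basis" for b
    proof -
      show "(\<lambda>y. h y \<bullet> b) \<in> borel_measurable N" by measurable
      have "\<bar>h y \<bullet> b\<bar> \<le> B" for y
        using B[of y] Basis_le_norm[OF that, of "h y"] by linarith
      then show "bounded (range (\<lambda>y. h y \<bullet> b))" unfolding bounded_iff by auto
    qed
    have iw: "integrable G (\<lambda>z. (h (\<Phi> z) \<bullet> b) * (w z \<bullet> b))" if b: "b \<in> Basis" for b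
    proof (rule Bochner_Integration.integrable_bound)
      note [measurable] = G(2) borel_measurable_integrable[OF w]
      show "integrable G (\<lambda>z. B * (w z \<bullet> b))" using w by auto
      have "\<bar>h y \<bullet> b\<bar> \<le> \<bar>B\<bar>" for y using B[of y] Basis_le_norm[OF b, of "h y"] by linarith
      then show "AE z in G. norm (h (\<Phi> z) \<bullet> b * (w z \<bullet> b)) \<le> norm (B * (w z \<bullet> b))"
        by (auto simp: abs_mult intro!: mult_right_mono)
    qed (use G(2) borel_measurable_integrable[OF w] in measurable)
    have eq1: "h (\<Phi> z) \<bullet> w z = (\<Sum>b\<in>Basis. (h (\<Phi> z) \<bullet> b) * (w z \<bullet> b))" for z
      by (rule euclidean_inner)
    have eq2: "h y \<bullet> u y = (\<Sum>b\<in>Basis. (h y \<bullet> b) * v b y)" for y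
      by (simp add: u_def inner_sum_right mult.commute)
    show ?thesis unfolding eq1 eq2
      using v(2)[OF hb] iw by (auto simp: Bochner_Integration.integral_sum)
  qed
  show ?thesis using u main by blast
qed

text \<open>Jensen's inequality for the conditional expectation \<open>u\<close>: integrate the tangent plane inequality
  at \<open>u\<close>, truncated so that every integral exists.\<close>
lemma image_density_quadratic:
  fixes w :: "'a \<Rightarrow> real^'n" and R :: "real^'n^'n"
  assumes G: "finite_measure G" and [measurable]: "\<Phi> \<in> G \<rightarrow>\<^sub>M N" and w: "integrable G w"
    and u: "integrable (distr G N \<Phi>) u"
    and uw: "\<And>h :: 'c \<Rightarrow> real^'n. h \<in> borel_measurable N \<Longrightarrow> bounded (range h) \<Longrightarrow>
      integrable G (\<lambda>z. h (\<Phi> z) \<bullet> w z) \<and>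
      integrable (distr G N \<Phi>) (\<lambda>y. h y \<bullet> u y) \<and> (\<integral>y. h y \<bullet> u y \<partial>distr G N \<Phi>) = (\<integral>z. h (\<Phi> z) \<bullet> w z \<partial>G)"
    and psd: "\<And>v. v \<bullet> (R *v v) \<ge> 0"
  shows "(\<integral>\<^sup>+y. ennreal (u y \<bullet> (R *v u y)) \<partial>distr G N \<Phi>) \<le> (\<integral>\<^sup>+z. ennreal (w z \<bullet> (R *v w z)) \<partial>G)"
proof (cases "(\<integral>\<^sup>+z. ennreal (w z \<bullet> (R *v w z)) \<partial>G) = \<infinity>")
  case False
  let ?D = "distr G N \<Phi>"
  interpret G: finite_measure G by fact
  interpret D: finite_measure ?D by (rule G.finite_measure_distr) measurable
  define q where "q v = v \<bullet> (R *v v)" for v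
  \<comment> \<open>\<open>L\<close> is the gradient of \<open>q\<close>. R is not assumed
    symmetric, whence the transposed term.\<close>
  define L where "L v = R *v v + transpose R *v v" for v
  have q_cont: "continuous_on UNIV q" and L_cont: "continuous_on UNIV L"
    unfolding q_def L_def by (intro continuous_intros matrix_vector_mult_linear_continuous_on)+
  note [measurable] = borel_measurable_continuous_onI[OF q_cont] borel_measurable_continuous_onI[OF L_cont]
    borel_measurable_integrable[OF w]
  have [measurable]: "u \<in> borel_measurable N" using borel_measurable_integrable[OF u] by simp
  have Lq: "L v \<bullet> v = 2 * q v" for v
    by (simp add: L_def q_def inner_add_left dot_lmul_matrix transpose_matrix_vector inner_commute[of "R *v v"])
  have tangent: "q b \<ge> L a \<bullet> b - q a" for a b
  proof -
    have "0 \<le> q (b - a)" using psd by (simp add: q_def)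
    also have "q (b - a) = q b - L a \<bullet> b + q a"
      by (simp add: q_def L_def inner_diff_left inner_diff_right inner_add_left matrix_vector_mult_diff_distrib
          dot_lmul_matrix transpose_matrix_vector inner_commute[of "R *v a"])
    finally show ?thesis by simp
  qed
  have iqw: "integrable G (\<lambda>z. q (w z))"
    using False psd unfolding q_def[symmetric] by (intro integrableI_nonneg) (auto simp: less_top)
  have bound: "(\<integral>\<^sup>+y. ennreal (if norm (u y) \<le> real k then q (u y) else 0) \<partial>?D) \<le> (\<integral>\<^sup>+z. ennreal (q (w z)) \<partial>G)" for k
  proof -
    \<comment> \<open>Replacing u by 0 where it is large, rather than projecting it to a ball, keeps
      \<open>L (a y) \<bullet> u y = 2 * q (a y)\<close> exact, since \<open>a y\<close> is either
      \<open>u y\<close> or 0. The tangent is taken at \<open>a\<close>, so \<open>L (a y)\<close>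
      is an admissible bounded test.\<close>
    define a where "a y = (if norm (u y) \<le> real k then u y else 0)" for y
    have [measurable]: "a \<in> borel_measurable N" unfolding a_def by measurable
    have na: "norm (a y) \<le> real k" for y by (simp add: a_def)
    then have ra: "range a \<subseteq> cball 0 (real k)" by auto
    have bdL: "bounded (range (\<lambda>y. L (a y)))" and bdq: "bounded (range (\<lambda>y. q (a y)))"
    proof -
      have "bounded (L ` cball 0 (real k))" "bounded (q ` cball 0 (real k))"
        using compact_cball L_cont q_cont by (auto intro!: compact_imp_bounded compact_continuous_image intro: continuous_on_subset)
      then show "bounded (range (\<lambda>y. L (a y)))" "bounded (range (\<lambda>y. q (a y)))"
        using na by (auto elim!: bounded_subset)
    qed
    have iqa: "integrable ?D (\<lambda>y. q (a y))"
    proof -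
      obtain B where "\<And>y. norm (q (a y)) \<le> B" using bdq by (auto simp: bounded_iff)
      then show ?thesis by (intro D.integrable_const_bound[of _ B]) auto
    qed
    have iqa': "integrable G (\<lambda>z. q (a (\<Phi> z)))" "(\<integral>z. q (a (\<Phi> z)) \<partial>G) = (\<integral>y. q (a y) \<partial>?D)"
      using iqa by (simp_all add: integrable_distr_eq integral_distr)
    have La: "integrable G (\<lambda>z. L (a (\<Phi> z)) \<bullet> w z)" "(\<integral>y. L (a y) \<bullet> u y \<partial>?D) = (\<integral>z. L (a (\<Phi> z)) \<bullet> w z \<partial>G)"
      using uw[OF _ bdL] by auto
    have Lau: "L (a y) \<bullet> u y = 2 * q (a y)" for y
      using Lq[of "u y"] by (auto simp: a_def q_def L_def)
    have "(\<integral>y. q (a y) \<partial>?D) = (\<integral>z. L (a (\<Phi> z)) \<bullet> w z - q (a (\<Phi> z)) \<partial>G)"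
      using La iqa' by (simp add: Bochner_Integration.integral_diff Lau)
    also have "\<dots> \<le> (\<integral>z. q (w z) \<partial>G)"
      using La(1) iqa'(1) iqw tangent by (intro integral_mono) auto
    finally have "ennreal (\<integral>y. q (a y) \<partial>?D) \<le> ennreal (\<integral>z. q (w z) \<partial>G)" by (rule ennreal_leI)
    then have "(\<integral>\<^sup>+y. ennreal (q (a y)) \<partial>?D) \<le> (\<integral>\<^sup>+z. ennreal (q (w z)) \<partial>G)"
      using iqa iqw psd by (simp add: nn_integral_eq_integral q_def)
    moreover have "q (a y) = (if norm (u y) \<le> real k then q (u y) else 0)" for y
      by (auto simp: a_def q_def)
    ultimately show ?thesis by simp
  qed
  have "(\<lambda>k. \<integral>\<^sup>+y. ennreal (if norm (u y) \<le> real k then q (u y) else 0) \<partial>?D) \<longlonglongrightarrow> (\<integral>\<^sup>+y. ennreal (q (u y)) \<partial>?D)"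
  proof (rule nn_integral_LIMSEQ)
    show "incseq (\<lambda>k y. ennreal (if norm (u y) \<le> real k then q (u y) else 0))"
      using psd by (auto simp: incseq_def le_fun_def q_def intro!: ennreal_leI)
    fix y
    obtain k0 where k0: "norm (u y) \<le> real k0" using real_arch_simple by blast
    show "(\<lambda>k. ennreal (if norm (u y) \<le> real k then q (u y) else 0)) \<longlonglongrightarrow> ennreal (q (u y))"
      by (rule tendsto_eventually, rule eventually_mono[OF eventually_ge_at_top[of k0]]) (use k0 in auto)
  qed measurable
  then have "(\<integral>\<^sup>+y. ennreal (q (u y)) \<partial>?D) \<le> (\<integral>\<^sup>+z. ennreal (q (w z)) \<partial>G)"
    by (rule LIMSEQ_le_const2) (use bound in auto)
  then show ?thesis by (simp add: q_def)
qed simp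

section \<open>Test functions\<close>

text \<open>The definition asks only \<phi> to vanish off S. Off the closed set S the function is
  locally zero relative to the strip, and a derivative within the strip is unique, even at the times
  0 and T, because every coordinate direction can be followed inside it.\<close>

lemma C1c_test_support:
  fixes \<phi> :: "real \<times> (real^'d) \<Rightarrow> real"
  assumes "T > 0" and test: "C1c_test T \<phi> \<phi>t \<phi>x"
  obtains S where "compact S" "\<And>z. z \<in> {0..T} \<times> UNIV - S \<Longrightarrow> \<phi> z = 0 \<and> \<phi>t z = 0 \<and> \<phi>x z = 0"
proof -
  let ?D = "{0..T} \<times> (UNIV :: (real^'d) set)"
  obtain S where S: "compact S" "\<And>z. z \<in> ?D - S \<Longrightarrow> \<phi> z = 0"
    and der: "\<And>z. z \<in> ?D \<Longrightarrow> (\<phi> has_derivative (\<lambda>(h, k). h * \<phi>t z + \<phi>x z \<bullet> k)) (at z within ?D)"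
    using test unfolding C1c_test_def by blast
  have "\<phi> z = 0 \<and> \<phi>t z = 0 \<and> \<phi>x z = 0" if z: "z \<in> ?D - S" for z
  proof -
    have "open (- S)" using S(1) by (simp add: compact_imp_closed open_Compl)
    then have "\<forall>\<^sub>F y in nhds z. y \<in> - S"
      using z by (intro eventually_nhds_in_open) auto
    then have ev: "\<forall>\<^sub>F y in at z within ?D. \<phi> y = 0"
      unfolding eventually_at_filter
    proof (rule eventually_mono)
      fix y assume "y \<in> - S"
      then show "y \<noteq> z \<longrightarrow> y \<in> ?D \<longrightarrow> \<phi> y = 0" using S(2)[of y] by simp
    qed
    have zD: "z \<in> ?D" using z by (rule DiffD1)
    have "((\<lambda>_. 0) has_derivative (\<lambda>(h, k). h * \<phi>t z + \<phi>x z \<bullet> k)) (at z within ?D)"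
      by (rule has_derivative_transform_eventually[OF der[OF zD] ev S(2)[OF z] zD])
    then have eq: "(\<lambda>(h, k). h * \<phi>t z + \<phi>x z \<bullet> k) = (\<lambda>_. 0)"
    proof (rule frechet_derivative_unique_within)
      show "((\<lambda>_. 0) has_derivative (\<lambda>_. 0)) (at z within ?D)" by simp
      fix i :: "real \<times> (real^'d)" and e :: real assume i: "i \<in> Basis" and "e > 0"
      \<comment> \<open>A time step that stays in [0,T]: backwards from T, forwards from any other
        time. Halving e makes it strictly smaller than e.\<close>
      define d where "d = (if fst z = T then - min (e/2) T else min (e/2) (T - fst z))"
      have d: "0 < \<bar>d\<bar>" "\<bar>d\<bar> < e" "fst z + d \<in> {0..T}"
        using z \<open>e > 0\<close> \<open>T > 0\<close> by (auto simp: d_def)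
      have "z + d *\<^sub>R i \<in> ?D"
        using i d(3) z by (auto simp: Basis_prod_def mem_Times_iff)
      with d(1,2) show "\<exists>d. 0 < \<bar>d\<bar> \<and> \<bar>d\<bar> < e \<and> z + d *\<^sub>R i \<in> ?D"
        by (intro exI[of _ d] conjI)
    qed
    have "\<phi>t z = 0" using fun_cong[OF eq, of "(1, 0)"] by simp
    moreover have "\<phi>x z = 0" using fun_cong[OF eq, of "(0, \<phi>x z)"] by simp
    ultimately show ?thesis using S(2)[OF z] by simp
  qed
  then show ?thesis by (rule that[OF S(1)])
qed

lemma C1c_test_bounded:
  fixes \<phi> :: "real \<times> (real^'d) \<Rightarrow> real"
  assumes "T > 0" and test: "C1c_test T \<phi> \<phi>t \<phi>x"
  obtains K \<rho> where "K \<ge> 0" "\<rho> \<ge> 0"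
    "\<And>z. z \<in> {0..T} \<times> UNIV \<Longrightarrow> \<bar>\<phi> z\<bar> \<le> K \<and> \<bar>\<phi>t z\<bar> \<le> K \<and> norm (\<phi>x z) \<le> K"
    "\<And>z. z \<in> {0..T} \<times> UNIV \<Longrightarrow> norm (snd z) > \<rho> \<Longrightarrow> \<phi> z = 0 \<and> \<phi>t z = 0 \<and> \<phi>x z = 0"
proof -
  let ?D = "{0..T} \<times> (UNIV :: (real^'d) set)"
  obtain S where S: "compact S" "\<And>z. z \<in> ?D - S \<Longrightarrow> \<phi> z = 0 \<and> \<phi>t z = 0 \<and> \<phi>x z = 0"
    using C1c_test_support[OF assms] by blast
  have cont: "continuous_on ?D \<phi>" "continuous_on ?D \<phi>t" "continuous_on ?D \<phi>x"
    using test has_derivative_continuous_on[of ?D \<phi> "\<lambda>z. \<lambda>(h, k). h * \<phi>t z + \<phi>x z \<bullet> k"]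
    unfolding C1c_test_def by blast+
  have comp: "compact (?D \<inter> S)"
    using S(1) by (intro closed_Int_compact closed_Times) auto
  have "bounded (\<phi> ` (?D \<inter> S))" "bounded (\<phi>t ` (?D \<inter> S))" "bounded (\<phi>x ` (?D \<inter> S))"
    by (intro compact_imp_bounded compact_continuous_image comp; use cont in \<open>auto intro: continuous_on_subset\<close>)+
  then obtain K1 K2 K3 where K: "\<And>z. z \<in> ?D \<inter> S \<Longrightarrow> \<bar>\<phi> z\<bar> \<le> K1" "\<And>z. z \<in> ?D \<inter> S \<Longrightarrow> \<bar>\<phi>t z\<bar> \<le> K2"
    "\<And>z. z \<in> ?D \<inter> S \<Longrightarrow> norm (\<phi>x z) \<le> K3"
    unfolding bounded_iff by (metis imageI real_norm_def)
  obtain \<rho> where \<rho>: "\<And>z. z \<in> S \<Longrightarrow> norm z \<le> \<rho>"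
    using compact_imp_bounded[OF S(1)] by (auto simp: bounded_iff)
  show ?thesis
  proof (rule that[of "max 0 (max K1 (max K2 K3))" "max 0 \<rho>"])
    fix z assume z: "z \<in> ?D"
    show "\<bar>\<phi> z\<bar> \<le> max 0 (max K1 (max K2 K3)) \<and> \<bar>\<phi>t z\<bar> \<le> max 0 (max K1 (max K2 K3)) \<and> norm (\<phi>x z) \<le> max 0 (max K1 (max K2 K3))"
    proof (cases "z \<in> S")
      case True
      then show ?thesis using K(1)[of z] K(2)[of z] K(3)[of z] z by (auto simp: le_max_iff_disj)
    next
      case False
      then show ?thesis using S(2)[of z] z by simp
    qed
    assume "norm (snd z) > max 0 \<rho>"
    then have "z \<notin> S" using \<rho>[of z] norm_snd_le[of "snd z" "fst z"] by force
    then show "\<phi> z = 0 \<and> \<phi>t z = 0 \<and> \<phi>x z = 0" using S(2) z by blast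
  qed auto
qed

text \<open>Moves the test function instead of the curve: for a frozen value of the noise, the
  equation of the displaced curve is the original equation tested with this function.\<close>

lemma C1c_test_shift:
  fixes \<phi> :: "real \<times> (real^'d) \<Rightarrow> real"
  assumes "T > 0" and test: "C1c_test T \<phi> \<phi>t \<phi>x"
    and z: "\<And>t. (z has_vector_derivative z' t) (at t)" and z': "continuous_on UNIV z'"
  shows "C1c_test T (\<lambda>(t, x). \<phi> (t, x + z t)) (\<lambda>(t, x). \<phi>t (t, x + z t) + \<phi>x (t, x + z t) \<bullet> z' t)
    (\<lambda>(t, x). \<phi>x (t, x + z t))"
  unfolding C1c_test_def
proof (intro conjI ballI)
  let ?D = "{0..T} \<times> (UNIV :: (real^'d) set)"
  define \<Psi> where "\<Psi> p = (fst p, snd p + z (fst p))" for p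
  have der: "\<And>p. p \<in> ?D \<Longrightarrow> (\<phi> has_derivative (\<lambda>(h, k). h * \<phi>t p + \<phi>x p \<bullet> k)) (at p within ?D)"
    and cont: "continuous_on ?D \<phi>t" "continuous_on ?D \<phi>x"
    using test unfolding C1c_test_def by blast+
  have z_cont: "continuous_on UNIV z"
    using z by (intro continuous_at_imp_continuous_on) (blast intro: has_vector_derivative_continuous)
  have \<Psi>_im: "\<Psi> ` ?D \<subseteq> ?D" by (auto simp: \<Psi>_def)
  have \<Psi>_cont: "continuous_on ?D \<Psi>"
    unfolding \<Psi>_def by (intro continuous_intros continuous_on_compose2[OF z_cont]) auto
  {
    fix p assume p: "p \<in> ?D"
    have "(\<Psi> has_derivative (\<lambda>q. (fst q, snd q + fst q *\<^sub>R z' (fst p)))) (at p within ?D)"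
      unfolding \<Psi>_def
      by (intro has_derivative_Pair has_derivative_add has_derivative_fst has_derivative_snd has_derivative_ident
          has_derivative_compose[OF has_derivative_fst[OF has_derivative_ident] z[unfolded has_vector_derivative_def]])
    from has_derivative_in_compose2[OF der \<Psi>_im p this]
    have "((\<lambda>q. \<phi> (\<Psi> q)) has_derivative
       (\<lambda>q. fst q * \<phi>t (\<Psi> p) + \<phi>x (\<Psi> p) \<bullet> (snd q + fst q *\<^sub>R z' (fst p)))) (at p within ?D)"
      by (simp add: case_prod_unfold)
    then show "((\<lambda>(t, x). \<phi> (t, x + z t)) has_derivative
      (\<lambda>(h, k). h * (case p of (t, x) \<Rightarrow> \<phi>t (t, x + z t) + \<phi>x (t, x + z t) \<bullet> z' t) +
        (case p of (t, x) \<Rightarrow> \<phi>x (t, x + z t)) \<bullet> k)) (at p within ?D)"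
      by (simp add: case_prod_unfold \<Psi>_def algebra_simps inner_add_right)
  }
  have c: "continuous_on ?D (\<lambda>p. \<phi>t (\<Psi> p))" "continuous_on ?D (\<lambda>p. \<phi>x (\<Psi> p))"
    using continuous_on_compose2[OF cont(1) \<Psi>_cont \<Psi>_im] continuous_on_compose2[OF cont(2) \<Psi>_cont \<Psi>_im] .
  have "continuous_on ?D (\<lambda>p. z' (fst p))"
    by (intro continuous_on_compose2[OF z'] continuous_intros) auto
  with c show "continuous_on ?D (\<lambda>(t, x). \<phi>t (t, x + z t) + \<phi>x (t, x + z t) \<bullet> z' t)"
    by (auto simp: case_prod_unfold \<Psi>_def intro!: continuous_intros)
  show "continuous_on ?D (\<lambda>(t, x). \<phi>x (t, x + z t))"
    using c(2) by (simp add: case_prod_unfold \<Psi>_def)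
  obtain S where S: "compact S" "\<And>z. z \<in> ?D - S \<Longrightarrow> \<phi> z = 0"
    using test unfolding C1c_test_def by blast
  have "compact ((\<lambda>p. (fst p, snd p - z (fst p))) ` (?D \<inter> S))"
  proof (rule compact_continuous_image)
    show "continuous_on (?D \<inter> S) (\<lambda>p. (fst p, snd p - z (fst p)))"
      by (intro continuous_intros continuous_on_compose2[OF z_cont]) auto
    show "compact (?D \<inter> S)"
      using S(1) by (intro closed_Int_compact closed_Times) auto
  qed
  moreover have "\<phi> (t, x + z t) = 0"
    if "t \<in> {0..T}" "(t, x) \<notin> (\<lambda>p. (fst p, snd p - z (fst p))) ` (?D \<inter> S)" for t x
  proof -
    have "(t, x + z t) \<notin> S"
    proof
      assume "(t, x + z t) \<in> S"
      then have "(fst (t, x + z t), snd (t, x + z t) - z (fst (t, x + z t))) \<in> (\<lambda>p. (fst p, snd p - z (fst p))) ` (?D \<inter> S)"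
        using that(1) by (intro imageI) auto
      with that(2) show False by simp
    qed
    then show ?thesis using S(2) that by auto
  qed
  ultimately show "\<exists>S. compact S \<and> (\<forall>p\<in>?D - S. (case p of (t, x) \<Rightarrow> \<phi> (t, x + z t)) = 0)"
    by (intro exI conjI) auto
qed

text \<open>With \<open>g = sqrt (1 + \<bar>x\<bar>\<^sup>2)\<close>, the difference \<open>N/2 - tent N x\<close> is the C1 concave truncation of \<open>g\<close>
  that equals \<open>g - g\<^sup>2/(2N)\<close> for \<open>g \<le> N\<close> and \<open>N/2\<close> beyond; \<open>tent N\<close> itself has compact support.\<close>
definition tent :: "real \<Rightarrow> 'a::real_inner \<Rightarrow> real" where
  "tent N x = (max 0 (N - sqrt (1 + x \<bullet> x)))\<^sup>2 / (2 * N)"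

definition tent_grad :: "real \<Rightarrow> 'a::real_inner \<Rightarrow> 'a" where
  "tent_grad N x = - (max 0 (N - sqrt (1 + x \<bullet> x)) / (N * sqrt (1 + x \<bullet> x))) *\<^sub>R x"

lemma DERIV_max_0_squared: "((\<lambda>y::real. (max 0 y)\<^sup>2) has_real_derivative 2 * max 0 y) (at y)"
proof -
  consider "y > 0" | "y < 0" | "y = 0" by linarith
  then show ?thesis
  proof cases
    case 1
    have "((\<lambda>y. y\<^sup>2) has_real_derivative 2 * max 0 y) (at y)"
      using 1 by (auto intro!: derivative_eq_intros)
    then show ?thesis
      by (rule DERIV_cong_ev[THEN iffD1, rotated -1, OF _ refl _ refl])
        (use eventually_gt_at_top 1 in \<open>auto intro!: eventually_mono[OF eventually_nhds_in_open[of "{0<..}"]]\<close>)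
  next
    case 2
    have "((\<lambda>y. 0) has_real_derivative 2 * max 0 y) (at y)"
      using 2 by simp
    then show ?thesis
      by (rule DERIV_cong_ev[THEN iffD1, rotated -1, OF _ refl _ refl])
        (use 2 in \<open>auto intro!: eventually_mono[OF eventually_nhds_in_open[of "{..<0}"]]\<close>)
  next
    case 3
    have "((\<lambda>h::real. (max 0 h)\<^sup>2 / h) \<longlongrightarrow> 0) (at 0)"
    proof (rule Lim_null_comparison)
      show "\<forall>\<^sub>F h::real in at 0. norm ((max 0 h)\<^sup>2 / h) \<le> \<bar>h\<bar>"
        by (rule always_eventually) (auto simp: max_def power2_eq_square)
      show "((\<lambda>h::real. \<bar>h\<bar>) \<longlongrightarrow> 0) (at 0)"
        by (rule tendsto_rabs_zero) (rule tendsto_ident_at)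
    qed
    then show ?thesis using 3 by (simp add: has_field_derivative_iff)
  qed
qed

lemma has_derivative_tent:
  fixes x :: "'a::real_inner"
  assumes "N > 0"
  shows "(tent N has_derivative (\<lambda>k. tent_grad N x \<bullet> k)) (at x)"
proof -
  define g where "g x = sqrt (1 + x \<bullet> x)" for x :: 'a
  have pos: "1 + x \<bullet> x > 0" for x :: 'a
    by (metis add_pos_nonneg inner_ge_zero zero_less_one)
  have "((\<lambda>x::'a. 1 + x \<bullet> x) has_derivative (\<lambda>k. 2 * (x \<bullet> k))) (at x)"
    by (auto intro!: derivative_eq_intros simp: inner_commute)
  from DERIV_compose_FDERIV[OF DERIV_real_sqrt[OF pos] this]
  have g: "(g has_derivative (\<lambda>k. (x \<bullet> k) / g x)) (at x)"
    by (simp add: g_def[abs_def] field_simps)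
  then have "((\<lambda>x. N - g x) has_derivative (\<lambda>k. - ((x \<bullet> k) / g x))) (at x)"
    by (auto intro!: derivative_eq_intros)
  from DERIV_compose_FDERIV[OF DERIV_max_0_squared this]
  have "((\<lambda>x. (max 0 (N - g x))\<^sup>2 * (1 / (2 * N))) has_derivative
      (\<lambda>k. (- ((x \<bullet> k) / g x) * (2 * max 0 (N - g x))) * (1 / (2 * N)))) (at x)"
    by (rule has_derivative_mult_left)
  moreover have "(- ((x \<bullet> k) / g x) * (2 * max 0 (N - g x))) * (1 / (2 * N)) = tent_grad N x \<bullet> k" for k
    using assms pos[of x] by (simp add: tent_grad_def g_def field_simps)
  ultimately show ?thesis by (simp add: tent_def[abs_def] g_def)
qed

lemma continuous_tent: "N > 0 \<Longrightarrow> continuous_on A (tent N)"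
  by (intro continuous_at_imp_continuous_on ballI has_derivative_continuous[OF has_derivative_tent])

lemma one_le_sqrt_one_plus_inner: "1 \<le> sqrt (1 + x \<bullet> x)"
  by simp

lemma continuous_tent_grad: "N > 0 \<Longrightarrow> continuous_on A (tent_grad N)"
  unfolding tent_grad_def
  by (intro continuous_intros) (metis one_le_sqrt_one_plus_inner mult_eq_0_iff not_one_le_zero order_less_irrefl)

lemma norm_le_sqrt_one_plus_inner: "norm x \<le> sqrt (1 + x \<bullet> x)"
  unfolding norm_eq_sqrt_inner by simp

text \<open>The sixth estimate is the reason for this truncation: the drift grows like
  \<open>norm x\<close>, and its contribution is dominated by the truncated moment itself, with a
  constant free of N. With g = sqrt(1 + x \<bullet> x) < N, its left side is at most g - g^2/N and
  its right side is g - g^2/(2N). The fifth estimate handles the control term; the third and the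
  seventh compare the truncation with g from above and, for g \<le> N, from below.\<close>

lemma tent_estimates:
  fixes x :: "'a::real_inner"
  assumes N: "N > 0"
  shows "0 \<le> tent N x" "tent N x \<le> N / 2" "N / 2 - tent N x \<le> sqrt (1 + x \<bullet> x)"
    "norm x \<ge> N \<Longrightarrow> tent N x = 0"
    "norm (tent_grad N x) \<le> 1"
    "norm x * norm (tent_grad N x) \<le> N / 2 - tent N x"
    "sqrt (1 + x \<bullet> x) \<le> N \<Longrightarrow> sqrt (1 + x \<bullet> x) / 2 \<le> N / 2 - tent N x"
proof -
  define g where "g = sqrt (1 + x \<bullet> x)"
  have g: "1 \<le> g" "norm x \<le> g"
    unfolding g_def by (rule one_le_sqrt_one_plus_inner norm_le_sqrt_one_plus_inner)+
  have t: "tent N x = (max 0 (N - g))\<^sup>2 / (2 * N)" by (simp add: tent_def g_def)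
  have ng: "norm (tent_grad N x) = max 0 (N - g) / N * (norm x / g)"
    using N g(1) by (simp add: tent_grad_def g_def[symmetric])
  show "0 \<le> tent N x" using N by (simp add: t)
  have expand: "g < N \<Longrightarrow> N / 2 - tent N x = g - g\<^sup>2 / (2 * N)" "\<not> g < N \<Longrightarrow> tent N x = 0"
    using N by (simp_all add: t field_simps power2_eq_square)
  have gg: "0 \<le> g\<^sup>2 / (2 * N)" "g < N \<Longrightarrow> g\<^sup>2 / (2 * N) \<le> g / 2"
    using N g by (auto simp: field_simps power2_eq_square)
  show "tent N x \<le> N / 2" "N / 2 - tent N x \<le> sqrt (1 + x \<bullet> x)"
    using expand gg g N unfolding g_def[symmetric] by (cases "g < N"; linarith)+
  show "tent N x = 0" if "norm x \<ge> N" using expand(2) that g by linarith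
  show "sqrt (1 + x \<bullet> x) / 2 \<le> N / 2 - tent N x" if "sqrt (1 + x \<bullet> x) \<le> N"
    using expand gg that unfolding g_def[symmetric] by (cases "g < N") auto
  have q: "norm x / g \<le> 1" "0 \<le> norm x / g" using g by auto
  have m: "max 0 (N - g) / N \<le> 1" "0 \<le> max 0 (N - g) / N" using N g by auto
  show "norm (tent_grad N x) \<le> 1" unfolding ng using mult_mono[OF m(1) q(1)] q(2) by simp
  have "norm x * norm (tent_grad N x) \<le> g * (max 0 (N - g) / N * 1)"
    unfolding ng using g q m by (intro mult_mono mult_nonneg_nonneg) auto
  also have "\<dots> \<le> N / 2 - tent N x"
  proof (cases "g < N")
    case True
    have "g * (max 0 (N - g) / N * 1) = g - g\<^sup>2 / N"
      using True N by (simp add: field_simps power2_eq_square)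
    also have "\<dots> \<le> g - g\<^sup>2 / (2 * N)" using N by (simp add: field_simps)
    finally show ?thesis using expand(1)[OF True] by simp
  qed (use expand(2) N in auto)
  finally show "norm x * norm (tent_grad N x) \<le> N / 2 - tent N x" .
qed

section \<open>Propagation of first moments\<close>

lemma time_measure_integral:
  fixes h :: "real \<Rightarrow> real"
  assumes h: "continuous_on {0..T} h"
  shows "integrable (time_measure T) h" "(\<integral>t. h t \<partial>time_measure T) = integral {0..T} h"
proof -
  have *: "set_integrable lborel {0..T} h" by (rule borel_integrable_atLeastAtMost'[OF h])
  show "integrable (time_measure T) h"
    using * by (simp add: integrable_restrict_space set_integrable_def)
  have "(\<integral>t. h t \<partial>time_measure T) = (\<integral>t\<in>{0..T}. h t \<partial>lborel)"
    unfolding set_lebesgue_integral_def by (rule integral_restrict_space) simp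
  then show "(\<integral>t. h t \<partial>time_measure T) = integral {0..T} h"
    using set_borel_integral_eq_integral(2)[OF *] by simp
qed

lemma continuous_on_compact_norm_bounded:
  assumes "compact S" "continuous_on S f"
  obtains K where "\<And>x. x \<in> S \<Longrightarrow> norm (f x) \<le> K"
  using compact_imp_bounded[OF compact_continuous_image[OF assms(2,1)]] by (auto simp: bounded_iff)

context narrow_curve begin

lemma integrable_bounded_continuous:
  fixes h :: "real \<times> (real^'d) \<Rightarrow> real"
  assumes "continuous_on ({0..T} \<times> UNIV) h" "\<And>z. z \<in> {0..T} \<times> UNIV \<Longrightarrow> \<bar>h z\<bar> \<le> K"
  shows "integrable C h"
  using continuous_on_measurable_spacetime[OF assms(1)] assms(2)
  by (intro finite_measure.integrable_const_bound[OF finite_curve_measure, of _ K] AE_I2)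
    (auto cong: measurable_cong_sets)

lemma integrable_bounded_continuous_inner:
  fixes h :: "real \<times> (real^'d) \<Rightarrow> 'b::euclidean_space"
  assumes "continuous_on ({0..T} \<times> UNIV) h" "\<And>z. z \<in> {0..T} \<times> UNIV \<Longrightarrow> norm (h z) \<le> K"
    and w: "integrable C w"
  shows "integrable C (\<lambda>z. h z \<bullet> w z)"
proof (rule Bochner_Integration.integrable_bound)
  have [measurable]: "h \<in> borel_measurable C" "w \<in> borel_measurable C"
    using continuous_on_measurable_spacetime[OF assms(1)] w by (auto cong: measurable_cong_sets)
  show "(\<lambda>z. h z \<bullet> w z) \<in> borel_measurable C" by measurable
  show "integrable C (\<lambda>z. K * norm (w z))" using w by auto
  show "AE z in C. norm (h z \<bullet> w z) \<le> norm (K * norm (w z))"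
  proof (rule AE_I2)
    fix z assume "z \<in> space C"
    then have "norm (h z) \<le> K" using assms(2) by simp
    then have "norm (h z) * norm (w z) \<le> \<bar>K * norm (w z)\<bar>"
      by (simp add: abs_mult mult_right_mono)
    then show "norm (h z \<bullet> w z) \<le> norm (K * norm (w z))"
      using Cauchy_Schwarz_ineq2[of "h z" "w z"] by simp
  qed
qed

text \<open>The drift \<open>A *v snd z\<close> is unbounded in space, but \<phi>x vanishes for
  \<open>norm (snd z) > \<rho>\<close>, so their product is bounded. The control term is a bounded
  field paired with an integrable one.\<close>

lemma integrable_test:
  fixes A :: "real^'d^'d" and B :: "real^'n^'d"
  assumes test: "C1c_test T \<phi> \<phi>t \<phi>x" and u: "integrable C u"
  shows "integrable C (\<lambda>z. \<phi>t z + \<phi>x z \<bullet> (A *v snd z + B *v u z))"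
proof -
  obtain K \<rho> where K: "K \<ge> 0" "\<rho> \<ge> 0"
    "\<And>z. z \<in> {0..T} \<times> UNIV \<Longrightarrow> \<bar>\<phi> z\<bar> \<le> K \<and> \<bar>\<phi>t z\<bar> \<le> K \<and> norm (\<phi>x z) \<le> K"
    and \<rho>: "\<And>z. z \<in> {0..T} \<times> UNIV \<Longrightarrow> norm (snd z) > \<rho> \<Longrightarrow> \<phi> z = 0 \<and> \<phi>t z = 0 \<and> \<phi>x z = 0"
    using C1c_test_bounded[OF T_pos test] by metis
  have cont: "continuous_on ({0..T} \<times> UNIV) \<phi>t" "continuous_on ({0..T} \<times> UNIV) \<phi>x"
    using test unfolding C1c_test_def by blast+
  obtain c where c: "c > 0" "\<And>x. norm (A *v x) \<le> c * norm x"
    using linear_bounded_pos[OF matrix_vector_mul_linear] by metis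
  have "integrable C (\<lambda>z. \<phi>x z \<bullet> (A *v snd z))"
  proof (rule integrable_bounded_continuous)
    show "continuous_on ({0..T} \<times> UNIV) (\<lambda>z. \<phi>x z \<bullet> (A *v snd z))"
      using cont by (intro continuous_intros bounded_linear.continuous_on[OF matrix_vector_mul_bounded_linear])
    fix z assume z: "z \<in> {0..T} \<times> (UNIV :: (real^'d) set)"
    show "\<bar>\<phi>x z \<bullet> (A *v snd z)\<bar> \<le> K * (c * \<rho>)"
    proof (cases "norm (snd z) > \<rho>")
      case True
      then show ?thesis using \<rho>[OF z] K c by simp
    next
      case False
      have "norm (A *v snd z) \<le> c * \<rho>"
        using c(2)[of "snd z"] mult_left_mono[of "norm (snd z)" \<rho> c] False c(1) by linarith
      then have "norm (\<phi>x z) * norm (A *v snd z) \<le> K * (c * \<rho>)"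
        using K(3)[OF z] K(1) by (intro mult_mono) auto
      then show ?thesis using Cauchy_Schwarz_ineq2[of "\<phi>x z" "A *v snd z"] by linarith
    qed
  qed
  moreover have "integrable C \<phi>t"
    using K(3) by (intro integrable_bounded_continuous[OF cont(1), of K]) auto
  moreover have "integrable C (\<lambda>z. B *v u z)"
    using u by (intro integrable_bounded_linear[OF linear_conv_bounded_linear[THEN iffD1, OF matrix_vector_mul_linear]])
  then have "integrable C (\<lambda>z. \<phi>x z \<bullet> (B *v u z))"
    using K(3) by (intro integrable_bounded_continuous_inner[OF cont(2), of K]) auto
  ultimately show ?thesis by (simp add: inner_add_right)
qed

lemma continuity_equationD:
  fixes A :: "real^'d^'d" and B :: "real^'n^'d"
  assumes "continuity_equation T (\<lambda>x v. A *v x + B *v v) u \<mu>" and test: "C1c_test T \<phi> \<phi>t \<phi>x"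
    and u: "integrable C u"
  shows "(\<integral>z. \<phi>t z + \<phi>x z \<bullet> (A *v snd z + B *v u z) \<partial>C) = (\<integral>x. \<phi> (T, x) \<partial>\<mu> T) - (\<integral>x. \<phi> (0, x) \<partial>\<mu> 0)"
  using assms(1) test set_integral_curve_measure[OF integrable_test[OF test u, of A B]]
  unfolding continuity_equation_def by auto

text \<open>For an integrable control the integrability clause of \<open>continuity_equation\<close>
  comes from \<open>integrable_test\<close>, so that the integral identity over the space-time
  measure remains.\<close>

lemma continuity_equationI:
  fixes A :: "real^'d^'d" and B :: "real^'n^'d"
  assumes u: "integrable C u" and "\<And>\<phi> \<phi>t \<phi>x. C1c_test T \<phi> \<phi>t \<phi>x \<Longrightarrow>
      (\<integral>z. \<phi>t z + \<phi>x z \<bullet> (A *v snd z + B *v u z) \<partial>C) = (\<integral>x. \<phi> (T, x) \<partial>\<mu> T) - (\<integral>x. \<phi> (0, x) \<partial>\<mu> 0)"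
  shows "continuity_equation T (\<lambda>x v. A *v x + B *v v) u \<mu>"
  unfolding continuity_equation_def
  using assms(2) set_integral_curve_measure[OF integrable_test[OF _ u, of _ _ _ A B]] integrable_test[OF _ u, of _ _ _ A B]
  by (auto simp: case_prod_unfold)

text \<open>Gronwall's inequality is obtained in one step: the multiplier \<open>\<omega>\<close> is the excess to be shown
  to vanish, and the test function carries its antiderivative and the integrating factor.\<close>
lemma tent_moment_bound:
  fixes A :: "real^'d^'d" and B :: "real^'n^'d"
  assumes CE: "continuity_equation T (\<lambda>x v. A *v x + B *v v) u \<mu>" and u: "integrable C u"
    and N: "N > 0" and A: "c \<ge> 0" "\<And>x. norm (A *v x) \<le> c * norm x"
    and B: "b \<ge> 0" "\<And>v. norm (B *v v) \<le> b * norm v"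
    and K: "(\<integral>x. N / 2 - tent N x \<partial>\<mu> 0) + b * (\<integral>z. norm (u z) \<partial>C) \<le> K"
    and t: "t \<in> {0..T}"
  shows "(\<integral>x. N / 2 - tent N x \<partial>\<mu> t) \<le> exp (c * t) * K"
proof -
  let ?D = "{0..T} \<times> (UNIV :: (real^'d) set)"
  define V where "V x = N / 2 - tent N x" for x :: "real^'d"
  have V: "0 \<le> V x" "V x \<le> N / 2" for x using tent_estimates(1,2)[OF N, of x] by (auto simp: V_def)
  have V_cont: "continuous_on UNIV V" unfolding V_def by (intro continuous_intros continuous_tent N)
  define F where "F s = (\<integral>x. V x \<partial>\<mu> s)" for s
  have F_cont: "continuous_on {0..T} F"
    using narrowly_continuous V_cont V unfolding narrowly_continuous_on_def F_def
    by (auto simp: bounded_iff intro!: exI[of _ "N / 2"])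
  \<comment> \<open>\<omega> is zero exactly where the desired bound holds, and \<omega> times
    \<open>exp (- c * s) * F s - K\<close> is \<omega> squared. It therefore suffices that the
    integral of this product is at most 0.\<close>
  define \<omega> where "\<omega> s = max 0 (exp (- c * s) * F s - K)" for s
  have \<omega>_cont: "continuous_on {0..T} \<omega>"
    unfolding \<omega>_def using F_cont by (intro continuous_intros)
  have \<omega>_nonneg: "0 \<le> \<omega> s" for s by (simp add: \<omega>_def)
  define \<eta> where "\<eta> s = integral {s..T} \<omega>" for s
  have \<omega>_int: "\<omega> integrable_on {s..T}" if "s \<in> {0..T}" for s
    using that by (intro integrable_continuous_interval continuous_on_subset[OF \<omega>_cont]) auto
  have \<eta>: "0 \<le> \<eta> s" "\<eta> s \<le> \<eta> 0" if "s \<in> {0..T}" for s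
    using that \<omega>_int[of s] \<omega>_int[of 0] \<omega>_nonneg T_pos unfolding \<eta>_def
    by (auto intro!: integral_nonneg integral_subset_le)
  \<comment> \<open>In a' the part \<open>- c * a s\<close> compensates the drift, and the part with
    \<omega> produces the integral to be estimated. As a vanishes at T, no terminal term
    appears.\<close>
  define a where "a s = exp (- c * s) * \<eta> s" for s
  define a' where "a' s = - c * a s - exp (- c * s) * \<omega> s" for s
  have \<eta>_der: "(\<eta> has_real_derivative - \<omega> s) (at s within {0..T})" if "s \<in> {0..T}" for s
    unfolding \<eta>_def by (rule integral_has_real_derivative'[OF \<omega>_cont that])
  have a_der: "(a has_real_derivative a' s) (at s within {0..T})" if "s \<in> {0..T}" for s
    unfolding a_def[abs_def] a'_def
    by (rule derivative_eq_intros \<eta>_der that refl)+ (simp add: a_def algebra_simps)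
  have a_cont: "continuous_on {0..T} a" using a_der by (rule DERIV_continuous_on)
  have a'_cont: "continuous_on {0..T} a'"
    unfolding a'_def using a_cont \<omega>_cont by (intro continuous_intros)
  have a_bd: "0 \<le> a s" "a s \<le> a 0" if "s \<in> {0..T}" for s
  proof -
    have "exp (- c * s) \<le> 1" using A(1) that by simp
    then have "exp (- c * s) * \<eta> s \<le> 1 * \<eta> 0" using \<eta>[OF that] by (intro mult_mono) auto
    then show "a s \<le> a 0" by (simp add: a_def)
    show "0 \<le> a s" using \<eta>[OF that] by (simp add: a_def)
  qed
  have aT: "a T = 0" by (simp add: a_def \<eta>_def)
  have fstD: "fst ` ?D \<subseteq> {0..T}" by auto
  have c_fst: "continuous_on ?D (\<lambda>z. h (fst z))" if "continuous_on {0..T} h" for h :: "real \<Rightarrow> real"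
    by (rule continuous_on_compose2[OF that continuous_on_fst[OF continuous_on_id] fstD])
  have c_snd: "continuous_on ?D (\<lambda>z. h (snd z))" if "continuous_on UNIV h" for h :: "real^'d \<Rightarrow> 'x::topological_space"
    by (rule continuous_on_compose2[OF that continuous_on_snd[OF continuous_on_id]]) simp
  have test: "C1c_test T (\<lambda>z :: real \<times> (real^'d). a (fst z) * tent N (snd z)) (\<lambda>z. a' (fst z) * tent N (snd z)) (\<lambda>z. a (fst z) *\<^sub>R tent_grad N (snd z))"
    unfolding C1c_test_def
  proof (intro conjI ballI)
    fix z assume z: "z \<in> ?D"
    have 1: "((\<lambda>z. a (fst z)) has_derivative (\<lambda>q. fst q * a' (fst z))) (at z within ?D)"
      by (rule has_derivative_in_compose2[where t="{0..T}" and g'="\<lambda>s h. h * a' s", OF _ fstD z])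
        (use a_der in \<open>auto simp: has_field_derivative_def mult.commute[of _ "a' _"] intro!: derivative_intros\<close>)
    have 2: "((\<lambda>z. tent N (snd z)) has_derivative (\<lambda>q. tent_grad N (snd z) \<bullet> snd q)) (at z within ?D)"
      by (rule has_derivative_compose[OF has_derivative_snd[OF has_derivative_ident] has_derivative_tent[OF N]])
    have "((\<lambda>z. a (fst z) * tent N (snd z)) has_derivative
        (\<lambda>q. a (fst z) * (tent_grad N (snd z) \<bullet> snd q) + fst q * a' (fst z) * tent N (snd z))) (at z within ?D)"
      by (rule has_derivative_mult[OF 1 2])
    then show "((\<lambda>z. a (fst z) * tent N (snd z)) has_derivative
        (\<lambda>(h, k). h * (a' (fst z) * tent N (snd z)) + (a (fst z) *\<^sub>R tent_grad N (snd z)) \<bullet> k)) (at z within ?D)"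
      by (simp add: case_prod_unfold algebra_simps)
  next
    show "continuous_on ?D (\<lambda>z. a' (fst z) * tent N (snd z))" "continuous_on ?D (\<lambda>z. a (fst z) *\<^sub>R tent_grad N (snd z))"
      using a'_cont a_cont N
      by (intro continuous_intros c_fst c_snd continuous_tent continuous_tent_grad; simp)+
    show "\<exists>S. compact S \<and> (\<forall>z\<in>?D - S. a (fst z) * tent N (snd z) = 0)"
    proof (intro exI conjI ballI)
      show "compact ({0..T} \<times> cball (0 :: real^'d) N)" by (intro compact_Times) auto
      fix z assume "z \<in> ?D - {0..T} \<times> cball 0 N"
      then have "norm (snd z) \<ge> N" by (auto simp: mem_Times_iff)
      then show "a (fst z) * tent N (snd z) = 0" using tent_estimates(4)[OF N, of "snd z"] by simp
    qed
  qed
  have CE1: "(\<integral>z. a' (fst z) * tent N (snd z) + (a (fst z) *\<^sub>R tent_grad N (snd z)) \<bullet> (A *v snd z + B *v u z) \<partial>C)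
      = - a 0 * (\<integral>x. tent N x \<partial>\<mu> 0)"
    using continuity_equationD[OF CE test u] by (simp add: aT)
  obtain Ka' where Ka': "\<And>s. s \<in> {0..T} \<Longrightarrow> \<bar>a' s\<bar> \<le> Ka'"
    using continuous_on_compact_norm_bounded[OF compact_Icc a'_cont] by (metis real_norm_def)
  have int_a': "integrable C (\<lambda>z. a' (fst z))"
    using Ka' by (intro integrable_bounded_continuous[OF c_fst[OF a'_cont], of Ka']) auto
  have prob0: "measure (\<mu> s) (space (\<mu> s)) = 1" if "s \<in> {0..T}" for s
    using prob_space.prob_space[OF prob_space_curve[OF that]] .
  have const: "(\<integral>x. k \<partial>\<mu> s) = k" if "s \<in> {0..T}" for s and k :: real
    using prob0[OF that] by simp
  have "(\<integral>z. a' (fst z) \<partial>C) = (\<integral>s. (\<integral>x. a' s \<partial>\<mu> s) \<partial>time_measure T)"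
    using integral_curve_measure(1)[OF int_a'] by simp
  also have "\<dots> = (\<integral>s. a' s \<partial>time_measure T)"
    by (intro Bochner_Integration.integral_cong refl const) (simp add: space_time_measure)
  also have "\<dots> = (\<integral>s. indicator {0..T} s *\<^sub>R a' s \<partial>lborel)"
    by (rule integral_restrict_space) simp
  also have "\<dots> = a T - a 0"
    using a_der a'_cont T_pos
    by (intro integral_FTC_atLeastAtMost) (auto simp: has_real_derivative_iff_has_vector_derivative)
  finally have a'_int: "(\<integral>z. a' (fst z) \<partial>C) = - a 0" by (simp add: aT)
  have int_test: "integrable C (\<lambda>z. a' (fst z) * tent N (snd z) + (a (fst z) *\<^sub>R tent_grad N (snd z)) \<bullet> (A *v snd z + B *v u z))"
    by (rule integrable_test[OF test u])
  have int_bd: "integrable (\<mu> s) h" if "s \<in> {0..T}" "continuous_on UNIV h" "\<And>x. \<bar>h x\<bar> \<le> k" for s h and k :: real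
  proof (rule finite_measure.integrable_const_bound[of _ _ k])
    show "finite_measure (\<mu> s)" using prob_space_curve[OF that(1)] by (rule prob_space.finite_measure)
    show "h \<in> borel_measurable (\<mu> s)"
      using borel_measurable_continuous_onI[OF that(2)] sets_curve[OF that(1)] by (simp cong: measurable_cong_sets)
  qed (use that(3) in auto)
  have F0: "F 0 = N / 2 - (\<integral>x. tent N x \<partial>\<mu> 0)"
  proof -
    have "integrable (\<mu> 0) (tent N)"
      using tent_estimates(1,2)[where 'a="real^'d", OF N] T_pos by (intro int_bd[of _ _ "N / 2"] continuous_tent N) (auto simp: abs_of_nonneg)
    moreover have "integrable (\<mu> 0) (\<lambda>_. N / 2)" using T_pos by (intro int_bd[of _ _ "\<bar>N / 2\<bar>"]) auto
    ultimately show ?thesis unfolding F_def V_def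
      using T_pos const[of 0 "N / 2"] by (simp add: Bochner_Integration.integral_diff)
  qed
  have int_V: "integrable C (\<lambda>z. exp (- c * fst z) * \<omega> (fst z) * V (snd z))"
  proof -
    have cont: "continuous_on {0..T} (\<lambda>s. exp (- c * s) * \<omega> s)" using \<omega>_cont by (intro continuous_intros)
    obtain k where k: "\<And>s. s \<in> {0..T} \<Longrightarrow> \<bar>exp (- c * s) * \<omega> s\<bar> \<le> k"
      using continuous_on_compact_norm_bounded[OF compact_Icc cont] by (metis real_norm_def)
    show ?thesis
    proof (rule integrable_bounded_continuous)
      show "continuous_on ?D (\<lambda>z. exp (- c * fst z) * \<omega> (fst z) * V (snd z))"
        by (intro continuous_on_mult c_fst[OF cont] c_snd V_cont)
      fix z assume "z \<in> ?D"
      then show "\<bar>exp (- c * fst z) * \<omega> (fst z) * V (snd z)\<bar> \<le> k * (N / 2)"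
        using k[of "fst z"] V[of "snd z"] by (subst abs_mult, intro mult_mono) auto
    qed
  qed
  \<comment> \<open>The constant N/2 has no compact support and cannot be part of the test function.
    Its share is added by hand, using that a' integrates to - a 0.\<close>
  have "(\<integral>z. a' (fst z) * (N / 2) - (a' (fst z) * tent N (snd z) + (a (fst z) *\<^sub>R tent_grad N (snd z)) \<bullet> (A *v snd z + B *v u z)) \<partial>C) = (\<integral>z. a' (fst z) * (N / 2) \<partial>C) - (- a 0 * (\<integral>x. tent N x \<partial>\<mu> 0))"
    unfolding CE1[symmetric] using int_a' by (intro Bochner_Integration.integral_diff int_test) simp
  then have "- a 0 * F 0 = (\<integral>z. a' (fst z) * (N / 2) - (a' (fst z) * tent N (snd z) + (a (fst z) *\<^sub>R tent_grad N (snd z)) \<bullet> (A *v snd z + B *v u z)) \<partial>C)"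
    by (simp only: F0) (simp add: a'_int algebra_simps)
  also have "\<dots> \<le> (\<integral>z. a 0 * b * norm (u z) - exp (- c * fst z) * \<omega> (fst z) * V (snd z) \<partial>C)"
  proof (rule integral_mono)
    show "integrable C (\<lambda>z. a' (fst z) * (N / 2) - (a' (fst z) * tent N (snd z) + (a (fst z) *\<^sub>R tent_grad N (snd z)) \<bullet> (A *v snd z + B *v u z)))"
      using int_a' int_test by auto
    show "integrable C (\<lambda>z. a 0 * b * norm (u z) - exp (- c * fst z) * \<omega> (fst z) * V (snd z))"
      using int_V u by auto
    fix z assume "z \<in> space C"
    then have s: "fst z \<in> {0..T}" by auto
    let ?x = "snd z" and ?s = "fst z"
    have "- (tent_grad N ?x \<bullet> (A *v ?x)) \<le> norm (tent_grad N ?x) * norm (A *v ?x)"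
      using Cauchy_Schwarz_ineq2[of "tent_grad N ?x" "A *v ?x"] by linarith
    also have "\<dots> \<le> norm (tent_grad N ?x) * (c * norm ?x)" by (intro mult_left_mono A) simp
    also have "\<dots> = c * (norm ?x * norm (tent_grad N ?x))" by simp
    also have "\<dots> \<le> c * V ?x" unfolding V_def by (intro mult_left_mono A tent_estimates N)
    finally have 1: "- (tent_grad N ?x \<bullet> (A *v ?x)) \<le> c * V ?x" .
    have "- (tent_grad N ?x \<bullet> (B *v u z)) \<le> norm (tent_grad N ?x) * norm (B *v u z)"
      using Cauchy_Schwarz_ineq2[of "tent_grad N ?x" "B *v u z"] by linarith
    also have "\<dots> \<le> 1 * (b * norm (u z))" using B tent_estimates(5)[where 'a="real^'d", OF N] by (intro mult_mono) auto
    finally have 2: "- (tent_grad N ?x \<bullet> (B *v u z)) \<le> b * norm (u z)" by simp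
    \<comment> \<open>Inserting a' groups the drift with \<open>c * V\<close>, so that the first
      bracket is nonpositive.\<close>
    have "a' ?s * V ?x - a ?s * (tent_grad N ?x \<bullet> (A *v ?x + B *v u z))
      = a ?s * (- (tent_grad N ?x \<bullet> (A *v ?x)) - c * V ?x) + a ?s * (- (tent_grad N ?x \<bullet> (B *v u z)))
        - exp (- c * ?s) * \<omega> ?s * V ?x"
      by (simp add: a'_def inner_add_right algebra_simps)
    also have "\<dots> \<le> a ?s * 0 + a 0 * (b * norm (u z)) - exp (- c * ?s) * \<omega> ?s * V ?x"
    proof -
      have "a ?s * (- (tent_grad N ?x \<bullet> (A *v ?x)) - c * V ?x) \<le> a ?s * 0"
        using 1 a_bd[OF s] by (intro mult_left_mono) auto
      moreover have "a ?s * (- (tent_grad N ?x \<bullet> (B *v u z))) \<le> a ?s * (b * norm (u z))"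
        using 2 a_bd[OF s] by (intro mult_left_mono) auto
      moreover have "a ?s * (b * norm (u z)) \<le> a 0 * (b * norm (u z))"
        using B(1) a_bd[OF s] by (intro mult_right_mono) auto
      ultimately show ?thesis by linarith
    qed
    finally show "a' ?s * (N / 2) - (a' ?s * tent N ?x + (a ?s *\<^sub>R tent_grad N ?x) \<bullet> (A *v ?x + B *v u z))
        \<le> a 0 * b * norm (u z) - exp (- c * ?s) * \<omega> ?s * V ?x"
      by (simp add: V_def algebra_simps)
  qed
  also have "\<dots> = a 0 * b * (\<integral>z. norm (u z) \<partial>C) - (\<integral>z. exp (- c * fst z) * \<omega> (fst z) * V (snd z) \<partial>C)"
    using int_V u by (simp add: Bochner_Integration.integral_diff)
  finally have "(\<integral>z. exp (- c * fst z) * \<omega> (fst z) * V (snd z) \<partial>C) \<le> a 0 * (F 0 + b * (\<integral>z. norm (u z) \<partial>C))"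
    by (simp add: algebra_simps)
  also have "\<dots> \<le> a 0 * K"
    using K a_bd(1)[of 0] T_pos by (intro mult_left_mono) (auto simp: F_def V_def)
  also have "a 0 = integral {0..T} \<omega>" by (simp add: a_def \<eta>_def)
  also have "(\<integral>z. exp (- c * fst z) * \<omega> (fst z) * V (snd z) \<partial>C) = (\<integral>s. exp (- c * s) * \<omega> s * F s \<partial>time_measure T)"
    using integral_curve_measure(1)[OF int_V] by (simp add: F_def)
  also have "\<dots> = integral {0..T} (\<lambda>s. exp (- c * s) * \<omega> s * F s)"
    using \<omega>_cont F_cont by (intro time_measure_integral continuous_intros)
  finally have le: "integral {0..T} (\<lambda>s. exp (- c * s) * \<omega> s * F s) \<le> integral {0..T} \<omega> * K" .
  have "integral {0..T} (\<lambda>s. (\<omega> s)\<^sup>2) = integral {0..T} (\<lambda>s. exp (- c * s) * \<omega> s * F s - \<omega> s * K)"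
    by (intro integral_cong) (auto simp: \<omega>_def max_def power2_eq_square algebra_simps)
  also have "\<dots> = integral {0..T} (\<lambda>s. exp (- c * s) * \<omega> s * F s) - integral {0..T} \<omega> * K"
    using \<omega>_cont F_cont
    by (subst Henstock_Kurzweil_Integration.integral_diff)
      (auto intro!: integrable_continuous_interval continuous_intros)
  finally have "integral {0..T} (\<lambda>s. (\<omega> s)\<^sup>2) \<le> 0" using le by simp
  moreover have "integral {0..T} (\<lambda>s. (\<omega> s)\<^sup>2) \<ge> 0"
    using \<omega>_cont by (intro integral_nonneg integrable_continuous_interval continuous_intros) auto
  ultimately have "integral {0..T} (\<lambda>s. (\<omega> s)\<^sup>2) = 0" by simp
  then have "\<omega> t = 0"
    using integral_eq_0_iff[OF continuous_on_power[OF \<omega>_cont] T_pos] t by simp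
  then have "exp (- c * t) * F t \<le> K" by (simp add: \<omega>_def max_def split: if_splits)
  then have "exp (c * t) * (exp (- c * t) * F t) \<le> exp (c * t) * K" by (intro mult_left_mono) auto
  then show ?thesis by (simp add: F_def V_def mult.assoc[symmetric] exp_add[symmetric])
qed

text \<open>For \<open>N = k\<close> the bound of \<open>tent_moment_bound\<close> can be chosen
  free of k, since the truncated initial moment is at most the integral of g = sqrt(1 + x \<bullet>
  x). Monotone convergence, applied to g/2 cut off where g exceeds k, then gives a finite
  moment.\<close>

lemma first_moment_finite:
  fixes A :: "real^'d^'d" and B :: "real^'n^'d"
  assumes CE: "continuity_equation T (\<lambda>x v. A *v x + B *v v) u \<mu>" and u: "integrable C u"
    and init: "integrable (\<mu> 0) norm" and t: "t \<in> {0..T}"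
  shows "integrable (\<mu> t) norm"
proof -
  let ?g = "\<lambda>x :: real^'d. sqrt (1 + x \<bullet> x)"
  have meas: "h \<in> borel_measurable (\<mu> s)" if "s \<in> {0..T}" "continuous_on UNIV h" for s and h :: "real^'d \<Rightarrow> real"
    using borel_measurable_continuous_onI[OF that(2)] sets_curve[OF that(1)] by (simp cong: measurable_cong_sets)
  have g_cont: "continuous_on UNIV ?g" by (intro continuous_intros)
  have g_le: "?g x \<le> 1 + norm x" for x
    by (rule real_le_lsqrt) (auto simp: power2_eq_square algebra_simps dot_square_norm)
  interpret \<mu>0: prob_space "\<mu> 0" using T_pos by (intro prob_space_curve) simp
  interpret \<mu>t: prob_space "\<mu> t" by (rule prob_space_curve[OF t])
  have g0: "integrable (\<mu> 0) ?g"
  proof (rule Bochner_Integration.integrable_bound)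
    show "integrable (\<mu> 0) (\<lambda>x. 1 + norm x)" using init by simp
    show "?g \<in> borel_measurable (\<mu> 0)" using T_pos by (intro meas g_cont) simp
    show "AE x in \<mu> 0. norm (?g x) \<le> norm (1 + norm x)" using g_le by (auto simp: abs_of_nonneg)
  qed
  obtain c where c: "c > 0" "\<And>x. norm (A *v x) \<le> c * norm x"
    using linear_bounded_pos[OF matrix_vector_mul_linear] by metis
  obtain b where b: "b > 0" "\<And>v. norm (B *v v) \<le> b * norm v"
    using linear_bounded_pos[OF matrix_vector_mul_linear] by metis
  define K where "K = exp (c * t) * ((\<integral>x. ?g x \<partial>\<mu> 0) + b * (\<integral>z. norm (u z) \<partial>C))"
  have bound: "(\<integral>\<^sup>+x. ennreal (if ?g x \<le> real k then ?g x / 2 else 0) \<partial>\<mu> t) \<le> ennreal K" for k :: nat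
  \<comment> \<open>The truncation requires N > 0. For k = 0 the integrand vanishes because sqrt(1 +
    x \<bullet> x) is at least 1.\<close>
  proof (cases "k = 0")
    case True
    have "(if ?g x \<le> real k then ?g x / 2 else 0) = 0" for x
    proof -
      have "\<not> ?g x \<le> real k"
        using one_le_sqrt_one_plus_inner[of x] True by (metis not_one_le_zero of_nat_0 order_trans)
      then show ?thesis by (rule if_not_P)
    qed
    then show ?thesis by (simp only: ennreal_0 nn_integral_const mult_zero_left zero_le)
  next
    case False
    then have k: "real k > 0" by simp
    let ?V = "\<lambda>x :: real^'d. real k / 2 - tent (real k) x"
    have V: "0 \<le> ?V x" "?V x \<le> real k / 2" for x
      using tent_estimates(1,2)[OF k, of x] by auto
    have V_cont: "continuous_on UNIV ?V" by (intro continuous_intros continuous_tent k)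
    have V0: "integrable (\<mu> 0) ?V"
      using V T_pos by (intro \<mu>0.integrable_const_bound[of _ "real k / 2"] meas V_cont) auto
    have Vt: "integrable (\<mu> t) ?V"
      using V t by (intro \<mu>t.integrable_const_bound[of _ "real k / 2"] meas V_cont) auto
    have "(\<integral>x. ?V x \<partial>\<mu> 0) \<le> (\<integral>x. ?g x \<partial>\<mu> 0)"
      using V0 g0 tent_estimates(3)[where 'a="real^'d", OF k] by (intro integral_mono) auto
    then have "(\<integral>x. ?V x \<partial>\<mu> t) \<le> K"
      unfolding K_def using c b by (intro tent_moment_bound[OF CE u k _ _ _ _ _ t, where c=c and b=b]) auto
    then have "(\<integral>\<^sup>+x. ennreal (?V x) \<partial>\<mu> t) \<le> ennreal K"
      using Vt V by (subst nn_integral_eq_integral) (auto intro: ennreal_leI)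
    moreover have "(\<integral>\<^sup>+x. ennreal (if ?g x \<le> real k then ?g x / 2 else 0) \<partial>\<mu> t) \<le> (\<integral>\<^sup>+x. ennreal (?V x) \<partial>\<mu> t)"
      using tent_estimates(7)[where 'a="real^'d", OF k] V(1) by (intro nn_integral_mono ennreal_leI) auto
    ultimately show ?thesis by (rule order_trans[rotated])
  qed
  have "(\<lambda>k. \<integral>\<^sup>+x. ennreal (if ?g x \<le> real k then ?g x / 2 else 0) \<partial>\<mu> t) \<longlonglongrightarrow> (\<integral>\<^sup>+x. ennreal (?g x / 2) \<partial>\<mu> t)"
  proof (rule nn_integral_LIMSEQ)
    show "incseq (\<lambda>k x. ennreal (if ?g x \<le> real k then ?g x / 2 else 0))"
      by (auto simp: incseq_def le_fun_def intro!: ennreal_leI)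
    have [measurable]: "?g \<in> borel_measurable (\<mu> t)" by (rule meas[OF t g_cont])
    show "(\<lambda>x. ennreal (if ?g x \<le> real k then ?g x / 2 else 0)) \<in> borel_measurable (\<mu> t)" for k by measurable
    fix x :: "real^'d"
    obtain k0 where k0: "?g x \<le> real k0" using real_arch_simple by blast
    show "(\<lambda>k. ennreal (if ?g x \<le> real k then ?g x / 2 else 0)) \<longlonglongrightarrow> ennreal (?g x / 2)"
      by (rule tendsto_eventually, rule eventually_mono[OF eventually_ge_at_top[of k0]]) (use k0 in auto)
  qed
  then have "(\<integral>\<^sup>+x. ennreal (?g x / 2) \<partial>\<mu> t) \<le> ennreal K"
    by (rule LIMSEQ_le_const2) (use bound in auto)
  then have "(\<integral>\<^sup>+x. ennreal (?g x / 2) \<partial>\<mu> t) < \<infinity>"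
    by (rule le_less_trans) simp
  then have "integrable (\<mu> t) (\<lambda>x. ?g x / 2)"
    by (intro integrableI_nonneg meas t continuous_intros) auto
  then have "integrable (\<mu> t) (\<lambda>x. 2 * (?g x / 2))" by (intro integrable_mult_right)
  then have g_int: "integrable (\<mu> t) ?g" by simp
  show ?thesis
    by (rule Bochner_Integration.integrable_bound[OF g_int])
      (use norm_le_sqrt_one_plus_inner in \<open>auto intro!: meas t continuous_intros\<close>)
qed

end

section \<open>Regularisation by a random loop\<close>

text \<open>The law of the noise. Its compact support keeps the random loop and its control bounded
  on [0,T], and its density is what the noisy curve inherits. The unit cube has volume 1, so no
  normalisation appears.\<close>

definition cube_measure :: "'a::euclidean_space measure" where
  "cube_measure = restrict_space lborel (cbox 0 One)"

lemma space_cube_measure: "space cube_measure = cbox 0 One"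
  by (simp add: cube_measure_def space_restrict_space)

lemma prob_space_cube_measure: "prob_space (cube_measure :: 'a::euclidean_space measure)"
proof
  have "emeasure lborel (cbox 0 One :: 'a set) = 1"
    by (subst emeasure_lborel_cbox) auto
  then show "emeasure cube_measure (space (cube_measure :: 'a measure)) = 1"
    by (simp add: space_cube_measure) (simp add: cube_measure_def emeasure_restrict_space)
qed

lemma borel_measurable_cube_measure: "f \<in> borel_measurable borel \<Longrightarrow> f \<in> borel_measurable cube_measure"
  unfolding cube_measure_def by (intro measurable_restrict_space1) simp

lemma null_sets_cube_measure:
  assumes "E \<in> null_sets lborel"
  shows "emeasure cube_measure (E \<inter> cbox 0 One) = 0"
proof -
  have "E \<inter> cbox 0 One \<in> null_sets lborel" using assms by (intro null_set_Int2) auto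
  then show ?thesis
    unfolding cube_measure_def by (subst emeasure_restrict_space) auto
qed

text \<open>Narrow continuity covers a fixed integrand, whereas here the integrand moves with t. A
  cut-off X that carries almost all mass at t0 does so at nearby times as well, again by narrow
  continuity. Near its support h is uniformly continuous, and far away the change of h is at most
  \<open>2 * K * (1 - X x)\<close>.\<close>

lemma (in narrow_curve) continuous_on_integral_curve:
  fixes h :: "real \<times> (real^'d) \<Rightarrow> real"
  assumes h: "continuous_on UNIV h" and K: "\<And>z. \<bar>h z\<bar> \<le> K"
  shows "continuous_on {0..T} (\<lambda>t. \<integral>x. h (t, x) \<partial>\<mu> t)"
  unfolding continuous_on_def
proof (intro ballI tendstoI)
  fix t0 e :: real assume t0: "t0 \<in> {0..T}" and e: "e > 0"
  have K0: "K \<ge> 0" using K[of 0] by linarith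
  \<comment> \<open>The moving integrand costs \<open>\<delta> * (1 + 2 * K)\<close> and the moving
    measure less than \<delta>. The sum is below \<open>\<delta> * (4 * K + 3)\<close>, whose second
    factor is positive also for K = 0.\<close>
  define \<delta> where "\<delta> = e / (4 * K + 3)"
  have \<delta>: "\<delta> > 0" "\<delta> * (4 * K + 3) = e" using e K0 by (auto simp: \<delta>_def)
  have slice: "continuous_on UNIV (\<lambda>x. h (s, x))" for s
    by (intro continuous_on_compose2[OF h] continuous_intros) auto
  have meas: "g \<in> borel_measurable (\<mu> s)" if "s \<in> {0..T}" "continuous_on UNIV g" for s and g :: "real^'d \<Rightarrow> real"
    using borel_measurable_continuous_onI[OF that(2)] sets_curve[OF that(1)] by (simp cong: measurable_cong_sets)
  have int: "integrable (\<mu> s) g" if s: "s \<in> {0..T}" "continuous_on UNIV g" "\<And>x. \<bar>g x\<bar> \<le> k" for s k and g :: "real^'d \<Rightarrow> real"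
    using meas[OF s(1,2)] s(3) prob_space_curve[OF s(1)]
    by (intro finite_measure.integrable_const_bound[of _ _ k] prob_space.finite_measure) auto
  have narrow: "continuous_on {0..T} (\<lambda>s. \<integral>x. g x \<partial>\<mu> s)" if "continuous_on UNIV g" "\<And>x. \<bar>g x\<bar> \<le> k"
    for k and g :: "real^'d \<Rightarrow> real"
    using narrowly_continuous that unfolding narrowly_continuous_on_def by (auto simp: bounded_iff)
  define cut where "cut r x = max 0 (min 1 (r + 1 - norm x))" for r and x :: "real^'d"
  have cut_cont: "continuous_on UNIV (cut r)" for r unfolding cut_def by (intro continuous_intros)
  have cut: "0 \<le> cut r x" "cut r x \<le> 1" "\<bar>cut r x\<bar> \<le> 1" for r x by (auto simp: cut_def)
  interpret \<mu>0: prob_space "\<mu> t0" by (rule prob_space_curve[OF t0])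
  have "(\<lambda>k. \<integral>x. cut (real k) x \<partial>\<mu> t0) \<longlonglongrightarrow> (\<integral>x. 1 \<partial>\<mu> t0)"
  proof (rule integral_dominated_convergence[where w="\<lambda>_. 1"])
    show "AE x in \<mu> t0. (\<lambda>k. cut (real k) x) \<longlonglongrightarrow> 1"
    proof (rule AE_I2)
      fix x :: "real^'d"
      obtain k0 where k0: "norm x \<le> real k0" using real_arch_simple by blast
      show "(\<lambda>k. cut (real k) x) \<longlonglongrightarrow> 1"
        by (rule tendsto_eventually, rule eventually_mono[OF eventually_ge_at_top[of k0]])
          (use k0 in \<open>auto simp: cut_def\<close>)
    qed
  qed (use cut in \<open>auto intro!: meas t0 cut_cont\<close>)
  then have "(\<lambda>k. \<integral>x. cut (real k) x \<partial>\<mu> t0) \<longlonglongrightarrow> 1" by (simp add: \<mu>0.prob_space)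
  then have "\<forall>\<^sub>F k in sequentially. 1 - \<delta> < (\<integral>x. cut (real k) x \<partial>\<mu> t0)"
    using \<delta> by (intro order_tendstoD) auto
  then obtain k where k: "1 - \<delta> < (\<integral>x. cut (real k) x \<partial>\<mu> t0)"
    by (metis eventually_happens' sequentially_bot)
  define X where "X = cut (real k)"
  have X: "0 \<le> X x" "X x \<le> 1" "\<bar>X x\<bar> \<le> 1" "continuous_on UNIV X" "norm x > real k + 1 \<Longrightarrow> X x = 0" for x
    unfolding X_def using cut cut_cont by (auto simp: cut_def)
  have ev1: "\<forall>\<^sub>F s in at t0 within {0..T}. 1 - \<delta> < (\<integral>x. X x \<partial>\<mu> s)"
    using narrow[OF X(4,3)] t0 k unfolding continuous_on_def X_def[symmetric]
    by (auto intro: order_tendstoD)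
  have ev2: "\<forall>\<^sub>F s in at t0 within {0..T}. dist (\<integral>x. h (t0, x) \<partial>\<mu> s) (\<integral>x. h (t0, x) \<partial>\<mu> t0) < \<delta>"
    using narrow[OF slice[of t0] K] t0 \<delta>(1) unfolding continuous_on_def by (intro tendstoD) auto
  let ?P = "{0..T} \<times> cball (0 :: real^'d) (real k + 1)"
  have "uniformly_continuous_on ?P h"
    by (intro compact_uniformly_continuous continuous_on_subset[OF h] compact_Times) auto
  then obtain d where d: "d > 0" "\<And>z z'. z \<in> ?P \<Longrightarrow> z' \<in> ?P \<Longrightarrow> dist z' z < d \<Longrightarrow> dist (h z') (h z) < \<delta>"
    using \<delta>(1) unfolding uniformly_continuous_on_def by blast
  have ev3: "\<forall>\<^sub>F s in at t0 within {0..T}. dist s t0 < d \<and> s \<in> {0..T}"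
    using d(1) by (auto simp: eventually_at)
  show "\<forall>\<^sub>F s in at t0 within {0..T}. dist (\<integral>x. h (s, x) \<partial>\<mu> s) (\<integral>x. h (t0, x) \<partial>\<mu> t0) < e"
    using ev1 ev2 ev3
  proof eventually_elim
    case (elim s)
    then have s: "s \<in> {0..T}" by simp
    interpret \<mu>s: prob_space "\<mu> s" by (rule prob_space_curve[OF s])
    have pt: "\<bar>h (s, x) - h (t0, x)\<bar> \<le> \<delta> + 2 * K * (1 - X x)" for x
    proof (cases "norm x \<le> real k + 1")
      case True
      then have "dist (h (s, x)) (h (t0, x)) < \<delta>"
        using d(2)[of "(t0, x)" "(s, x)"] s t0 elim by (auto simp: dist_Pair_Pair)
      moreover have "0 \<le> 2 * K * (1 - X x)" using K0 X(2)[of x] by simp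
      ultimately show ?thesis by (simp add: dist_real_def)
    next
      case False
      then show ?thesis using K[of "(s, x)"] K[of "(t0, x)"] X(5)[of x] \<delta>(1) by simp
    qed
    have ints: "integrable (\<mu> s) (\<lambda>x. h (s, x))" "integrable (\<mu> s) (\<lambda>x. h (t0, x))" "integrable (\<mu> s) X"
      by (rule int[OF s slice K] int[OF s X(4,3)])+
    have "\<bar>(\<integral>x. h (s, x) \<partial>\<mu> s) - (\<integral>x. h (t0, x) \<partial>\<mu> s)\<bar> = \<bar>\<integral>x. h (s, x) - h (t0, x) \<partial>\<mu> s\<bar>"
      using ints by (simp add: Bochner_Integration.integral_diff)
    also have "\<dots> \<le> (\<integral>x. \<bar>h (s, x) - h (t0, x)\<bar> \<partial>\<mu> s)" by (rule integral_abs_bound)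
    also have "\<dots> \<le> (\<integral>x. \<delta> + 2 * K * (1 - X x) \<partial>\<mu> s)"
      using ints pt by (intro integral_mono) auto
    also have "\<dots> = \<delta> + 2 * K * (1 - (\<integral>x. X x \<partial>\<mu> s))"
      using ints(3) by (simp add: Bochner_Integration.integral_diff \<mu>s.prob_space)
    also have "\<dots> \<le> \<delta> + 2 * K * \<delta>"
      using elim(1) K0 by (intro add_left_mono mult_left_mono) auto
    finally have "\<bar>(\<integral>x. h (s, x) \<partial>\<mu> s) - (\<integral>x. h (t0, x) \<partial>\<mu> s)\<bar> \<le> \<delta> + 2 * K * \<delta>" .
    with elim(2) have "dist (\<integral>x. h (s, x) \<partial>\<mu> s) (\<integral>x. h (t0, x) \<partial>\<mu> t0) < \<delta> * (2 * K + 2)"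
      by (simp add: dist_real_def algebra_simps)
    also have "\<dots> \<le> \<delta> * (4 * K + 3)" using \<delta>(1) K0 by (intro mult_left_mono) auto
    finally show ?case using \<delta>(2) by simp
  qed
qed

text \<open>\<open>Z (t, \<theta>)\<close> is a random trajectory of the control system, driven by the control \<open>W (t, \<theta>)\<close>, that
  starts and ends at \<open>0\<close>; it is added to a given solution of the continuity equation.\<close>
locale noisy_curve = narrow_curve T \<mu>
  for T :: real and \<mu> :: "real \<Rightarrow> (real^'d) measure" +
  fixes A :: "real^'d^'d" and B :: "real^'n^'d"
    and Z :: "real \<times> (real^'d) \<Rightarrow> real^'d" and W :: "real \<times> (real^'d) \<Rightarrow> real^'n"
  assumes Z_cont: "continuous_on UNIV Z" and W_cont: "continuous_on UNIV W"
    and Z_der: "\<And>t \<theta>. ((\<lambda>t. Z (t, \<theta>)) has_vector_derivative A *v Z (t, \<theta>) + B *v W (t, \<theta>)) (at t)"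
    and Z_ends: "\<And>\<theta>. Z (0, \<theta>) = 0" "\<And>\<theta>. Z (T, \<theta>) = 0"
begin

abbreviation \<nu> :: "(real^'d) measure" where "\<nu> \<equiv> cube_measure"

definition noisy :: "real \<Rightarrow> (real^'d) measure" where
  "noisy t = distr (\<mu> t \<Otimes>\<^sub>M \<nu>) borel (\<lambda>p. fst p + Z (t, snd p))"

abbreviation "G \<equiv> C \<Otimes>\<^sub>M \<nu>"

definition \<Phi> :: "(real \<times> (real^'d)) \<times> (real^'d) \<Rightarrow> real \<times> (real^'d)" where
  "\<Phi> p = (fst (fst p), snd (fst p) + Z (fst (fst p), snd p))"

lemma shift_measurable:
  assumes "t \<in> {0..T}"
  shows "(\<lambda>p. fst p + Z (t, snd p)) \<in> borel_measurable (\<mu> t \<Otimes>\<^sub>M \<nu>)"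
proof -
  have [measurable]: "Z \<in> borel_measurable borel" by (rule borel_measurable_continuous_onI[OF Z_cont])
  have [measurable]: "fst \<in> borel_measurable (\<mu> t \<Otimes>\<^sub>M \<nu>)"
    using measurable_fst[of "\<mu> t" \<nu>] sets_curve[OF assms] by (simp cong: measurable_cong_sets)
  have [measurable]: "snd \<in> borel_measurable (\<mu> t \<Otimes>\<^sub>M \<nu>)"
    using measurable_compose[OF measurable_snd borel_measurable_cube_measure[OF measurable_ident]] by simp
  show ?thesis by measurable
qed

lemma measurable_G:
  "(\<lambda>p. fst (fst p)) \<in> borel_measurable G" "(\<lambda>p. snd (fst p)) \<in> borel_measurable G" "snd \<in> borel_measurable G"
proof -
  have C: "fst \<in> G \<rightarrow>\<^sub>M spacetime T" using measurable_fst[of C \<nu>] by (simp cong: measurable_cong_sets)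
  show "(\<lambda>p. fst (fst p)) \<in> borel_measurable G" "(\<lambda>p. snd (fst p)) \<in> borel_measurable G"
    by (rule measurable_compose[OF C measurable_fst_spacetime] measurable_compose[OF C measurable_snd_spacetime])+
  show "snd \<in> borel_measurable G"
    using measurable_compose[OF measurable_snd borel_measurable_cube_measure[OF measurable_ident]] by simp
qed

lemma \<Phi>_measurable: "\<Phi> \<in> G \<rightarrow>\<^sub>M spacetime T"
proof -
  note [measurable] = measurable_G
  have [measurable]: "Z \<in> borel_measurable borel" by (rule borel_measurable_continuous_onI[OF Z_cont])
  show ?thesis unfolding \<Phi>_def
    by (rule measurable_spacetimeI) (auto simp: space_pair_measure)
qed

text \<open>Testing the noisy curve with g means testing \<mu> with the average h of g over the
  noise. As h depends on time as well as space, \<open>continuous_on_integral_curve\<close> takes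
  the place of bare narrow continuity.\<close>

lemma noisy_narrow_curve: "narrow_curve T noisy"
proof
  show "T > 0" by (rule T_pos)
  interpret \<nu>: prob_space \<nu> by (rule prob_space_cube_measure)
  show "noisy t \<in> prob_measures" if "t \<in> {0..T}" for t
  proof -
    interpret \<mu>t: prob_space "\<mu> t" by (rule prob_space_curve[OF that])
    interpret P: pair_prob_space "\<mu> t" \<nu> ..
    show ?thesis unfolding prob_measures_def noisy_def
      using P.prob_space_distr[OF shift_measurable[OF that]] by simp
  qed
  show "narrowly_continuous_on {0..T} noisy"
    unfolding narrowly_continuous_on_def
  proof (intro allI impI)
    fix g :: "real^'d \<Rightarrow> real" assume g: "continuous_on UNIV g" and "bounded (range g)"
    then obtain K where K: "\<And>x. \<bar>g x\<bar> \<le> K" by (auto simp: bounded_iff)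
    have [measurable]: "Z \<in> borel_measurable borel" "g \<in> borel_measurable borel"
      by (rule borel_measurable_continuous_onI[OF Z_cont] borel_measurable_continuous_onI[OF g])+
    have [measurable]: "(\<lambda>\<theta>. \<theta>) \<in> borel_measurable \<nu>"
      by (rule borel_measurable_cube_measure) simp
    define h where "h z = (\<integral>\<theta>. g (snd z + Z (fst z, \<theta>)) \<partial>\<nu>)" for z
    have int_g: "integrable \<nu> (\<lambda>\<theta>. g (x + Z (t, \<theta>)))" for t x
      by (rule \<nu>.integrable_const_bound[of _ K]) (use K in auto)
    have h_bd: "\<bar>h z\<bar> \<le> K" for z
    proof -
      have "\<bar>h z\<bar> \<le> (\<integral>\<theta>. \<bar>g (snd z + Z (fst z, \<theta>))\<bar> \<partial>\<nu>)"
        unfolding h_def by (rule integral_abs_bound)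
      also have "\<dots> \<le> (\<integral>\<theta>. K \<partial>\<nu>)" using int_g K by (intro integral_mono) auto
      finally show ?thesis by (simp add: \<nu>.prob_space)
    qed
    have h_cont: "continuous_on UNIV h"
      unfolding continuous_on_sequentially
    proof (intro allI ballI impI, elim conjE)
      fix z :: "nat \<Rightarrow> real \<times> (real^'d)" and z0 assume lim: "z \<longlonglongrightarrow> z0"
      have F_cont: "continuous_on UNIV (\<lambda>z. g (snd z + Z (fst z, \<theta>)))" for \<theta>
        by (intro continuous_on_compose2[OF g] continuous_intros continuous_on_compose2[OF Z_cont]) auto
      have "(\<lambda>k. h (z k)) \<longlonglongrightarrow> h z0" unfolding h_def
      proof (rule integral_dominated_convergence[where w="\<lambda>_. K"])
        show "AE \<theta> in \<nu>. (\<lambda>k. g (snd (z k) + Z (fst (z k), \<theta>))) \<longlonglongrightarrow> g (snd z0 + Z (fst z0, \<theta>))"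
          using continuous_on_tendsto_compose[OF F_cont lim] by auto
      qed (use K in auto)
      then show "(h \<circ> z) \<longlonglongrightarrow> h z0" by (simp add: comp_def)
    qed
    have "(\<integral>x. g x \<partial>noisy t) = (\<integral>x. h (t, x) \<partial>\<mu> t)" if t: "t \<in> {0..T}" for t
    proof -
      interpret \<mu>t: prob_space "\<mu> t" by (rule prob_space_curve[OF t])
      interpret P: pair_prob_space "\<mu> t" \<nu> ..
      note [measurable] = shift_measurable[OF t]
      have "(\<integral>x. g x \<partial>noisy t) = (\<integral>p. g (fst p + Z (t, snd p)) \<partial>(\<mu> t \<Otimes>\<^sub>M \<nu>))"
        unfolding noisy_def by (rule integral_distr) measurable
      also have "\<dots> = (\<integral>x. (\<integral>\<theta>. g (x + Z (t, \<theta>)) \<partial>\<nu>) \<partial>\<mu> t)"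
        using P.integral_fst'[of "\<lambda>p. g (fst p + Z (t, snd p))"] K
        by (subst P.integral_fst'[symmetric]) (auto intro!: P.P.integrable_const_bound[of _ K])
      finally show ?thesis by (simp add: h_def)
    qed
    then show "continuous_on {0..T} (\<lambda>t. \<integral>x. g x \<partial>noisy t)"
      by (intro continuous_on_eq[OF continuous_on_integral_curve[OF h_cont h_bd]]) simp
  qed
qed

sublocale N: narrow_curve T noisy
  by (rule noisy_narrow_curve)

lemma noisy_ends: "noisy 0 = \<mu> 0" "noisy T = \<mu> T"
proof -
  interpret \<nu>: prob_space \<nu> by (rule prob_space_cube_measure)
  have "distr (\<mu> t \<Otimes>\<^sub>M \<nu>) borel fst = \<mu> t" if t: "t \<in> {0..T}" for t
  proof -
    have "distr (\<mu> t \<Otimes>\<^sub>M \<nu>) borel fst = distr (\<mu> t \<Otimes>\<^sub>M \<nu>) (\<mu> t) fst"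
      by (rule distr_cong) (simp_all add: sets_curve[OF t])
    then show ?thesis using \<nu>.distr_pair_fst by simp
  qed
  then show "noisy 0 = \<mu> 0" "noisy T = \<mu> T" using T_pos by (simp_all add: noisy_def Z_ends)
qed

lemma nn_integral_noisy:
  assumes t: "t \<in> {0..T}" and f: "f \<in> borel_measurable borel"
  shows "(\<integral>\<^sup>+x. f x \<partial>noisy t) = (\<integral>\<^sup>+x. (\<integral>\<^sup>+\<theta>. f (x + Z (t, \<theta>)) \<partial>\<nu>) \<partial>\<mu> t)"
proof -
  interpret \<nu>: prob_space \<nu> by (rule prob_space_cube_measure)
  note [measurable] = shift_measurable[OF t] f
  have "(\<integral>\<^sup>+x. f x \<partial>noisy t) = (\<integral>\<^sup>+p. f (fst p + Z (t, snd p)) \<partial>(\<mu> t \<Otimes>\<^sub>M \<nu>))"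
    unfolding noisy_def by (rule nn_integral_distr) measurable
  also have "\<dots> = (\<integral>\<^sup>+x. (\<integral>\<^sup>+\<theta>. f (fst (x, \<theta>) + Z (t, snd (x, \<theta>))) \<partial>\<nu>) \<partial>\<mu> t)"
    by (rule \<nu>.nn_integral_fst[symmetric]) measurable
  finally show ?thesis by simp
qed

text \<open>This brings the noisy curve into the scope of \<open>image_density\<close>: a density on
  the image is a function of time and of the displaced position, as a control has to be.\<close>

lemma noisy_curve_measure: "curve_measure T noisy = distr G (spacetime T) \<Phi>"
proof (rule measure_eqI)
  interpret \<nu>: prob_space \<nu> by (rule prob_space_cube_measure)
  note [measurable] = \<Phi>_measurable
  show "sets (curve_measure T noisy) = sets (distr G (spacetime T) \<Phi>)" by simp
  fix E assume "E \<in> sets (curve_measure T noisy)"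
  then have E[measurable]: "E \<in> sets (spacetime T)" by simp
  have "emeasure (curve_measure T noisy) E = (\<integral>\<^sup>+z. indicator E z \<partial>curve_measure T noisy)"
    by simp
  also have "\<dots> = (\<integral>\<^sup>+t. (\<integral>\<^sup>+x. indicator E (t, x) \<partial>noisy t) \<partial>time_measure T)"
    by (rule N.nn_integral_curve_measure) simp
  also have "\<dots> = (\<integral>\<^sup>+t. (\<integral>\<^sup>+x. (\<integral>\<^sup>+\<theta>. indicator E (\<Phi> ((t, x), \<theta>)) \<partial>\<nu>) \<partial>\<mu> t) \<partial>time_measure T)"
  proof (rule nn_integral_cong)
    fix t assume "t \<in> space (time_measure T)"
    then have t: "t \<in> {0..T}" by (simp add: space_time_measure)
    have "(\<lambda>x. indicator E (t, x)) \<in> borel_measurable (noisy t)"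
      by (rule N.measurable_slice[OF t]) simp
    then have "(\<lambda>x. indicator E (t, x) :: ennreal) \<in> borel_measurable borel"
      using N.sets_curve[OF t] by (simp cong: measurable_cong_sets)
    from nn_integral_noisy[OF t this]
    show "(\<integral>\<^sup>+x. indicator E (t, x) \<partial>noisy t) = (\<integral>\<^sup>+x. (\<integral>\<^sup>+\<theta>. indicator E (\<Phi> ((t, x), \<theta>)) \<partial>\<nu>) \<partial>\<mu> t)"
      by (simp add: \<Phi>_def)
  qed
  also have "\<dots> = (\<integral>\<^sup>+z. (\<integral>\<^sup>+\<theta>. indicator E (\<Phi> (z, \<theta>)) \<partial>\<nu>) \<partial>C)"
  proof (rule nn_integral_curve_measure[symmetric])
    have "(\<lambda>z. \<integral>\<^sup>+\<theta>. indicator E (\<Phi> (z, \<theta>)) \<partial>\<nu>) \<in> borel_measurable C"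
      by (rule \<nu>.borel_measurable_nn_integral_fst) measurable
    then show "(\<lambda>z. \<integral>\<^sup>+\<theta>. indicator E (\<Phi> (z, \<theta>)) \<partial>\<nu>) \<in> borel_measurable (spacetime T)"
      by (simp cong: measurable_cong_sets)
  qed
  also have "\<dots> = (\<integral>\<^sup>+p. indicator E (\<Phi> p) \<partial>G)"
    by (rule \<nu>.nn_integral_fst) measurable
  also have "\<dots> = (\<integral>\<^sup>+z. indicator E z \<partial>distr G (spacetime T) \<Phi>)"
    by (rule nn_integral_distr[symmetric]) auto
  also have "\<dots> = emeasure (distr G (spacetime T) \<Phi>) E" by simp
  finally show "emeasure (curve_measure T noisy) E = emeasure (distr G (spacetime T) \<Phi>) E" .
qed

text \<open>The density comes from the noise: given X = x, the displaced position already avoids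
  null sets, and averaging over x preserves this. A null set of space-time has null slices at almost
  every time only, so the exceptional times in the assumption cost nothing.\<close>

lemma noisy_absolutely_continuous:
  assumes ac: "AE t in lborel. \<forall>x. \<forall>E \<in> null_sets lborel. emeasure \<nu> {\<theta> \<in> space \<nu>. x + Z (t, \<theta>) \<in> E} = 0"
  shows "absolutely_continuous (spacetime T) (curve_measure T noisy)"
  unfolding absolutely_continuous_def
proof
  fix E assume E: "E \<in> null_sets (spacetime T :: (real \<times> (real^'d)) measure)"
  then have [measurable]: "E \<in> sets (spacetime T)" by auto
  have [measurable]: "Z \<in> borel_measurable borel" by (rule borel_measurable_continuous_onI[OF Z_cont])
  have [measurable]: "(\<lambda>\<theta>. \<theta>) \<in> borel_measurable \<nu>"
    by (rule borel_measurable_cube_measure) simp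
  have slice: "{x. (t, x) \<in> E} \<in> sets borel" if t: "t \<in> {0..T}" for t
  proof -
    have "(\<lambda>x. indicator E (t, x) :: ennreal) \<in> borel_measurable (\<mu> t)"
      by (rule measurable_slice[OF t]) simp
    then have "(\<lambda>x. indicator {x. (t, x) \<in> E} x :: ennreal) \<in> borel_measurable borel"
      using sets_curve[OF t] by (simp cong: measurable_cong_sets add: indicator_def)
    then show ?thesis by (simp add: borel_measurable_indicator_iff)
  qed
  have "(\<integral>\<^sup>+t\<in>{0..T}. (\<integral>\<^sup>+x. indicator E (t, x) \<partial>lborel) \<partial>lborel) = (\<integral>\<^sup>+z. indicator E z \<partial>spacetime T)"
    by (rule nn_integral_spacetime[symmetric]) simp
  also have "\<dots> = 0" using E by (auto simp: null_sets_def)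
  finally have "(\<integral>\<^sup>+t. (\<integral>\<^sup>+x. indicator E (t, x) \<partial>lborel) \<partial>time_measure T) = 0"
    by (simp add: nn_integral_restrict_space)
  moreover have "(\<lambda>t. \<integral>\<^sup>+x. indicator E (t, x) \<partial>lborel) \<in> borel_measurable (time_measure T)"
  proof (rule lborel.borel_measurable_nn_integral)
    have "(\<lambda>z. indicator E z :: ennreal) \<in> borel_measurable (time_measure T \<Otimes>\<^sub>M borel)"
      by (rule measurable_compose[OF measurable_id_spacetime]) simp
    then show "(\<lambda>(t, x). indicator E (t, x) :: ennreal) \<in> borel_measurable (time_measure T \<Otimes>\<^sub>M lborel)"
      by (simp cong: measurable_cong_sets sets_pair_measure_cong add: case_prod_unfold)
  qed
  ultimately have ae: "AE t in time_measure T. (\<integral>\<^sup>+x. indicator E (t, x) \<partial>lborel) = 0"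
    by (subst (asm) nn_integral_0_iff_AE) auto
  have ac': "AE t in time_measure T. \<forall>x. \<forall>E \<in> null_sets lborel. emeasure \<nu> {\<theta> \<in> space \<nu>. x + Z (t, \<theta>) \<in> E} = 0"
    using ac by (simp add: AE_restrict_space_iff) (auto elim: eventually_mono)
  have "emeasure (curve_measure T noisy) E = (\<integral>\<^sup>+z. indicator E z \<partial>curve_measure T noisy)"
    by simp
  also have "\<dots> = (\<integral>\<^sup>+t. (\<integral>\<^sup>+x. indicator E (t, x) \<partial>noisy t) \<partial>time_measure T)"
    by (rule N.nn_integral_curve_measure) simp
  also have "\<dots> = (\<integral>\<^sup>+t. 0 \<partial>time_measure T)"
  proof (rule nn_integral_cong_AE)
    show "AE t in time_measure T. (\<integral>\<^sup>+x. indicator E (t, x) \<partial>noisy t) = 0"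
      using ae ac' AE_space
    proof eventually_elim
      case (elim t)
      then have t: "t \<in> {0..T}" by (simp add: space_time_measure)
      define Et where "Et = {x. (t, x) \<in> E}"
      have [measurable]: "Et \<in> sets borel" unfolding Et_def by (rule slice[OF t])
      have ind: "indicator E (t, x) = (indicator Et x :: ennreal)" for x by (simp add: Et_def indicator_def)
      have "Et \<in> null_sets lborel" using elim(1) unfolding ind by (auto simp: null_sets_def)
      then have "emeasure \<nu> {\<theta> \<in> space \<nu>. x + Z (t, \<theta>) \<in> Et} = 0" for x using elim(2) by blast
      moreover have "(\<integral>\<^sup>+\<theta>. indicator Et (x + Z (t, \<theta>)) \<partial>\<nu>) = emeasure \<nu> {\<theta> \<in> space \<nu>. x + Z (t, \<theta>) \<in> Et}" for x
      proof -
        have "(\<integral>\<^sup>+\<theta>. indicator Et (x + Z (t, \<theta>)) \<partial>\<nu>) = (\<integral>\<^sup>+\<theta>. indicator {\<theta> \<in> space \<nu>. x + Z (t, \<theta>) \<in> Et} \<theta> \<partial>\<nu>)"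
          by (intro nn_integral_cong) (auto simp: indicator_def)
        also have "\<dots> = emeasure \<nu> {\<theta> \<in> space \<nu>. x + Z (t, \<theta>) \<in> Et}"
          by (rule nn_integral_indicator) measurable
        finally show ?thesis .
      qed
      ultimately show ?case unfolding ind by (subst nn_integral_noisy[OF t]) auto
    qed
  qed
  finally show "E \<in> null_sets (curve_measure T noisy)" by (auto simp: null_sets_def)
qed

text \<open>For frozen noise the displaced curve is driven by \<open>w\<close>. The equation is
  linear in the control and pairs it with a function of \<open>\<Phi> p\<close>, so after averaging
  over the noise \<open>w\<close> may be replaced by its conditional expectation given
  \<Phi>.\<close>

lemma noisy_solution:
  fixes R :: "real^'n^'n"
  assumes u: "integrable C u" and CE: "continuity_equation T (\<lambda>x v. A *v x + B *v v) u \<mu>"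
    and psd: "\<And>v. v \<bullet> (R *v v) \<ge> 0"
  shows "\<exists>u'. integrable (curve_measure T noisy) u' \<and>
    continuity_equation T (\<lambda>x v. A *v x + B *v v) u' noisy \<and>
    (\<integral>\<^sup>+z. ennreal (u' z \<bullet> (R *v u' z)) \<partial>curve_measure T noisy)
      \<le> (\<integral>\<^sup>+p. ennreal ((u (fst p) + W (fst (fst p), snd p)) \<bullet> (R *v (u (fst p) + W (fst (fst p), snd p)))) \<partial>G)"
proof -
  interpret \<nu>: prob_space \<nu> by (rule prob_space_cube_measure)
  interpret C: finite_measure C by (rule finite_curve_measure)
  interpret P: pair_sigma_finite C \<nu> ..
  let ?D = "{0..T} \<times> (UNIV :: (real^'d) set)"
  let ?C' = "curve_measure T noisy"
  have fin_G: "finite_measure G" by (rule finite_measure_pair_measure) unfold_locales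
  interpret Gf: finite_measure G by (rule fin_G)
  note [measurable] = measurable_G \<Phi>_measurable
  have [measurable]: "W \<in> borel_measurable borel" by (rule borel_measurable_continuous_onI[OF W_cont])
  define w where "w p = u (fst p) + W (fst (fst p), snd p)" for p
  have "compact ({0..T} \<times> cbox 0 (One :: real^'d))" by (intro compact_Times) auto
  then obtain KW where "\<And>z. z \<in> {0..T} \<times> cbox 0 One \<Longrightarrow> norm (W z) \<le> KW"
    using continuous_on_compact_norm_bounded[OF _ continuous_on_subset[OF W_cont]] by blast
  then have KW: "norm (W (t, \<theta>)) \<le> KW" if "t \<in> {0..T}" "\<theta> \<in> cbox 0 One" for t \<theta>
    using that by blast
  have "integrable G (\<lambda>p. W (fst (fst p), snd p))"
    by (rule Gf.integrable_const_bound[of _ KW])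
      (auto intro!: AE_I2 KW simp: space_pair_measure space_cube_measure)
  moreover have "integrable G (\<lambda>p. u (fst p))"
  proof -
    have "integrable (distr G C fst) u" using u by (simp add: \<nu>.distr_pair_fst)
    then show ?thesis using u by (subst (asm) integrable_distr_eq) auto
  qed
  ultimately have w: "integrable G w" unfolding w_def by simp
  obtain u' where u': "integrable ?C' u'" and
    u'_eq: "\<And>h :: real \<times> (real^'d) \<Rightarrow> real^'n. h \<in> borel_measurable (spacetime T) \<Longrightarrow> bounded (range h) \<Longrightarrow>
      integrable G (\<lambda>p. h (\<Phi> p) \<bullet> w p) \<and> integrable ?C' (\<lambda>y. h y \<bullet> u' y) \<and>
      (\<integral>y. h y \<bullet> u' y \<partial>?C') = (\<integral>p. h (\<Phi> p) \<bullet> w p \<partial>G)"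
    using image_density[OF fin_G \<Phi>_measurable w] unfolding noisy_curve_measure by blast
  have "continuity_equation T (\<lambda>x v. A *v x + B *v v) u' noisy"
  proof (rule N.continuity_equationI[OF u'])
    fix \<phi> \<phi>t \<phi>x assume test: "C1c_test T \<phi> \<phi>t (\<phi>x :: real \<times> (real^'d) \<Rightarrow> real^'d)"
    obtain K where K: "K \<ge> 0" "\<And>z. z \<in> ?D \<Longrightarrow> norm (\<phi>x z) \<le> K"
      using C1c_test_bounded[OF T_pos test] by metis
    have cont: "continuous_on ?D \<phi>t" "continuous_on ?D \<phi>x"
      using test unfolding C1c_test_def by blast+
    have \<Phi>D: "\<Phi> p \<in> ?D" if "p \<in> space G" for p
      using measurable_space[OF \<Phi>_measurable that] by simp
    obtain b where b: "b > 0" "\<And>x. norm (transpose B *v x) \<le> b * norm x"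
      using linear_bounded_pos[OF matrix_vector_mul_linear] by metis
    \<comment> \<open>The extension by 0 outside the strip makes h bounded on the whole type, as
      \<open>u'_eq\<close> requires.\<close>
    define h where "h z = (if z \<in> ?D then transpose B *v \<phi>x z else 0)" for z
    have h_meas: "h \<in> borel_measurable (spacetime T)"
    proof -
      have "(\<lambda>z. transpose B *v \<phi>x z) \<in> borel_measurable (spacetime T)"
        using cont(2) by (intro continuous_on_measurable_spacetime bounded_linear.continuous_on[OF matrix_vector_mul_bounded_linear])
      then show ?thesis by (subst measurable_cong[where g="\<lambda>z. transpose B *v \<phi>x z"]) (auto simp: h_def)
    qed
    have "norm (h z) \<le> b * K" for z
    proof (cases "z \<in> ?D")
      case True
      then have "norm (h z) \<le> b * norm (\<phi>x z)" using b by (simp add: h_def)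
      also have "\<dots> \<le> b * K" using b K(2)[OF True] by (intro mult_left_mono) auto
      finally show ?thesis .
    qed (use b K in \<open>auto simp: h_def\<close>)
    then have h_bd: "bounded (range h)" by (auto simp: bounded_iff)
    have h_inner: "h z \<bullet> v = \<phi>x z \<bullet> (B *v v)" if "z \<in> ?D" for z v
      using that by (simp add: h_def transpose_matrix_vector dot_lmul_matrix)
    \<comment> \<open>The terms free of the control; their integrability is
      \<open>integrable_test\<close> for the zero control.\<close>
    define q where "q z = \<phi>t z + \<phi>x z \<bullet> (A *v snd z)" for z
    have int_q: "integrable ?C' q"
      using N.integrable_test[OF test, of "\<lambda>_. 0 :: real^'n" A B] by (simp add: q_def[abs_def])
    then have q_meas: "q \<in> borel_measurable (spacetime T)"
      using borel_measurable_integrable[OF int_q] by (simp cong: measurable_cong_sets)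
    have int_qG: "integrable G (\<lambda>p. q (\<Phi> p))"
      using int_q q_meas by (subst (asm) noisy_curve_measure, subst (asm) integrable_distr_eq) auto
    note hw = u'_eq[OF h_meas h_bd]
    define r where "r p = \<phi>t (\<Phi> p) + \<phi>x (\<Phi> p) \<bullet> (A *v snd (\<Phi> p) + B *v w p)" for p
    have r: "r p = q (\<Phi> p) + h (\<Phi> p) \<bullet> w p" if "p \<in> space G" for p
      using h_inner[OF \<Phi>D[OF that]] by (simp add: r_def q_def inner_add_right)
    have int_r: "integrable G r"
      using Bochner_Integration.integrable_add[OF int_qG conjunct1[OF hw]]
      by (subst Bochner_Integration.integrable_cong[OF refl r])
    have "(\<integral>z. \<phi>t z + \<phi>x z \<bullet> (A *v snd z + B *v u' z) \<partial>?C') = (\<integral>z. q z + h z \<bullet> u' z \<partial>?C')"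
      using h_inner by (intro Bochner_Integration.integral_cong) (auto simp: q_def inner_add_right)
    also have "\<dots> = (\<integral>z. q z \<partial>?C') + (\<integral>z. h z \<bullet> u' z \<partial>?C')"
      using int_q hw by (intro Bochner_Integration.integral_add) auto
    also have "(\<integral>z. q z \<partial>?C') = (\<integral>p. q (\<Phi> p) \<partial>G)"
      unfolding noisy_curve_measure using q_meas by (intro integral_distr) auto
    also have "(\<integral>p. q (\<Phi> p) \<partial>G) + (\<integral>z. h z \<bullet> u' z \<partial>?C') = (\<integral>p. q (\<Phi> p) + h (\<Phi> p) \<bullet> w p \<partial>G)"
      using int_qG hw by (simp add: Bochner_Integration.integral_add)
    also have "\<dots> = (\<integral>p. r p \<partial>G)"
      using r by (intro Bochner_Integration.integral_cong) auto
    \<comment> \<open>The noise is integrated last, so that it is frozen in the inner integral.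
      There the derivative of the loop turns A x + B u into A (x + Z) + B (u + W), the expression in
      \<open>r\<close>.\<close>
    also have "\<dots> = (\<integral>\<theta>. (\<integral>z. r (z, \<theta>) \<partial>C) \<partial>\<nu>)"
      using P.integral_snd[of "\<lambda>z \<theta>. r (z, \<theta>)"] int_r by (simp add: case_prod_unfold)
    also have "\<dots> = (\<integral>\<theta>. (\<integral>x. \<phi> (T, x) \<partial>\<mu> T) - (\<integral>x. \<phi> (0, x) \<partial>\<mu> 0) \<partial>\<nu>)"
    proof (intro Bochner_Integration.integral_cong refl)
      fix \<theta>
      have "continuous_on UNIV (\<lambda>t. Z (t, \<theta>))" "continuous_on UNIV (\<lambda>t. W (t, \<theta>))"
        by (intro continuous_on_compose2[OF Z_cont] continuous_on_compose2[OF W_cont] continuous_intros; simp)+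
      then have "continuous_on UNIV (\<lambda>t. A *v Z (t, \<theta>) + B *v W (t, \<theta>))"
        by (intro continuous_on_add bounded_linear.continuous_on[OF matrix_vector_mul_bounded_linear])
      from continuity_equationD[OF CE C1c_test_shift[OF T_pos test Z_der this] u]
      show "(\<integral>z. r (z, \<theta>) \<partial>C) = (\<integral>x. \<phi> (T, x) \<partial>\<mu> T) - (\<integral>x. \<phi> (0, x) \<partial>\<mu> 0)"
        by (simp add: r_def \<Phi>_def w_def Z_ends case_prod_unfold inner_add_right matrix_vector_right_distrib algebra_simps)
    qed
    also have "\<dots> = (\<integral>x. \<phi> (T, x) \<partial>noisy T) - (\<integral>x. \<phi> (0, x) \<partial>noisy 0)"
      by (simp add: \<nu>.prob_space noisy_ends)
    finally show "(\<integral>z. \<phi>t z + \<phi>x z \<bullet> (A *v snd z + B *v u' z) \<partial>?C') = (\<integral>x. \<phi> (T, x) \<partial>noisy T) - (\<integral>x. \<phi> (0, x) \<partial>noisy 0)" .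
  qed
  moreover have "(\<integral>\<^sup>+z. ennreal (u' z \<bullet> (R *v u' z)) \<partial>?C') \<le> (\<integral>\<^sup>+p. ennreal (w p \<bullet> (R *v w p)) \<partial>G)"
    using u' u'_eq psd unfolding noisy_curve_measure
    by (intro image_density_quadratic[OF fin_G \<Phi>_measurable w]) auto
  ultimately show ?thesis using u' unfolding w_def by blast
qed

lemma noisy_first_moment:
  assumes t: "t \<in> {0..T}" and mom: "integrable (\<mu> t) norm"
  shows "integrable (noisy t) norm"
proof -
  interpret \<nu>: prob_space \<nu> by (rule prob_space_cube_measure)
  interpret \<mu>t: prob_space "\<mu> t" by (rule prob_space_curve[OF t])
  interpret P: pair_prob_space "\<mu> t" \<nu> ..
  have "compact ({0..T} \<times> cbox 0 (One :: real^'d))" by (intro compact_Times) auto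
  then obtain KZ where "\<And>z. z \<in> {0..T} \<times> cbox 0 One \<Longrightarrow> norm (Z z) \<le> KZ"
    using continuous_on_compact_norm_bounded[OF _ continuous_on_subset[OF Z_cont]] by blast
  then have KZ: "norm (Z (t, \<theta>)) \<le> KZ" if "t \<in> {0..T}" "\<theta> \<in> cbox 0 One" for t \<theta>
    using that by blast
  have *: "(\<lambda>p. fst p + Z (t, snd p)) \<in> \<mu> t \<Otimes>\<^sub>M \<nu> \<rightarrow>\<^sub>M borel" by (rule shift_measurable[OF t])
  have "integrable (distr (\<mu> t \<Otimes>\<^sub>M \<nu>) (\<mu> t) fst) norm" using mom by (simp add: \<nu>.distr_pair_fst)
  then have i: "integrable (\<mu> t \<Otimes>\<^sub>M \<nu>) (\<lambda>p. norm (fst p))"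
    using mom by (subst (asm) integrable_distr_eq) auto
  have "integrable (\<mu> t \<Otimes>\<^sub>M \<nu>) (\<lambda>p. norm (fst p + Z (t, snd p)))"
  proof (rule Bochner_Integration.integrable_bound)
    show "integrable (\<mu> t \<Otimes>\<^sub>M \<nu>) (\<lambda>p. norm (fst p) + KZ)" using i by simp
    show "AE p in \<mu> t \<Otimes>\<^sub>M \<nu>. norm (norm (fst p + Z (t, snd p))) \<le> norm (norm (fst p) + KZ)"
    proof (rule AE_I2)
      fix p assume "p \<in> space (\<mu> t \<Otimes>\<^sub>M \<nu>)"
      then have "norm (Z (t, snd p)) \<le> KZ" using KZ[OF t] by (auto simp: space_pair_measure space_cube_measure)
      then show "norm (norm (fst p + Z (t, snd p))) \<le> norm (norm (fst p) + KZ)"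
        using norm_triangle_ineq[of "fst p" "Z (t, snd p)"] by simp
    qed
  qed (use * in measurable)
  then show ?thesis unfolding noisy_def using * by (subst integrable_distr_eq) auto
qed

end

section \<open>Equality of the two costs\<close>

text \<open>Nonnegativity at a - b bounds the sum of the mixed terms by the two squares; no symmetry
  of M is involved. The factor 1 + \<delta> and the weight \<delta> on b make the effect of the
  noise vanish as \<delta> tends to 0.\<close>

lemma quadratic_form_perturb:
  fixes M :: "real^'n^'n"
  assumes psd: "\<And>v. v \<bullet> (M *v v) \<ge> 0" and "\<delta> \<ge> 0"
  shows "(a + \<delta> *\<^sub>R b) \<bullet> (M *v (a + \<delta> *\<^sub>R b)) \<le> (1 + \<delta>) * (a \<bullet> (M *v a) + \<delta> * (b \<bullet> (M *v b)))"
proof -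
  have "0 \<le> (a - b) \<bullet> (M *v (a - b))" by (rule psd)
  then have "a \<bullet> (M *v b) + b \<bullet> (M *v a) \<le> a \<bullet> (M *v a) + b \<bullet> (M *v b)"
    by (simp add: matrix_vector_mult_diff_distrib inner_diff_left inner_diff_right)
  from mult_left_mono[OF this \<open>\<delta> \<ge> 0\<close>] show ?thesis
    by (simp add: matrix_vector_right_distrib matrix_vector_mult_scaleR inner_add_left inner_add_right algebra_simps)
qed

lemma continuous_on_quadratic_form:
  fixes M :: "real^'n^'n"
  shows "continuous_on S (\<lambda>v. v \<bullet> (M *v v))"
  by (intro continuous_intros bounded_linear.continuous_on[OF matrix_vector_mul_bounded_linear])

text \<open>The constant is the minimum of the form on the compact unit sphere, and homogeneity
  extends the bound. It serves to make controls of finite cost integrable.\<close>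

lemma positive_definite_coercive:
  fixes R :: "real^'n^'n"
  assumes pd: "\<And>v. v \<noteq> 0 \<Longrightarrow> v \<bullet> (R *v v) > 0"
  obtains c where "c > 0" "\<And>v. c * (norm v)\<^sup>2 \<le> v \<bullet> (R *v v)"
proof -
  have "\<exists>v\<in>sphere 0 1. \<forall>w\<in>sphere 0 1. v \<bullet> (R *v v) \<le> w \<bullet> (R *v w)"
    by (rule continuous_attains_inf[OF compact_sphere _ continuous_on_quadratic_form]) (auto simp: sphere_eq_empty)
  then obtain v where v: "norm v = 1" "\<And>w. norm w = 1 \<Longrightarrow> v \<bullet> (R *v v) \<le> w \<bullet> (R *v w)" by auto
  show ?thesis
  proof (rule that)
    show "v \<bullet> (R *v v) > 0" using pd[of v] v(1) by force
    fix w
    show "v \<bullet> (R *v v) * (norm w)\<^sup>2 \<le> w \<bullet> (R *v w)"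
    proof (cases "w = 0")
      case False
      then have "v \<bullet> (R *v v) \<le> (inverse (norm w) *\<^sub>R w) \<bullet> (R *v (inverse (norm w) *\<^sub>R w))"
        by (intro v) simp
      also have "\<dots> = (w \<bullet> (R *v w)) / (norm w)\<^sup>2"
        by (simp add: matrix_vector_mult_scaleR power2_eq_square field_simps)
      finally show ?thesis using False by (simp add: field_simps)
    qed simp
  qed
qed

text \<open>The partial sums of the indicators of disjoint sets stay in [0,1], so
  \<open>norm (u z)\<close> dominates and the integrals converge.\<close>

lemma vector_measure_set_integral:
  fixes u :: "'a \<Rightarrow> 'b::{banach, second_countable_topology}"
  assumes u: "integrable M u"
  shows "vector_measure M (\<lambda>E. \<integral>z\<in>E. u z \<partial>M)"
  unfolding vector_measure_def
proof (intro allI impI)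
  fix E :: "nat \<Rightarrow> 'a set" assume "range E \<subseteq> sets M" and disj: "disjoint_family E"
  then have E [measurable]: "E i \<in> sets M" for i by auto
  note [measurable] = borel_measurable_integrable[OF u]
  have sums: "(\<lambda>i. indicator (E i) z :: real) sums indicator (\<Union>i. E i) z" for z
    by (rule indicator_sums) (use disj in \<open>auto simp: disjoint_family_on_def\<close>)
  have part: "0 \<le> (\<Sum>i<n. indicator (E i) z :: real)" "(\<Sum>i<n. indicator (E i) z :: real) \<le> 1" for n z
  proof -
    show "0 \<le> (\<Sum>i<n. indicator (E i) z :: real)" by (intro sum_nonneg) auto
    have "(\<Sum>i<n. indicator (E i) z :: real) \<le> (\<Sum>i. indicator (E i) z)"
      using sums[of z] by (intro sum_le_suminf) (auto simp: sums_iff)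
    also have "\<dots> = indicator (\<Union>i. E i) z" using sums[of z] by (simp add: sums_iff)
    also have "\<dots> \<le> 1" by (simp add: indicator_def)
    finally show "(\<Sum>i<n. indicator (E i) z :: real) \<le> 1" .
  qed
  have int: "integrable M (\<lambda>z. indicator (E i) z *\<^sub>R u z)" for i
    by (rule integrable_mult_indicator[OF E u])
  have "(\<lambda>n. \<integral>z. (\<Sum>i<n. indicator (E i) z) *\<^sub>R u z \<partial>M) \<longlonglongrightarrow> (\<integral>z. indicator (\<Union>i. E i) z *\<^sub>R u z \<partial>M)"
  proof (rule integral_dominated_convergence[where w="\<lambda>z. norm (u z)"])
    show "AE z in M. (\<lambda>n. (\<Sum>i<n. indicator (E i) z) *\<^sub>R u z) \<longlonglongrightarrow> indicator (\<Union>i. E i) z *\<^sub>R u z"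
      using sums by (auto intro!: AE_I2 tendsto_scaleR simp: sums_def)
    show "AE z in M. norm ((\<Sum>i<n. indicator (E i) z) *\<^sub>R u z) \<le> norm (u z)" for n
      using part[of _ n] by (auto intro!: AE_I2 mult_left_le_one_le)
    show "integrable M (\<lambda>z. norm (u z))" using u by simp
  qed measurable
  moreover have "(\<integral>z. (\<Sum>i<n. indicator (E i) z) *\<^sub>R u z \<partial>M) = (\<Sum>i<n. \<integral>z\<in>E i. u z \<partial>M)" for n
    unfolding set_lebesgue_integral_def scaleR_sum_left
    by (rule Bochner_Integration.integral_sum) (rule int)
  ultimately show "(\<lambda>i. \<integral>z\<in>E i. u z \<partial>M) sums (\<integral>z\<in>(\<Union>i. E i). u z \<partial>M)"
    by (simp add: sums_def set_lebesgue_integral_def)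
qed

text \<open>Injective differentiable maps pull negligible sets back to negligible sets.
  Negligibility refers to the completed measure, so the Borel measurability of the preimage is shown
  separately.\<close>

lemma null_sets_vimage_affine:
  fixes M :: "real^'d^'d"
  assumes M: "det M \<noteq> 0" "\<delta> \<noteq> 0" and E: "E \<in> null_sets lborel"
  shows "{\<theta>. x + \<delta> *\<^sub>R (M *v \<theta>) \<in> E} \<in> null_sets lborel"
proof -
  have "inj (\<lambda>\<theta>. M *v \<theta>)"
    using M(1) by (simp add: invertible_det_nz[symmetric] invertible_left_inverse matrix_left_invertible_injective)
  then have inj: "inj (\<lambda>\<theta>. \<delta> *\<^sub>R (M *v \<theta>))" using M(2) by (simp add: inj_def)
  have "((\<lambda>\<theta>. x + \<delta> *\<^sub>R (M *v \<theta>)) has_derivative (\<lambda>\<theta>. \<delta> *\<^sub>R (M *v \<theta>))) (at \<theta>)" for \<theta>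
    by (auto intro!: derivative_eq_intros bounded_linear_imp_has_derivative)
  moreover have "negligible E" using E by (simp add: negligible_iff_null_sets null_sets_completionI)
  ultimately have "negligible {\<theta> \<in> UNIV. x + \<delta> *\<^sub>R (M *v \<theta>) \<in> E}"
    using inj by (intro negligible_differentiable_vimage[where f'="\<lambda>_ \<theta>. \<delta> *\<^sub>R (M *v \<theta>)"]) auto
  moreover have "(\<lambda>\<theta>. x + \<delta> *\<^sub>R (M *v \<theta>)) \<in> borel_measurable borel"
    by (intro borel_measurable_continuous_onI continuous_intros bounded_linear.continuous_on[OF matrix_vector_mul_bounded_linear])
  then have "{\<theta>. x + \<delta> *\<^sub>R (M *v \<theta>) \<in> E} \<in> sets borel"
    using E measurable_sets[of "\<lambda>\<theta>. x + \<delta> *\<^sub>R (M *v \<theta>)" borel borel E] by (auto simp: vimage_def)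
  ultimately show ?thesis
    unfolding negligible_iff_null_sets by (simp add: null_sets_completion_iff)
qed

text \<open>Without absolute continuity of the curve measure the right-hand side is infinite by
  definition. Otherwise the density of m is the competitor.\<close>

lemma BB_cost_le_conv_functional:
  fixes f :: "real^'d \<Rightarrow> real^'n \<Rightarrow> real^'d" and s :: "real^'d \<Rightarrow> real" and \<psi> :: "real^'n \<Rightarrow> real"
  assumes "T > 0" and adm: "(m, \<mu>) \<in> conv_admissible T f \<mu>0 \<mu>T"
    and s: "s \<in> borel_measurable borel" "\<And>x. s x \<ge> 0" and \<psi>: "\<psi> \<in> borel_measurable borel" "\<And>v. \<psi> v \<ge> 0"
  shows "BB_cost T f UNIV (\<lambda>t x v. s x + \<psi> v) \<mu>0 \<mu>T \<le> conv_functional T s \<psi> m \<mu>"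
proof (cases "absolutely_continuous (spacetime T) (curve_measure T \<mu>)")
  case True
  interpret narrow_curve T \<mu>
    using adm \<open>T > 0\<close> by unfold_locales (auto simp: conv_admissible_def prob_measures_moment_def)
  obtain u where u: "is_vector_density C m u" and CE: "continuity_equation T f u \<mu>"
    using adm by (auto simp: conv_admissible_def)
  have u_meas: "u \<in> borel_measurable (spacetime T)"
    using u borel_measurable_integrable[of C u] by (simp add: is_vector_density_def cong: measurable_cong_sets)
  have "(u, \<mu>) \<in> BB_admissible T f UNIV \<mu>0 \<mu>T"
    using adm u_meas CE measurable_cong_sets[OF sets_spacetime refl]
    by (auto simp: BB_admissible_def conv_admissible_def prob_measures_moment_def measurable_restrict_space2_iff)
  then have "BB_cost T f UNIV (\<lambda>t x v. s x + \<psi> v) \<mu>0 \<mu>T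
      \<le> (\<integral>\<^sup>+t\<in>{0..T}. (\<integral>\<^sup>+x. ennreal (s x + \<psi> (u (t, x))) \<partial>\<mu> t) \<partial>lborel)"
    unfolding BB_cost_def by (rule INF_lower2) simp
  also have "\<dots> = (\<integral>\<^sup>+z. ennreal (s (snd z) + \<psi> (u z)) \<partial>C)"
    using measurable_compose[OF measurable_snd_spacetime s(1)] measurable_compose[OF u_meas \<psi>(1)]
    by (subst nn_integral_curve_measure') auto
  also have "\<dots> = conv_functional T s \<psi> m \<mu>"
    by (subst conv_functional_eq[OF True u s(1) \<psi>(1)]) (simp add: s \<psi>)
  finally show ?thesis .
qed (simp add: conv_functional_def)

lemma conv_cost_le_BB_integral:
  fixes A :: "real^'d^'d" and B :: "real^'n^'d" and Q :: "real^'d^'d" and R :: "real^'n^'n"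
  defines "f \<equiv> \<lambda>x v. A *v x + B *v v"
  defines "s \<equiv> \<lambda>x. x \<bullet> (Q *v x)" and "\<psi> \<equiv> \<lambda>v. v \<bullet> (R *v v)"
  assumes "T > 0" and rank: "rank (kalman_matrix A B) = CARD('d)"
    and adm: "(u, \<mu>) \<in> BB_admissible T f UNIV \<mu>0 \<mu>T" and init: "integrable \<mu>0 norm"
    and psd: "\<And>x. x \<bullet> (Q *v x) \<ge> 0" and pd: "\<And>v. v \<noteq> 0 \<Longrightarrow> v \<bullet> (R *v v) > 0"
  shows "conv_BB_cost T f s \<psi> \<mu>0 \<mu>T
    \<le> (\<integral>\<^sup>+t\<in>{0..T}. (\<integral>\<^sup>+x. ennreal (s x + \<psi> (u (t, x))) \<partial>\<mu> t) \<partial>lborel)" (is "_ \<le> ?J")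
proof (cases "?J = \<infinity>")
  case False
  interpret narrow_curve T \<mu>
    using adm \<open>T > 0\<close> by unfold_locales (auto simp: BB_admissible_def)
  have psd': "v \<bullet> (R *v v) \<ge> 0" for v using pd[of v] by (cases "v = 0") auto
  have nonneg: "s x \<ge> 0" "\<psi> v \<ge> 0" for x v using psd psd' by (auto simp: s_def \<psi>_def)
  have cont: "continuous_on S s" "continuous_on S' \<psi>" for S S'
    unfolding s_def \<psi>_def by (rule continuous_on_quadratic_form)+
  have [measurable]: "s \<in> borel_measurable borel" "\<psi> \<in> borel_measurable borel"
    by (rule borel_measurable_continuous_onI[OF cont(1)] borel_measurable_continuous_onI[OF cont(2)])+
  note [measurable] = measurable_snd_spacetime
  have CE: "continuity_equation T (\<lambda>x v. A *v x + B *v v) u \<mu>"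
    and ends: "\<mu> 0 = \<mu>0" "\<mu> T = \<mu>T"
    using adm by (auto simp: BB_admissible_def f_def)
  have u_meas [measurable]: "u \<in> borel_measurable (spacetime T)"
    using adm measurable_cong_sets[OF sets_spacetime refl] by (auto simp: BB_admissible_def measurable_restrict_space2_iff)
  define L where "L z = s (snd z) + \<psi> (u z)" for z
  have L_meas [measurable]: "L \<in> borel_measurable (spacetime T)" unfolding L_def by measurable
  have L_nonneg: "L z \<ge> 0" for z using nonneg by (simp add: L_def)
  have J: "?J = (\<integral>\<^sup>+z. ennreal (L z) \<partial>C)"
    by (subst nn_integral_curve_measure') (auto simp: L_def)
  obtain j where j: "j \<ge> 0" "(\<integral>\<^sup>+z. ennreal (L z) \<partial>C) = ennreal j"
    using False unfolding J by (cases "\<integral>\<^sup>+z. ennreal (L z) \<partial>C") auto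
  interpret C: finite_measure C by (rule finite_curve_measure)
  \<comment> \<open>\<open>BB_admissible\<close> asks the control only to be measurable. Finite cost
    and coercivity supply integrability through |u| \<le> 1 + |u|^2 \<le> 1 + L/c.\<close>
  have u: "integrable C u"
  proof -
    obtain c where c: "c > 0" "\<And>v. c * (norm v)\<^sup>2 \<le> v \<bullet> (R *v v)"
      using positive_definite_coercive[OF pd] by blast
    have "integrable C L"
      using False unfolding J by (intro integrableI_nonneg) (auto simp: less_top L_nonneg cong: measurable_cong_sets)
    then have "integrable C (\<lambda>z. 1 + L z / c)" by simp
    then show ?thesis
    proof (rule Bochner_Integration.integrable_bound)
      show "u \<in> borel_measurable C" by (simp cong: measurable_cong_sets)
      have "norm (u z) \<le> norm (1 + L z / c)" for z
      proof -
        have "c * (norm (u z))\<^sup>2 \<le> L z"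
          using c(2)[of "u z"] nonneg(1)[of "snd z"] by (simp add: L_def \<psi>_def)
        then have "(norm (u z))\<^sup>2 \<le> L z / c" using c(1) by (simp add: field_simps)
        moreover have "norm (u z) \<le> 1 + (norm (u z))\<^sup>2"
          using zero_le_power2[of "norm (u z) - 1"] by (simp add: power2_eq_square algebra_simps) (smt (verit) mult_nonneg_nonneg norm_ge_zero)
        ultimately show ?thesis by simp
      qed
      then show "AE z in C. norm (u z) \<le> norm (1 + L z / c)" by simp
    qed
  qed
  obtain S V where S_cont: "continuous_on UNIV S" and V_cont: "continuous_on UNIV V"
    and der: "\<And>t \<theta>. ((\<lambda>t. S t *v \<theta>) has_vector_derivative A *v (S t *v \<theta>) + B *v (V t *v \<theta>)) (at t)"
    and S_ends: "S 0 = 0" "S T = 0" and S_fin: "finite {t. det (S t) = 0}"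
    using loop_family[OF rank \<open>T > 0\<close>] by blast
  have Z0_cont: "continuous_on UNIV (\<lambda>z. S (fst z) *v snd z)"
    unfolding matrix_vector_mult_def
    by (intro continuous_intros continuous_on_compose2[OF S_cont]) auto
  have W0_cont: "continuous_on UNIV (\<lambda>z. V (fst z) *v snd z)"
    unfolding matrix_vector_mult_def
    by (intro continuous_intros continuous_on_compose2[OF V_cont]) auto
  \<comment> \<open>K bounds the running cost of the unscaled loop and its control, uniformly over
    the cube. Scaling by \<delta> is left to \<open>quadratic_form_perturb\<close>.\<close>
  have "continuous_on ({0..T} \<times> cbox 0 One) (\<lambda>z. s (S (fst z) *v snd z) + \<psi> (V (fst z) *v snd z))"
    by (intro continuous_on_add continuous_on_compose2[OF cont(1)[of UNIV]] continuous_on_compose2[OF cont(2)[of UNIV]]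
        continuous_on_subset[OF Z0_cont] continuous_on_subset[OF W0_cont]) auto
  then obtain K where "\<And>z. z \<in> {0..T} \<times> cbox 0 One \<Longrightarrow> norm (s (S (fst z) *v snd z) + \<psi> (V (fst z) *v snd z)) \<le> K"
    using continuous_on_compact_norm_bounded[OF compact_Times[OF compact_Icc compact_cbox]] by blast
  then have K: "s (S t *v \<theta>) + \<psi> (V t *v \<theta>) \<le> K" if "t \<in> {0..T}" "\<theta> \<in> cbox 0 One" for t \<theta>
    using that by force
  define K' where "K' = K * measure C (space C)"
  have K_nonneg: "K \<ge> 0"
    using K[of 0 0] \<open>T > 0\<close> nonneg(1)[of "S 0 *v 0"] nonneg(2)[of "V 0 *v 0"] by (auto simp: cbox_def)
  have approx: "conv_BB_cost T f s \<psi> \<mu>0 \<mu>T \<le> ennreal ((1 + \<delta>) * (j + \<delta> * K'))" if \<delta>: "\<delta> > 0" for \<delta>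
  proof -
    define Z where "Z z = \<delta> *\<^sub>R (S (fst z) *v snd z)" for z
    define W where "W z = \<delta> *\<^sub>R (V (fst z) *v snd z)" for z
    interpret noisy_curve T \<mu> A B Z W
    proof unfold_locales
      show "continuous_on UNIV Z" "continuous_on UNIV W"
        unfolding Z_def W_def by (intro continuous_intros Z0_cont W0_cont)+
      show "((\<lambda>t. Z (t, \<theta>)) has_vector_derivative A *v Z (t, \<theta>) + B *v W (t, \<theta>)) (at t)" for t \<theta>
        using bounded_linear.has_vector_derivative[OF bounded_linear_scaleR_right der[of \<theta> t], of \<delta>]
        by (simp add: Z_def W_def scaleR_right_distrib matrix_vector_mult_scaleR)
    qed (simp_all add: Z_def S_ends)
    let ?C' = "curve_measure T noisy"
    interpret \<nu>: prob_space \<nu> by (rule prob_space_cube_measure)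
    obtain u' where u': "integrable ?C' u'" and CE': "continuity_equation T (\<lambda>x v. A *v x + B *v v) u' noisy"
      and cost: "(\<integral>\<^sup>+z. ennreal (u' z \<bullet> (R *v u' z)) \<partial>?C')
      \<le> (\<integral>\<^sup>+p. ennreal ((u (fst p) + W (fst (fst p), snd p)) \<bullet> (R *v (u (fst p) + W (fst (fst p), snd p)))) \<partial>G)"
      using noisy_solution[OF u CE psd'] by blast
    have ac: "absolutely_continuous (spacetime T) ?C'"
    proof (rule noisy_absolutely_continuous)
      have "{t. det (S t) = 0} \<in> null_sets lborel"
        using S_fin by (rule finite_imp_null_set_lborel)
      then have "AE t in lborel. det (S t) \<noteq> 0" by (rule AE_I') auto
      then show "AE t in lborel. \<forall>x. \<forall>E\<in>null_sets lborel. emeasure \<nu> {\<theta> \<in> space \<nu>. x + Z (t, \<theta>) \<in> E} = 0"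
      proof eventually_elim
        case (elim t)
        show ?case
        proof (intro allI ballI)
          fix x and E :: "(real^'d) set" assume E: "E \<in> null_sets lborel"
          have "{\<theta>. x + Z (t, \<theta>) \<in> E} \<in> null_sets lborel"
            using null_sets_vimage_affine[of "S t" \<delta> E x] E elim \<delta> by (simp add: Z_def)
          from null_sets_cube_measure[OF this]
          show "emeasure \<nu> {\<theta> \<in> space \<nu>. x + Z (t, \<theta>) \<in> E} = 0"
            by (simp add: space_cube_measure Int_def conj_commute)
        qed
      qed
    qed
    define m where "m E = (\<integral>z\<in>E. u' z \<partial>?C')" for E
    have dens: "is_vector_density ?C' m u'" using u' by (simp add: is_vector_density_def m_def)
    have "vector_measure (spacetime T) m"
      using vector_measure_set_integral[OF u'] by (simp add: vector_measure_def m_def)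
    moreover have "vector_abs_continuous ?C' m"
      unfolding vector_abs_continuous_def
    proof
      fix E assume E: "E \<in> null_sets ?C'"
      show "m E = 0"
        unfolding m_def set_lebesgue_integral_def using AE_not_in[OF E]
        by (intro integral_eq_zero_AE) (auto elim!: eventually_mono)
    qed
    moreover have "noisy t \<in> prob_measures_moment 1" if t: "t \<in> {0..T}" for t
    proof -
      have "integrable (\<mu> t) norm"
        using first_moment_finite[OF CE u _ t] init ends by simp
      then show ?thesis
        using noisy_first_moment[OF t] N.prob_measures[OF t] by (simp add: prob_measures_moment_def)
    qed
    ultimately have "(m, noisy) \<in> conv_admissible T f \<mu>0 \<mu>T"
      unfolding conv_admissible_def f_def
      using N.narrowly_continuous noisy_ends ends dens CE' by auto
    then have "conv_BB_cost T f s \<psi> \<mu>0 \<mu>T \<le> conv_functional T s \<psi> m noisy"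
      unfolding conv_BB_cost_def by (rule INF_lower2) simp
    also have "\<dots> = (\<integral>\<^sup>+z. ennreal (s (snd z)) + ennreal (\<psi> (u' z)) \<partial>?C')"
      by (rule N.conv_functional_eq[OF ac dens]) measurable
    also have "\<dots> = (\<integral>\<^sup>+z. ennreal (s (snd z)) \<partial>?C') + (\<integral>\<^sup>+z. ennreal (\<psi> (u' z)) \<partial>?C')"
    proof (rule nn_integral_add)
      show "(\<lambda>z. ennreal (s (snd z))) \<in> borel_measurable ?C'" by (simp cong: measurable_cong_sets)
      have "u' \<in> borel_measurable ?C'" using u' by simp
      then show "(\<lambda>z. ennreal (\<psi> (u' z))) \<in> borel_measurable ?C'" by measurable
    qed
    also have "\<dots> \<le> (\<integral>\<^sup>+p. ennreal (s (snd (\<Phi> p))) \<partial>G) + (\<integral>\<^sup>+p. ennreal (\<psi> (u (fst p) + W (fst (fst p), snd p))) \<partial>G)"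
    proof (rule add_mono)
      show "(\<integral>\<^sup>+z. ennreal (s (snd z)) \<partial>?C') \<le> (\<integral>\<^sup>+p. ennreal (s (snd (\<Phi> p))) \<partial>G)"
        unfolding noisy_curve_measure using \<Phi>_measurable by (subst nn_integral_distr) auto
      show "(\<integral>\<^sup>+z. ennreal (\<psi> (u' z)) \<partial>?C') \<le> (\<integral>\<^sup>+p. ennreal (\<psi> (u (fst p) + W (fst (fst p), snd p))) \<partial>G)"
        using cost by (simp add: \<psi>_def)
    qed
    also have "\<dots> = (\<integral>\<^sup>+p. ennreal (s (snd (\<Phi> p))) + ennreal (\<psi> (u (fst p) + W (fst (fst p), snd p))) \<partial>G)"
    proof (rule nn_integral_add[symmetric])
      note [measurable] = measurable_G
      have [measurable]: "W \<in> borel_measurable borel" by (rule borel_measurable_continuous_onI[OF W_cont])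
      have [measurable]: "u \<in> borel_measurable C" using u by simp
      show "(\<lambda>p. ennreal (s (snd (\<Phi> p)))) \<in> borel_measurable G"
        using measurable_compose[OF \<Phi>_measurable, of "\<lambda>z. ennreal (s (snd z))" borel] by simp
      show "(\<lambda>p. ennreal (\<psi> (u (fst p) + W (fst (fst p), snd p)))) \<in> borel_measurable G" by measurable
    qed
    \<comment> \<open>Both quadratic forms are expanded at the unperturbed state and control. The
      resulting bound does not involve the noise any more, so the integral over G reduces to one
      over C.\<close>
    also have "\<dots> \<le> (\<integral>\<^sup>+p. ennreal (1 + \<delta>) * (ennreal (L (fst p)) + ennreal (\<delta> * K)) \<partial>G)"
    proof (rule nn_integral_mono)
      fix p assume p: "p \<in> space G"
      obtain t x \<theta> where pe: "p = ((t, x), \<theta>)" by (metis prod.collapse)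
      have t: "t \<in> {0..T}" "\<theta> \<in> cbox 0 One"
        using p by (auto simp: pe space_pair_measure space_cube_measure)
      have "s (x + Z (t, \<theta>)) + \<psi> (u (t, x) + W (t, \<theta>))
        \<le> (1 + \<delta>) * (s x + \<delta> * s (S t *v \<theta>)) + (1 + \<delta>) * (\<psi> (u (t, x)) + \<delta> * \<psi> (V t *v \<theta>))"
        using quadratic_form_perturb[OF psd, of \<delta> x "S t *v \<theta>"] quadratic_form_perturb[OF psd', of \<delta> "u (t, x)" "V t *v \<theta>"] \<delta>
        by (simp add: s_def \<psi>_def Z_def W_def)
      also have "\<dots> = (1 + \<delta>) * (L (t, x) + \<delta> * (s (S t *v \<theta>) + \<psi> (V t *v \<theta>)))"
        by (simp add: L_def algebra_simps)
      also have "\<dots> \<le> (1 + \<delta>) * (L (t, x) + \<delta> * K)"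
        using K[OF t] \<delta> by (intro mult_left_mono add_left_mono) auto
      finally have "ennreal (s (x + Z (t, \<theta>)) + \<psi> (u (t, x) + W (t, \<theta>))) \<le> ennreal ((1 + \<delta>) * (L (t, x) + \<delta> * K))"
        by (rule ennreal_leI)
      then show "ennreal (s (snd (\<Phi> p))) + ennreal (\<psi> (u (fst p) + W (fst (fst p), snd p)))
        \<le> ennreal (1 + \<delta>) * (ennreal (L (fst p)) + ennreal (\<delta> * K))"
        using \<delta> K_nonneg by (simp add: pe \<Phi>_def nonneg L_nonneg ennreal_mult)
    qed
    also have "\<dots> = (\<integral>\<^sup>+z. ennreal (1 + \<delta>) * (ennreal (L z) + ennreal (\<delta> * K)) \<partial>C)"
    proof -
      have "(\<lambda>z. ennreal (1 + \<delta>) * (ennreal (L z) + ennreal (\<delta> * K))) \<in> borel_measurable C"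
        by (simp cong: measurable_cong_sets)
      then have "(\<integral>\<^sup>+z. ennreal (1 + \<delta>) * (ennreal (L z) + ennreal (\<delta> * K)) \<partial>distr G C fst)
        = (\<integral>\<^sup>+p. ennreal (1 + \<delta>) * (ennreal (L (fst p)) + ennreal (\<delta> * K)) \<partial>G)"
        by (subst nn_integral_distr) auto
      then show ?thesis by (simp add: \<nu>.distr_pair_fst)
    qed
    also have "\<dots> = ennreal (1 + \<delta>) * ((\<integral>\<^sup>+z. ennreal (L z) \<partial>C) + ennreal (\<delta> * K) * emeasure C (space C))"
    proof -
      have [measurable]: "L \<in> borel_measurable C" by (simp cong: measurable_cong_sets)
      show ?thesis by (subst nn_integral_cmult, simp, subst nn_integral_add) auto
    qed
    also have "\<dots> = ennreal ((1 + \<delta>) * (j + \<delta> * K'))"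
      using \<delta> K_nonneg j unfolding C.emeasure_eq_measure K'_def
      by (simp add: ennreal_mult[symmetric] ennreal_plus[symmetric] mult.assoc del: ennreal_plus)
    finally show ?thesis .
  qed
  \<comment> \<open>The bound is used along \<delta> = 1/(n+1); \<open>j\<close> and
    \<open>K'\<close> do not depend on \<delta>.\<close>
  have "(\<lambda>n. (1 + 1 / real (Suc n)) * (j + 1 / real (Suc n) * K')) \<longlonglongrightarrow> (1 + 0) * (j + 0 * K')"
    by (intro tendsto_intros LIMSEQ_Suc[OF lim_1_over_n])
  then have "(\<lambda>n. ennreal ((1 + 1 / real (Suc n)) * (j + 1 / real (Suc n) * K'))) \<longlonglongrightarrow> ennreal ((1 + 0) * (j + 0 * K'))"
    by (rule tendsto_ennrealI)
  then have "conv_BB_cost T f s \<psi> \<mu>0 \<mu>T \<le> ennreal ((1 + 0) * (j + 0 * K'))"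
    by (rule LIMSEQ_le_const) (intro exI allI impI approx, simp)
  then show ?thesis unfolding J using j by simp
qed simp

theorem corollary3p20:
  fixes T :: real
    and f0 :: "real^'d \<Rightarrow> real^'d" and fs :: "'n::finite \<Rightarrow> real^'d \<Rightarrow> real^'d"
    and Q :: "real^'d^'d" and R :: "real^'n^'n"
    and \<mu>0 \<mu>T :: "(real^'d) measure"
  assumes "T > 0"
    and "\<mu>0 \<in> prob_measures_moment 2" and "\<mu>T \<in> prob_measures_moment 2"
    and "controllable_LTI f0 fs"
    and "\<And>x. x \<bullet> (Q *v x) \<ge> 0"
    and "\<And>u. u \<noteq> 0 \<Longrightarrow> u \<bullet> (R *v u) > 0"
  shows "BB_cost T (control_affine f0 fs) UNIV (\<lambda>t x u. x \<bullet> (Q *v x) + u \<bullet> (R *v u)) \<mu>0 \<mu>T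
       = conv_BB_cost T (control_affine f0 fs) (\<lambda>x. x \<bullet> (Q *v x)) (\<lambda>u. u \<bullet> (R *v u)) \<mu>0 \<mu>T"
proof (rule antisym)
  have R: "v \<bullet> (R *v v) \<ge> 0" for v using assms(6)[of v] by (cases "v = 0") auto
  show "BB_cost T (control_affine f0 fs) UNIV (\<lambda>t x u. x \<bullet> (Q *v x) + u \<bullet> (R *v u)) \<mu>0 \<mu>T
       \<le> conv_BB_cost T (control_affine f0 fs) (\<lambda>x. x \<bullet> (Q *v x)) (\<lambda>u. u \<bullet> (R *v u)) \<mu>0 \<mu>T"
    unfolding conv_BB_cost_def
    by (rule INF_greatest, clarify, rule BB_cost_le_conv_functional[OF assms(1)])
      (auto intro!: borel_measurable_continuous_onI continuous_on_quadratic_form assms(5) R)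
  obtain A b where f0: "\<And>x. f0 x = A *v x" and fs: "\<And>i x. fs i x = b i"
    and rank: "rank (kalman_matrix A (\<chi> r i. b i $ r)) = CARD('d)"
    using assms(4) unfolding controllable_LTI_def by blast
  define B where "B = (\<chi> r i. b i $ r)"
  have f: "control_affine f0 fs = (\<lambda>x v. A *v x + B *v v)"
    by (intro ext) (simp add: control_affine_def f0 fs B_def matrix_vector_mult_def vec_eq_iff mult.commute)
  \<comment> \<open>The second moment dominates the first through
    \<open>norm x \<le> 1 + norm x powr 2\<close>; the initial first moment is what
    \<open>first_moment_finite\<close> propagates to later times.\<close>
  have "integrable \<mu>0 norm"
  proof (rule Bochner_Integration.integrable_bound)
    interpret prob_space \<mu>0 using assms(2) by (simp add: prob_measures_moment_def prob_measures_def)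
    have [measurable_cong]: "sets \<mu>0 = sets borel" using assms(2) by (simp add: prob_measures_moment_def prob_measures_def)
    show "integrable \<mu>0 (\<lambda>x. 1 + norm x powr 2)"
      using assms(2) by (simp add: prob_measures_moment_def)
    show "norm \<in> borel_measurable \<mu>0" by measurable
    have "norm x \<le> 1 + norm x powr 2" for x :: "real^'d"
    proof (cases "norm x \<le> 1")
      case False
      then have "norm x * 1 \<le> norm x * norm x" by (intro mult_left_mono) auto
      then show ?thesis by (simp add: powr_numeral power2_eq_square)
    qed (simp add: add_increasing2)
    then show "AE x in \<mu>0. norm (norm x) \<le> norm (1 + norm x powr 2)" by simp
  qed
  then show "conv_BB_cost T (control_affine f0 fs) (\<lambda>x. x \<bullet> (Q *v x)) (\<lambda>u. u \<bullet> (R *v u)) \<mu>0 \<mu>T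
       \<le> BB_cost T (control_affine f0 fs) UNIV (\<lambda>t x u. x \<bullet> (Q *v x) + u \<bullet> (R *v u)) \<mu>0 \<mu>T"
    unfolding BB_cost_def f
    using conv_cost_le_BB_integral[OF assms(1) rank[folded B_def] _ _ assms(5,6)]
    by (intro INF_greatest) auto
qed

end
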